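(* Let $g$ be a non-negative operator monotone decreasing function on $(0,\infty)$, let $p,q>1$ with $\frac1p+\frac1q=1$, and let $A,B$ be positive definite operators on a Hilbert space $\mathcal{H}$ such that $0 < sA^p\le B^q\le tA^p$ for some constants $s,t>0$. Then $$g\big(A^p\sharp_{1/q}B^q\big)\le \exp\!\Big(\frac{1}{2pq}\Big(\frac{\max\{1,t\}}{\min\{1,s\}}-1\Big)^2\Big)\,\big(g(A^p)\sharp_{1/q}g(B^q)\big),$$ and for all $\xi\in\mathcal{H}$ $$\big\langle g(A^p\sharp_{1/q}B^q)\xi,\xi\big\rangle\le \exp\!\Big(\frac{1}{2pq}\Big(\frac{\max\{1,t\}}{\min\{1,s\}}-1\Big)^2\Big)\,\langle g(A^p)\xi,\xi\rangle^{1/p}\,\langle g(B^q)\xi,\xi\rangle^{1/q}.$$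
   Context: Operators are bounded linear operators on a Hilbert space. For self-adjoint $A,B$, $A\le B$ means $B-A$ is positive, i.e. $\langle (B-A)x,x\rangle\ge 0$ for all $x$. $A>0$ (positive definite) means $A$ is positive and invertible. Functions and powers of positive definite operators are taken via the continuous functional calculus. A continuous function $g:(0,\infty)\to\mathbb{R}$ is operator monotone decreasing if $A\ge B$ implies $g(A)\le g(B)$ for all positive definite operators $A,B$ (on an arbitrary Hilbert space). For positive definite $A,B$ and $\alpha\in[0,1]$ the $\alpha$-geometric mean is $A\sharp_\alpha B=A^{1/2}(A^{-1/2}BA^{-1/2})^{\alpha}A^{1/2}$, with the convention $0\sharp_\alpha 0=0$ (relevant only if $g\equiv 0$). *)

theory Defs
  imports "HOL-Analysis.Analysis" "HOL-Computational_Algebra.Polynomial"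
    "HOL-Library.Infinite_Typeclass"
begin

text \<open>
  The libraries provide real Hilbert spaces (\<^class>\<open>real_inner\<close> with
  \<^class>\<open>complete_space\<close>).  A complex Hilbert space is such a space with a complex
  scalar multiplication and a complex inner product (linear in the first argument)
  whose real part is the given real inner product; the norm is then the one
  of the complex inner product.
\<close>

class complex_hilbert = real_inner + complete_space +
  fixes scaleC :: "complex \<Rightarrow> 'a \<Rightarrow> 'a"  (infixr "*\<^sub>C" 75)
    and cinner :: "'a \<Rightarrow> 'a \<Rightarrow> complex"
  assumes scaleC_add_right: "a *\<^sub>C (x + y) = a *\<^sub>C x + a *\<^sub>C y"
    and scaleC_add_left: "(a + b) *\<^sub>C x = a *\<^sub>C x + b *\<^sub>C x"
    and scaleC_scaleC: "a *\<^sub>C b *\<^sub>C x = (a * b) *\<^sub>C x"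
    and scaleR_scaleC: "r *\<^sub>R x = complex_of_real r *\<^sub>C x"
    and cinner_commute: "cinner x y = cnj (cinner y x)"
    and cinner_add_left: "cinner (x + y) z = cinner x z + cinner y z"
    and cinner_scaleC_left: "cinner (a *\<^sub>C x) y = a * cinner x y"
    and inner_eq_Re_cinner: "inner x y = Re (cinner x y)"

text \<open>
  Operator monotonicity quantifies over all Hilbert spaces inside a formula, which a type
  variable cannot do.  Hilbert spaces are therefore the closed complex subspaces \<open>H\<close>
  of an ambient complex Hilbert space, given by a type of the class below, which plays
  the role of a universe.  It only has to be infinite-dimensional; it can be as large as
  one likes: the spaces of square-summable families at the end of this theory
  are instances, and every Hilbert space is isometric to a closed subspace of one of them.
\<close>

class hilbert_universe = complex_hilbert +
  assumes infinite_dimensional: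
    "\<exists>e. \<forall>m n::nat. cinner (e m) (e n) = (if m = n then 1 else 0)"

definition hilbert_space :: "'u::complex_hilbert set \<Rightarrow> bool" where
  "hilbert_space H \<longleftrightarrow>
     0 \<in> H \<and> (\<forall>x\<in>H. \<forall>y\<in>H. x + y \<in> H) \<and> (\<forall>c. \<forall>x\<in>H. c *\<^sub>C x \<in> H) \<and> closed H"

text \<open>
  Bounded complex-linear operators on \<open>H\<close>, each extended by zero to the orthogonal
  complement of \<open>H\<close>.  This extension is unique and keeps the operator norm, so the
  set below is the algebra of bounded operators on \<open>H\<close>, with the orthogonal projection
  onto \<open>H\<close> in the role of the identity operator.
\<close>

definition operators :: "'u::complex_hilbert set \<Rightarrow> ('u \<Rightarrow>\<^sub>L 'u) set" where
  "operators H = {T. (\<forall>c x. blinfun_apply T (c *\<^sub>C x) = c *\<^sub>C blinfun_apply T x) \<and>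
     (\<forall>x. blinfun_apply T x \<in> H) \<and>
     (\<forall>x. (\<forall>y\<in>H. cinner x y = 0) \<longrightarrow> blinfun_apply T x = 0)}"

definition ident :: "'u::complex_hilbert set \<Rightarrow> 'u \<Rightarrow>\<^sub>L 'u" where
  "ident H = (THE P. P \<in> operators H \<and> (\<forall>x\<in>H. blinfun_apply P x = x))"

definition invertible_on :: "'u::complex_hilbert set \<Rightarrow> ('u \<Rightarrow>\<^sub>L 'u) \<Rightarrow> bool" where
  "invertible_on H T \<longleftrightarrow>
     T \<in> operators H \<and> (\<exists>R\<in>operators H. T o\<^sub>L R = ident H \<and> R o\<^sub>L T = ident H)"

text \<open>On a complex Hilbert space the positivity below implies self-adjointness.\<close>

definition positive_on :: "'u::complex_hilbert set \<Rightarrow> ('u \<Rightarrow>\<^sub>L 'u) \<Rightarrow> bool" where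
  "positive_on H T \<longleftrightarrow>
     T \<in> operators H \<and> (\<forall>x\<in>H. cinner (blinfun_apply T x) x \<in> \<real>\<^sub>\<ge>\<^sub>0)"

definition op_le :: "'u::complex_hilbert set \<Rightarrow> ('u \<Rightarrow>\<^sub>L 'u) \<Rightarrow> ('u \<Rightarrow>\<^sub>L 'u) \<Rightarrow> bool" where
  "op_le H A B \<longleftrightarrow> positive_on H (B - A)"

definition positive_definite_on :: "'u::complex_hilbert set \<Rightarrow> ('u \<Rightarrow>\<^sub>L 'u) \<Rightarrow> bool" where
  "positive_definite_on H T \<longleftrightarrow> positive_on H T \<and> invertible_on H T"

text \<open>
  The continuous functional calculus is only applied to self-adjoint operators, whose
  spectrum is real; hence real spectral values and real polynomials suffice.
  \<open>f(A)\<close> is the operator approximated in norm by \<open>p(A)\<close> for the polynomials \<open>p\<close> that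
  approximate \<open>f\<close> uniformly on the spectrum.
\<close>

definition spectrum_on :: "'u::complex_hilbert set \<Rightarrow> ('u \<Rightarrow>\<^sub>L 'u) \<Rightarrow> real set" where
  "spectrum_on H A = {x. \<not> invertible_on H (A - x *\<^sub>R ident H)}"

definition poly_op :: "'u::complex_hilbert set \<Rightarrow> real poly \<Rightarrow> ('u \<Rightarrow>\<^sub>L 'u) \<Rightarrow> ('u \<Rightarrow>\<^sub>L 'u)" where
  "poly_op H p A = (\<Sum>i\<le>degree p. coeff p i *\<^sub>R ((\<lambda>T. A o\<^sub>L T) ^^ i) (ident H))"

definition is_cfc :: "'u::complex_hilbert set \<Rightarrow> (real \<Rightarrow> real) \<Rightarrow> ('u \<Rightarrow>\<^sub>L 'u) \<Rightarrow> ('u \<Rightarrow>\<^sub>L 'u) \<Rightarrow> bool" where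
  "is_cfc H f A T \<longleftrightarrow> T \<in> operators H \<and>
     (\<forall>\<epsilon>>0. \<exists>p. (\<forall>x\<in>spectrum_on H A. \<bar>f x - poly p x\<bar> \<le> \<epsilon>) \<and> norm (T - poly_op H p A) \<le> \<epsilon>)"

definition cfc :: "'u::complex_hilbert set \<Rightarrow> (real \<Rightarrow> real) \<Rightarrow> ('u \<Rightarrow>\<^sub>L 'u) \<Rightarrow> ('u \<Rightarrow>\<^sub>L 'u)" where
  "cfc H f A = (THE T. is_cfc H f A T)"

definition op_powr :: "'u::complex_hilbert set \<Rightarrow> ('u \<Rightarrow>\<^sub>L 'u) \<Rightarrow> real \<Rightarrow> ('u \<Rightarrow>\<^sub>L 'u)" where
  "op_powr H A r = cfc H (\<lambda>x. x powr r) A"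

text \<open>Weighted geometric mean of positive definite operators, with the convention that
  the mean of two zero operators is zero.\<close>

definition geometric_mean ::
  "'u::complex_hilbert set \<Rightarrow> real \<Rightarrow> ('u \<Rightarrow>\<^sub>L 'u) \<Rightarrow> ('u \<Rightarrow>\<^sub>L 'u) \<Rightarrow> ('u \<Rightarrow>\<^sub>L 'u)" where
  "geometric_mean H \<alpha> A B =
     (if A = 0 \<and> B = 0 then 0
      else op_powr H A (1/2) o\<^sub>L
           op_powr H (op_powr H A (-1/2) o\<^sub>L B o\<^sub>L op_powr H A (-1/2)) \<alpha> o\<^sub>L
           op_powr H A (1/2))"

text \<open>Only the values of \<open>g\<close> on the positive half-line matter.\<close>

definition operator_monotone_decreasing :: "'u::hilbert_universe itself \<Rightarrow> (real \<Rightarrow> real) \<Rightarrow> bool" where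
  "operator_monotone_decreasing (_ :: 'u itself) g \<longleftrightarrow>
     continuous_on {0<..} g \<and>
     (\<forall>(K::'u set) A B. hilbert_space K \<longrightarrow> positive_definite_on K A \<longrightarrow> positive_definite_on K B \<longrightarrow>
        op_le K B A \<longrightarrow> op_le K (cfc K g A) (cfc K g B))"

text \<open>
  Square-summable families over an arbitrary index type; they show that universes of every
  infinite dimension exist.
\<close>

typedef 'i ell2 = "{f::'i \<Rightarrow> complex. (\<lambda>i. (cmod (f i))\<^sup>2) summable_on UNIV}"
  morphisms ell2_fun Abs_ell2
  by (rule exI[of _ "\<lambda>_. 0"]) simp

setup_lifting type_definition_ell2

lemma ell2_summable: "(\<lambda>i. (cmod (ell2_fun x i))\<^sup>2) summable_on UNIV"
  using ell2_fun[of x] by simp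

lemma cmod_mult_le: "2 * cmod (a * cnj b) \<le> (cmod a)\<^sup>2 + (cmod b)\<^sup>2"
  using zero_le_power2[of "cmod a - cmod b"] by (simp add: power2_diff norm_mult)

lemma cmod_add_sq_le: "(cmod (a + b))\<^sup>2 \<le> 2 * (cmod a)\<^sup>2 + 2 * (cmod b)\<^sup>2"
proof -
  have "(cmod (a + b))\<^sup>2 \<le> (cmod a + cmod b)\<^sup>2"
    by (rule power_mono[OF norm_triangle_ineq]) simp
  moreover have "0 \<le> (cmod a - cmod b)\<^sup>2" by simp
  ultimately show ?thesis by (simp add: power2_sum power2_diff)
qed

lemma summable_add_sq:
  assumes "(\<lambda>i. (cmod (f i))\<^sup>2) summable_on UNIV" "(\<lambda>i. (cmod (h i))\<^sup>2) summable_on UNIV"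
  shows "(\<lambda>i. (cmod (f i + h i))\<^sup>2) summable_on UNIV"
  by (rule summable_on_comparison_test
        [OF summable_on_add[OF summable_on_cmult_right[OF assms(1), of 2]
                               summable_on_cmult_right[OF assms(2), of 2]]])
     (use cmod_add_sq_le in auto)

lemma summable_scale_sq:
  assumes "(\<lambda>i. (cmod (f i))\<^sup>2) summable_on UNIV"
  shows "(\<lambda>i. (cmod (c * f i))\<^sup>2) summable_on UNIV"
  using summable_on_cmult_right[OF assms, of "(cmod c)\<^sup>2"]
  by (simp add: norm_mult power_mult_distrib)

lemma ell2_prod_summable: "(\<lambda>i. ell2_fun x i * cnj (ell2_fun y i)) summable_on UNIV"
proof (rule abs_summable_summable)
  show "(\<lambda>i. norm (ell2_fun x i * cnj (ell2_fun y i))) summable_on UNIV"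
  proof (rule summable_on_comparison_test)
    show "(\<lambda>i. (cmod (ell2_fun x i))\<^sup>2 + (cmod (ell2_fun y i))\<^sup>2) summable_on UNIV"
      by (intro summable_on_add ell2_summable)
    show "norm (ell2_fun x i * cnj (ell2_fun y i))
        \<le> (cmod (ell2_fun x i))\<^sup>2 + (cmod (ell2_fun y i))\<^sup>2" for i
      using cmod_mult_le[of "ell2_fun x i" "ell2_fun y i"]
        norm_ge_zero[of "ell2_fun x i * cnj (ell2_fun y i)"] by linarith
  qed simp
qed

instantiation ell2 :: (type) ab_group_add
begin
lift_definition zero_ell2 :: "'a ell2" is "\<lambda>_. 0" by simp
lift_definition plus_ell2 :: "'a ell2 \<Rightarrow> 'a ell2 \<Rightarrow> 'a ell2" is "\<lambda>f h i. f i + h i"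
  by (simp add: summable_add_sq)
lift_definition uminus_ell2 :: "'a ell2 \<Rightarrow> 'a ell2" is "\<lambda>f i. - f i" by simp
lift_definition minus_ell2 :: "'a ell2 \<Rightarrow> 'a ell2 \<Rightarrow> 'a ell2" is "\<lambda>f h i. f i - h i"
proof -
  fix f h :: "'a \<Rightarrow> complex"
  assume "(\<lambda>i. (cmod (f i))\<^sup>2) summable_on UNIV" "(\<lambda>i. (cmod (h i))\<^sup>2) summable_on UNIV"
  then show "(\<lambda>i. (cmod (f i - h i))\<^sup>2) summable_on UNIV"
    using summable_add_sq[of f "\<lambda>i. - h i"] by simp
qed
instance by (standard; transfer; auto simp: fun_eq_iff)
end

instantiation ell2 :: (type) real_vector
begin
lift_definition scaleR_ell2 :: "real \<Rightarrow> 'a ell2 \<Rightarrow> 'a ell2" is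
  "\<lambda>r f i. complex_of_real r * f i"
  by (simp only: mem_Collect_eq summable_scale_sq)
instance by (standard; transfer; simp add: algebra_simps)
end

definition ell2_cinner :: "'i ell2 \<Rightarrow> 'i ell2 \<Rightarrow> complex" where
  "ell2_cinner x y = (\<Sum>\<^sub>\<infinity>i. ell2_fun x i * cnj (ell2_fun y i))"

lemma ell2_cinner_self:
  "ell2_cinner x x = complex_of_real (\<Sum>\<^sub>\<infinity>i. (cmod (ell2_fun x i))\<^sup>2)"
proof -
  have "((\<lambda>i. complex_of_real ((cmod (ell2_fun x i))\<^sup>2)) has_sum
      complex_of_real (\<Sum>\<^sub>\<infinity>i. (cmod (ell2_fun x i))\<^sup>2)) UNIV"
    by (intro has_sum_of_real has_sum_infsum ell2_summable)
  then show ?thesis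
    unfolding ell2_cinner_def complex_norm_square by (rule infsumI)
qed

lemma ell2_cinner_add: "ell2_cinner (x + y) z = ell2_cinner x z + ell2_cinner y z"
  unfolding ell2_cinner_def plus_ell2.rep_eq distrib_right
  by (rule infsum_add[OF ell2_prod_summable ell2_prod_summable])

lemma ell2_cinner_commute: "ell2_cinner x y = cnj (ell2_cinner y x)"
  unfolding ell2_cinner_def infsum_cnj[symmetric] by (simp add: mult.commute)

lemma ell2_cinner_scaleR: "ell2_cinner (r *\<^sub>R x) y = complex_of_real r * ell2_cinner x y"
  unfolding ell2_cinner_def scaleR_ell2.rep_eq mult.assoc
  by (rule infsum_cmult_right')

lemma ell2_sq_sum_le:
  "finite F \<Longrightarrow> (\<Sum>i\<in>F. (cmod (ell2_fun x i))\<^sup>2) \<le> (\<Sum>\<^sub>\<infinity>i. (cmod (ell2_fun x i))\<^sup>2)"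
  by (rule finite_sum_le_infsum[OF ell2_summable]) auto

lemma ell2_cinner_self_eq_0: "Re (ell2_cinner x x) = 0 \<longleftrightarrow> x = 0"
proof
  assume "Re (ell2_cinner x x) = 0"
  then have "(cmod (ell2_fun x i))\<^sup>2 \<le> 0" for i
    using ell2_sq_sum_le[of "{i}" x] by (simp add: ell2_cinner_self)
  then show "x = 0"
    by (simp add: ell2_fun_inject[symmetric] zero_ell2.rep_eq fun_eq_iff)
next
  show "x = 0 \<Longrightarrow> Re (ell2_cinner x x) = 0"
    by (simp add: ell2_cinner_self zero_ell2.rep_eq)
qed

instantiation ell2 :: (type) real_inner
begin
definition inner_ell2 :: "'a ell2 \<Rightarrow> 'a ell2 \<Rightarrow> real" where
  "inner_ell2 x y = Re (ell2_cinner x y)"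
definition norm_ell2 :: "'a ell2 \<Rightarrow> real" where
  "norm_ell2 x = sqrt (inner x x)"
definition dist_ell2 :: "'a ell2 \<Rightarrow> 'a ell2 \<Rightarrow> real" where
  "dist_ell2 x y = norm (x - y)"
definition sgn_ell2 :: "'a ell2 \<Rightarrow> 'a ell2" where
  "sgn_ell2 x = x /\<^sub>R norm x"
definition uniformity_ell2 :: "('a ell2 \<times> 'a ell2) filter" where
  "uniformity_ell2 = (INF e\<in>{0<..}. principal {(x, y). dist x y < e})"
definition open_ell2 :: "'a ell2 set \<Rightarrow> bool" where
  "open_ell2 U \<longleftrightarrow> (\<forall>x\<in>U. \<forall>\<^sub>F (x', y) in uniformity. x' = x \<longrightarrow> y \<in> U)"

instance
proof intro_classes
  fix x y z :: "'a ell2" and r :: real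
  show "inner x y = inner y x"
    unfolding inner_ell2_def by (subst ell2_cinner_commute) simp
  show "inner (x + y) z = inner x z + inner y z"
    by (simp add: inner_ell2_def ell2_cinner_add)
  show "inner (r *\<^sub>R x) y = r * inner x y"
    by (simp add: inner_ell2_def ell2_cinner_scaleR)
  show "0 \<le> inner x x"
    by (simp add: inner_ell2_def ell2_cinner_self infsum_nonneg)
  show "inner x x = 0 \<longleftrightarrow> x = 0"
    by (simp add: inner_ell2_def ell2_cinner_self_eq_0)
qed (rule sgn_ell2_def dist_ell2_def norm_ell2_def uniformity_ell2_def open_ell2_def)+

end

lemma ell2_norm_sq: "(norm x)\<^sup>2 = (\<Sum>\<^sub>\<infinity>i. (cmod (ell2_fun x i))\<^sup>2)"
  by (simp add: power2_norm_eq_inner inner_ell2_def ell2_cinner_self)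

lemma ell2_dist_sum:
  "finite F \<Longrightarrow> (\<Sum>i\<in>F. (cmod (ell2_fun x i - ell2_fun y i))\<^sup>2) \<le> (dist x y)\<^sup>2"
  using ell2_sq_sum_le[of F "x - y"] by (simp add: dist_norm ell2_norm_sq minus_ell2.rep_eq)

lemma ell2_dist_coord: "dist (ell2_fun x i) (ell2_fun y i) \<le> dist x y"
  using ell2_dist_sum[of "{i}" x y] by (auto simp: dist_norm intro: power2_le_imp_le)

instantiation ell2 :: (type) complex_hilbert
begin

lift_definition scaleC_ell2 :: "complex \<Rightarrow> 'a ell2 \<Rightarrow> 'a ell2" is "\<lambda>c f i. c * f i"
  by (simp only: mem_Collect_eq summable_scale_sq)

definition cinner_ell2 :: "'a ell2 \<Rightarrow> 'a ell2 \<Rightarrow> complex" where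
  "cinner_ell2 = ell2_cinner"

instance
proof intro_classes
  fix x y z :: "'a ell2" and a b :: complex and r :: real
  show "a *\<^sub>C (x + y) = a *\<^sub>C x + a *\<^sub>C y" by transfer (simp add: algebra_simps)
  show "(a + b) *\<^sub>C x = a *\<^sub>C x + b *\<^sub>C x" by transfer (simp add: algebra_simps)
  show "a *\<^sub>C b *\<^sub>C x = (a * b) *\<^sub>C x" by transfer (simp add: algebra_simps)
  show "r *\<^sub>R x = complex_of_real r *\<^sub>C x" by transfer simp
  show "cinner x y = cnj (cinner y x)"
    unfolding cinner_ell2_def by (rule ell2_cinner_commute)
  show "cinner (x + y) z = cinner x z + cinner y z"
    unfolding cinner_ell2_def by (rule ell2_cinner_add)
  show "cinner (a *\<^sub>C x) y = a * cinner x y"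
    unfolding cinner_ell2_def ell2_cinner_def scaleC_ell2.rep_eq mult.assoc
    by (rule infsum_cmult_right')
  show "inner x y = Re (cinner x y)"
    by (simp add: inner_ell2_def cinner_ell2_def)
next
  fix X :: "nat \<Rightarrow> 'a ell2"
  assume "Cauchy X"
  then have cau: "\<exists>M. \<forall>m\<ge>M. \<forall>n\<ge>M. dist (X m) (X n) < e" if "0 < e" for e
    using that by (auto simp: Cauchy_def)
  have "Cauchy (\<lambda>n. ell2_fun (X n) i)" for i
  proof (rule metric_CauchyI)
    fix e :: real assume "0 < e"
    from cau[OF this] show "\<exists>M. \<forall>m\<ge>M. \<forall>n\<ge>M. dist (ell2_fun (X m) i) (ell2_fun (X n) i) < e"
      by (meson ell2_dist_coord le_less_trans)
  qed
  then have "\<exists>l. (\<lambda>n. ell2_fun (X n) i) \<longlonglongrightarrow> l" for i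
    by (simp add: Cauchy_convergent_iff convergent_def)
  then obtain h where h: "(\<lambda>n. ell2_fun (X n) i) \<longlonglongrightarrow> h i" for i by metis
  have lim_sum: "(\<Sum>i\<in>F. (cmod (ell2_fun (X m) i - h i))\<^sup>2) \<le> e\<^sup>2"
    if M: "\<forall>m\<ge>M. \<forall>n\<ge>M. dist (X m) (X n) < e" and "m \<ge> M" and "finite F" for m M e F
  proof (rule LIMSEQ_le_const2)
    show "(\<lambda>n. \<Sum>i\<in>F. (cmod (ell2_fun (X m) i - ell2_fun (X n) i))\<^sup>2)
        \<longlonglongrightarrow> (\<Sum>i\<in>F. (cmod (ell2_fun (X m) i - h i))\<^sup>2)"
      by (intro tendsto_intros h)
    have "(\<Sum>i\<in>F. (cmod (ell2_fun (X m) i - ell2_fun (X n) i))\<^sup>2) \<le> e\<^sup>2" if "n \<ge> M" for n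
    proof -
      have "(dist (X m) (X n))\<^sup>2 \<le> e\<^sup>2"
        using M \<open>m \<ge> M\<close> that by (intro power_mono) (auto intro: less_imp_le)
      then show ?thesis using ell2_dist_sum[OF \<open>finite F\<close>, of "X m" "X n"] by linarith
    qed
    then show "\<exists>N. \<forall>n\<ge>N. (\<Sum>i\<in>F. (cmod (ell2_fun (X m) i - ell2_fun (X n) i))\<^sup>2) \<le> e\<^sup>2"
      by blast
  qed
  have diff_sm: "(\<lambda>i. (cmod (ell2_fun (X m) i - h i))\<^sup>2) summable_on UNIV"
    if M: "\<forall>m\<ge>M. \<forall>n\<ge>M. dist (X m) (X n) < e" and "m \<ge> M" for m M e
  proof (rule nonneg_bdd_above_summable_on)
    show "bdd_above (sum (\<lambda>i. (cmod (ell2_fun (X m) i - h i))\<^sup>2) ` {F. F \<subseteq> UNIV \<and> finite F})"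
      by (rule bdd_aboveI2[of _ _ "e\<^sup>2"]) (use lim_sum[OF that] in auto)
  qed simp
  obtain M1 where M1: "\<forall>m\<ge>M1. \<forall>n\<ge>M1. dist (X m) (X n) < 1" using cau[of 1] by auto
  have "(\<lambda>i. (cmod (h i - ell2_fun (X M1) i))\<^sup>2) summable_on UNIV"
    using diff_sm[OF M1 order_refl] by (simp add: norm_minus_commute)
  from summable_add_sq[OF ell2_summable[of "X M1"] this]
  have hsm: "(\<lambda>i. (cmod (h i))\<^sup>2) summable_on UNIV" by simp
  define L where "L = Abs_ell2 h"
  have L: "ell2_fun L = h" unfolding L_def using hsm by (simp add: Abs_ell2_inverse)
  have "X \<longlonglongrightarrow> L"
  proof (rule metric_LIMSEQ_I)
    fix e :: real assume "0 < e"
    then obtain M where M: "\<forall>m\<ge>M. \<forall>n\<ge>M. dist (X m) (X n) < e / 2"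
      using cau[of "e / 2"] by auto
    have "dist (X n) L < e" if "n \<ge> M" for n
    proof -
      have "(norm (X n - L))\<^sup>2 \<le> (e / 2)\<^sup>2"
        unfolding ell2_norm_sq minus_ell2.rep_eq L
        by (rule infsum_le_finite_sums[OF diff_sm[OF M that] lim_sum[OF M that]])
      then have "dist (X n) L \<le> e / 2"
        using \<open>0 < e\<close> by (auto simp: dist_norm intro: power2_le_imp_le)
      then show ?thesis using \<open>0 < e\<close> by linarith
    qed
    then show "\<exists>N. \<forall>n\<ge>N. dist (X n) L < e" by blast
  qed
  then show "convergent X" by (rule convergentI)
qed

end

lift_definition ell2_unit :: "'i \<Rightarrow> 'i ell2" is "\<lambda>j i. if i = j then 1 else 0"
proof -
  fix j :: 'i
  have "(\<lambda>i. (cmod (if i = j then 1 else 0))\<^sup>2) summable_on {j}" by simp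
  then show "(\<lambda>i. (cmod (if i = j then 1 else 0))\<^sup>2) summable_on UNIV"
    by (rule summable_on_cong_neutral[THEN iffD1, rotated -1]) auto
qed

lemma ell2_cinner_unit: "cinner (ell2_unit j) (ell2_unit k) = (if j = k then 1 else 0)"
proof -
  have "cinner (ell2_unit j) (ell2_unit k) = (\<Sum>\<^sub>\<infinity>i\<in>{j}. if j = k then 1 else 0)"
    unfolding cinner_ell2_def ell2_cinner_def ell2_unit.rep_eq
    by (rule infsum_cong_neutral) auto
  then show ?thesis by simp
qed

instance ell2 :: (infinite) hilbert_universe
proof
  obtain f :: "nat \<Rightarrow> 'a" where "inj f"
    using infinite_countable_subset[OF infinite_UNIV] by blast
  then show "\<exists>e. \<forall>m n::nat. cinner (e m) (e n :: 'a ell2) = (if m = n then 1 else 0)"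
    by (intro exI[of _ "\<lambda>n. ell2_unit (f n)"]) (auto simp: ell2_cinner_unit dest: injD)
qed

end

theory Submission
  imports Defs "HOL-Computational_Algebra.Fundamental_Theorem_Algebra"
begin

text \<open>
  Write \<open>P = A\<^sup>p\<close>, \<open>Q = B\<^sup>q\<close> and \<open>\<alpha> = 1/q\<close>, so that \<open>1 - \<alpha> = 1/p\<close>; let \<open>P \<sharp> Q\<close> be the \<open>\<alpha>\<close>-geometric
  mean, \<open>C = (1 - \<alpha>) P + \<alpha> Q\<close> the arithmetic mean, and \<open>l\<close> the exponential constant.  The first
  inequality is the chain
  \<open>g (P \<sharp> Q) \<le> l g (l (P \<sharp> Q)) \<le> l g (C) \<le> l (g P \<sharp> g Q)\<close>.

  The middle step is monotonicity of \<open>g\<close> together with \<open>C \<le> l (P \<sharp> Q)\<close>.  After conjugation with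
  \<open>P\<^sup>-\<^sup>1\<^sup>/\<^sup>2\<close> the latter is the scalar inequality \<open>(1 - \<alpha>) + \<alpha> x \<le> l x powr \<alpha>\<close> on \<open>{s..t}\<close>
  (\<open>reverse_young\<close>, \<open>geometric_mean_ge_linear\<close>).  The other two steps rest on the fact that
  \<open>h = 1 / g\<close> preserves the operator order and is therefore operator concave
  (\<open>monotone_imp_concave\<close>); here \<open>g\<close> is positive, since otherwise it vanishes identically
  (\<open>vanishing_dichotomy\<close>) and all terms are zero.  For numbers, concavity and positivity of \<open>h\<close> give \<open>h (l x) \<le> l h x\<close>, which is
  the first step (\<open>dilation_bound\<close>).  For operators, concavity says that \<open>g (C)\<close> lies below the
  harmonic mean of \<open>g P\<close> and \<open>g Q\<close>, and the harmonic mean lies below the geometric mean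
  (\<open>geometric_mean_inverse\<close>, \<open>op_monotone_decreasing_geometrically_convex\<close>).  The second inequality follows
  from the first by \<open>\<langle>(S \<sharp> T) \<xi>, \<xi>\<rangle> \<le> \<langle>S \<xi>, \<xi>\<rangle> powr (1 - \<alpha>) * \<langle>T \<xi>, \<xi>\<rangle> powr \<alpha>\<close>, which comes from comparing
  \<open>y powr \<alpha>\<close> with its tangents (\<open>geometric_mean_hoelder\<close>).

  That order preservation implies concavity is the classical argument with \<open>2 \<times> 2\<close> operator matrices: a
  rotation of \<open>X \<oplus> Y\<close> has the convex combination \<open>Z\<close> of \<open>X\<close> and \<open>Y\<close> in its corner, and it is dominated by a
  diagonal matrix with almost the same corner.  The argument needs a copy of \<open>H \<oplus> H\<close> inside the
  ambient space.  For finite-dimensional \<open>H\<close> Gram-Schmidt orthogonalisation provides one; in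
  general \<open>H\<close> is compressed to the span of the vectors \<open>X\<^sup>k \<xi>\<close>, \<open>Y\<^sup>k \<xi>\<close>, \<open>Z\<^sup>k \<xi>\<close> with \<open>k \<le> d\<close>, which does not
  change the action of polynomials of degree \<open>d\<close> on \<open>\<xi>\<close>, and \<open>h\<close> is approximated by such a polynomial.

  The continuous functional calculus is developed along the way.  Its basis is
  \<open>norm_poly_op_attained\<close>: the norm of \<open>q(A)\<close>, for self-adjoint \<open>A\<close> on a non-zero space, is the value of \<open>\<bar>q\<bar>\<close> at some
  point of the spectrum.  Afterwards only intervals \<open>{m..M}\<close> with \<open>m \<le> A \<le> M\<close> occur in
  place of the spectrum.
\<close>

notation (input) blinfun_apply (infixl "\<cdot>" 90)

section \<open>Closed subspaces of a complex Hilbert space and their operators\<close>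

instance complex_hilbert \<subseteq> banach ..

lemma scaleC_1 [simp]: "1 *\<^sub>C (x::'u::complex_hilbert) = x"
  by (metis of_real_1 scaleR_one scaleR_scaleC)

lemma scaleC_zero_right [simp]: "c *\<^sub>C (0::'u::complex_hilbert) = 0"
  using scaleC_add_right[of c 0 "0::'u"] by simp

lemma scaleC_zero_left [simp]: "0 *\<^sub>C (x::'u::complex_hilbert) = 0"
  using scaleC_add_left[of 0 0 x] by simp

lemma scaleC_minus_right: "c *\<^sub>C (- x) = - (c *\<^sub>C (x::'u::complex_hilbert))"
  using scaleC_add_right[of c x "- x"] by (simp add: add_eq_0_iff2)

lemma scaleC_diff_right: "c *\<^sub>C (x - y) = c *\<^sub>C x - c *\<^sub>C (y::'u::complex_hilbert)"
  using scaleC_add_right[of c x "- y"] by (simp add: scaleC_minus_right)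

lemma scaleC_sum_right: "c *\<^sub>C (\<Sum>i\<in>I. f i) = (\<Sum>i\<in>I. c *\<^sub>C (f i::'u::complex_hilbert))"
  by (induction I rule: infinite_finite_induct) (auto simp: scaleC_add_right)

lemma scaleC_scaleR: "c *\<^sub>C r *\<^sub>R x = r *\<^sub>R c *\<^sub>C (x::'u::complex_hilbert)"
  by (simp add: scaleR_scaleC scaleC_scaleC mult.commute)

lemma scaleC_eq: "c *\<^sub>C x = Re c *\<^sub>R x + Im c *\<^sub>R (\<i> *\<^sub>C (x::'u::complex_hilbert))"
proof -
  have "c *\<^sub>C x = (complex_of_real (Re c) + complex_of_real (Im c) * \<i>) *\<^sub>C x"
    by (simp add: complex_eq[symmetric] mult.commute)
  then show ?thesis by (simp add: scaleC_add_left scaleR_scaleC scaleC_scaleC)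
qed

lemma cinner_add_right: "cinner x (y + z) = cinner x y + cinner x (z::'u::complex_hilbert)"
  by (metis cinner_add_left cinner_commute complex_cnj_add)

lemma cinner_scaleC_right: "cinner x (a *\<^sub>C y) = cnj a * cinner x (y::'u::complex_hilbert)"
  by (metis cinner_commute cinner_scaleC_left complex_cnj_mult)

lemma cinner_zero_left [simp]: "cinner 0 (y::'u::complex_hilbert) = 0"
  using cinner_scaleC_left[of 0 y y] by simp

lemma cinner_sum_left: "cinner (\<Sum>i\<in>I. f i) y = (\<Sum>i\<in>I. cinner (f i) (y::'u::complex_hilbert))"
  by (induction I rule: infinite_finite_induct) (auto simp: cinner_add_left)

lemma cinner_diff_left: "cinner (x - y) z = cinner x z - cinner y (z::'u::complex_hilbert)"
  using cinner_add_left[of "x - y" y z] by simp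

lemma cinner_eq: "cinner x y = Complex (inner x y) (inner x (\<i> *\<^sub>C (y::'u::complex_hilbert)))"
  by (simp add: complex_eq_iff inner_eq_Re_cinner cinner_scaleC_right)

lemma inner_iC_left: "inner (\<i> *\<^sub>C x) y = - inner x (\<i> *\<^sub>C (y::'u::complex_hilbert))"
  by (simp add: inner_eq_Re_cinner cinner_scaleC_right cinner_scaleC_left)

lemma norm_scaleC: "norm (c *\<^sub>C x) = cmod c * norm (x::'u::complex_hilbert)"
proof -
  have "cinner (c *\<^sub>C x) (c *\<^sub>C x) = (c * cnj c) * cinner x x"
    by (simp add: cinner_scaleC_left cinner_scaleC_right)
  then have "inner (c *\<^sub>C x) (c *\<^sub>C x) = (cmod c)\<^sup>2 * inner x x"
    by (simp add: inner_eq_Re_cinner complex_norm_square[symmetric] del: of_real_power)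
  then show ?thesis by (simp add: norm_eq_sqrt_inner real_sqrt_mult)
qed

text \<open>In a complex subspace orthogonality is already decided by the real inner product, because
  the imaginary part of \<open>cinner x y\<close> is the real inner product of \<open>x\<close> with another
  vector of the subspace.  This is why the real inner product suffices from here on.\<close>

lemma orthogonal_iff_inner:
  assumes "hilbert_space (H::'u::complex_hilbert set)"
  shows "(\<forall>y\<in>H. cinner x y = 0) \<longleftrightarrow> (\<forall>y\<in>H. inner x y = 0)"
  using assms by (auto simp: cinner_eq hilbert_space_def complex_eq_iff)

lemma hilbert_space_D:
  assumes "hilbert_space (H::'u::complex_hilbert set)"
  shows "0 \<in> H" "x \<in> H \<Longrightarrow> y \<in> H \<Longrightarrow> x + y \<in> H" "x \<in> H \<Longrightarrow> c *\<^sub>C x \<in> H"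
    "x \<in> H \<Longrightarrow> r *\<^sub>R x \<in> H" "x \<in> H \<Longrightarrow> y \<in> H \<Longrightarrow> x - y \<in> H" "closed H"
proof -
  show 1: "0 \<in> H" "x \<in> H \<Longrightarrow> c *\<^sub>C x \<in> H" "closed H" for x c
    using assms by (auto simp: hilbert_space_def)
  show 2: "x \<in> H \<Longrightarrow> y \<in> H \<Longrightarrow> x + y \<in> H" for x y
    using assms by (auto simp: hilbert_space_def)
  show 3: "x \<in> H \<Longrightarrow> r *\<^sub>R x \<in> H" for x r
    using 1(2) by (simp add: scaleR_scaleC)
  show "x \<in> H \<Longrightarrow> y \<in> H \<Longrightarrow> x - y \<in> H"
    using 2[of x "- y"] 3[of y "-1"] by simp
qed

lemma hilbert_space_sum:
  "hilbert_space (H::'u::complex_hilbert set) \<Longrightarrow> (\<And>i. i \<in> I \<Longrightarrow> f i \<in> H) \<Longrightarrow> (\<Sum>i\<in>I. f i) \<in> H"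
  by (induction I rule: infinite_finite_induct) (auto simp: hilbert_space_D)

text \<open>A sequence in \<open>H\<close> that minimises the distance to \<open>x\<close> is Cauchy by
  the parallelogram law, and its limit is a nearest point; moving along a direction \<open>z\<close>
  of \<open>H\<close> cannot bring it closer, which is orthogonality.\<close>

lemma orthogonal_decomposition:
  assumes hs: "hilbert_space (H::'u::complex_hilbert set)"
  shows "\<exists>y\<in>H. \<forall>z\<in>H. inner (x - y) z = 0"
proof -
  note H = hilbert_space_D[OF hs]
  define d where "d = Inf ((\<lambda>y. (norm (x - y))\<^sup>2) ` H)"
  have bb: "bdd_below ((\<lambda>y. (norm (x - y))\<^sup>2) ` H)"
    by (rule bdd_belowI2[of _ 0]) simp
  have dle: "d \<le> (norm (x - y))\<^sup>2" if "y \<in> H" for y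
    unfolding d_def by (rule cINF_lower[OF bb that])
  have "\<exists>y\<in>H. (norm (x - y))\<^sup>2 < d + inverse (real (Suc n))" for n
    using cInf_less_iff[OF _ bb, of "d + inverse (real (Suc n))"] H(1) unfolding d_def by auto
  then obtain f where f: "\<And>n. f n \<in> H" "\<And>n. (norm (x - f n))\<^sup>2 < d + inverse (real (Suc n))"
    by metis
  have par: "(norm (f m - f n))\<^sup>2 \<le> 2 * (inverse (real (Suc m)) + inverse (real (Suc n)))" for m n
  proof -
    have "(norm ((x - f m) + (x - f n)))\<^sup>2 + (norm ((x - f m) - (x - f n)))\<^sup>2
        = 2 * (norm (x - f m))\<^sup>2 + 2 * (norm (x - f n))\<^sup>2"
      by (simp add: power2_norm_eq_inner algebra_simps inner_commute)
    moreover have "(x - f m) + (x - f n) = 2 *\<^sub>R (x - (1/2) *\<^sub>R (f m + f n))"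
      by (simp add: algebra_simps scaleR_2)
    then have "(norm ((x - f m) + (x - f n)))\<^sup>2 = 4 * (norm (x - (1/2) *\<^sub>R (f m + f n)))\<^sup>2"
      by (simp only: norm_scaleR power_mult_distrib) simp
    moreover have "d \<le> (norm (x - (1/2) *\<^sub>R (f m + f n)))\<^sup>2"
      by (intro dle H f)
    moreover have "(x - f m) - (x - f n) = f n - f m" by simp
    ultimately show ?thesis using f(2)[of m] f(2)[of n] by (simp add: norm_minus_commute)
  qed
  have "Cauchy f"
  proof (rule metric_CauchyI)
    fix e :: real assume "0 < e"
    then obtain N where N: "inverse (real (Suc N)) < e\<^sup>2 / 4"
      using reals_Archimedean[of "e\<^sup>2 / 4"] by auto
    have "dist (f m) (f n) < e" if "m \<ge> N" "n \<ge> N" for m n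
    proof -
      have "inverse (real (Suc k)) < e\<^sup>2 / 4" if "k \<ge> N" for k
        using le_less_trans[OF le_imp_inverse_le N] that by simp
      from add_strict_mono[OF this[OF \<open>m \<ge> N\<close>] this[OF \<open>n \<ge> N\<close>]]
      have "(norm (f m - f n))\<^sup>2 < e\<^sup>2" using par[of m n] by simp
      then show ?thesis using \<open>0 < e\<close> by (simp add: dist_norm power_less_imp_less_base)
    qed
    then show "\<exists>M. \<forall>m\<ge>M. \<forall>n\<ge>M. dist (f m) (f n) < e" by blast
  qed
  then obtain y where y: "f \<longlonglongrightarrow> y" by (auto simp: Cauchy_convergent_iff convergent_def)
  have "y \<in> H" using closed_sequentially[OF H(6) _ y] f(1) by auto
  have "(norm (x - y))\<^sup>2 \<le> d + 0"
  proof (rule LIMSEQ_le)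
    show "(\<lambda>n. (norm (x - f n))\<^sup>2) \<longlonglongrightarrow> (norm (x - y))\<^sup>2" by (intro tendsto_intros y)
    show "(\<lambda>n. d + inverse (real (Suc n))) \<longlonglongrightarrow> d + 0"
      by (intro tendsto_intros LIMSEQ_inverse_real_of_nat)
  qed (use f(2) in \<open>auto intro: less_imp_le\<close>)
  then have yd: "(norm (x - y))\<^sup>2 \<le> d" by simp
  have "inner (x - y) z = 0" if "z \<in> H" for z
  proof (rule ccontr)
    assume nz: "inner (x - y) z \<noteq> 0"
    then have "inner z z > 0" by auto
    define r where "r = inner (x - y) z / inner z z"
    have "(norm (x - y))\<^sup>2 \<le> (norm (x - (y + r *\<^sub>R z)))\<^sup>2"
      by (rule order_trans[OF yd dle]) (intro H \<open>y \<in> H\<close> that)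
    also have "x - (y + r *\<^sub>R z) = (x - y) - r *\<^sub>R z" by simp
    also have "(norm ((x - y) - r *\<^sub>R z))\<^sup>2 = (norm (x - y))\<^sup>2 - 2 * r * inner (x - y) z + r * r * inner z z"
      by (simp add: power2_norm_eq_inner algebra_simps inner_commute)
    also have "r * r * inner z z = r * inner (x - y) z"
      using \<open>inner z z > 0\<close> by (simp add: r_def)
    finally have "r * inner (x - y) z \<le> 0" by linarith
    moreover have "r * inner (x - y) z > 0"
      using nz \<open>inner z z > 0\<close> by (simp add: r_def flip: power2_eq_square)
    ultimately show False by simp
  qed
  with \<open>y \<in> H\<close> show ?thesis by blast
qed

lemma operatorsI:
  assumes "\<And>c x. T \<cdot> (c *\<^sub>C x) = c *\<^sub>C T \<cdot> x" "\<And>x. T \<cdot> x \<in> H"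
    "\<And>x. (\<forall>y\<in>H. inner x y = 0) \<Longrightarrow> T \<cdot> x = 0" "hilbert_space (H::'u::complex_hilbert set)"
  shows "T \<in> operators H"
  using assms orthogonal_iff_inner[OF assms(4)] by (auto simp: operators_def)

lemma operators_scaleC: "T \<in> operators H \<Longrightarrow> T \<cdot> (c *\<^sub>C x) = c *\<^sub>C T \<cdot> x"
  by (simp add: operators_def)

lemma operators_in: "T \<in> operators H \<Longrightarrow> T \<cdot> x \<in> H"
  by (simp add: operators_def)

context
  fixes H :: "'u::complex_hilbert set"
  assumes hs: "hilbert_space H"
begin

lemma projection_exists: "\<exists>P\<in>operators H. \<forall>x\<in>H. P \<cdot> x = x"
proof -
  note H = hilbert_space_D[OF hs]
  obtain p where p: "\<And>x. p x \<in> H" "\<And>x z. z \<in> H \<Longrightarrow> inner (x - p x) z = 0"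
    using orthogonal_decomposition[OF hs] by metis
  have uniq: "p x = y" if "y \<in> H" "\<And>z. z \<in> H \<Longrightarrow> inner (x - y) z = 0" for x y
  proof -
    have "inner (p x - y) (p x - y) = inner (x - y) (p x - y) - inner (x - p x) (p x - y)"
      by (simp add: algebra_simps)
    also have "\<dots> = 0" using that p H(5) by simp
    finally show ?thesis by simp
  qed
  have padd: "p (x + y) = p x + p y" for x y
  proof (rule uniq)
    fix z assume "z \<in> H"
    then show "inner (x + y - (p x + p y)) z = 0"
      using p(2)[of z x] p(2)[of z y] by (simp add: algebra_simps)
  qed (intro H p)
  have psc: "p (c *\<^sub>C x) = c *\<^sub>C p x" for c x
  proof (rule uniq)
    fix z assume z: "z \<in> H"
    have "inner (c *\<^sub>C x - c *\<^sub>C p x) z = Re (cinner (c *\<^sub>C (x - p x)) z)"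
      by (simp add: inner_eq_Re_cinner scaleC_diff_right)
    also have "cinner (x - p x) z = 0"
      using orthogonal_iff_inner[OF hs, of "x - p x"] p(2) z by auto
    then have "Re (cinner (c *\<^sub>C (x - p x)) z) = 0" by (simp add: cinner_scaleC_left)
    finally show "inner (c *\<^sub>C x - c *\<^sub>C p x) z = 0" .
  qed (intro H p)
  have pnorm: "norm (p x) \<le> norm x" for x
  proof -
    have "(norm (p x))\<^sup>2 = inner x (p x)" using p(2)[OF p(1), of x x]
      by (simp add: power2_norm_eq_inner algebra_simps)
    also have "\<dots> \<le> norm x * norm (p x)" by (rule norm_cauchy_schwarz)
    finally show ?thesis by (cases "norm (p x) = 0") (auto simp: power2_eq_square)
  qed
  have bl: "bounded_linear p"
    by (rule bounded_linear_intro[of _ 1]) (use padd psc pnorm in \<open>auto simp: scaleR_scaleC\<close>)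
  have app: "blinfun_apply (Blinfun p) = p" by (rule bounded_linear_Blinfun_apply[OF bl])
  have "Blinfun p \<in> operators H"
    by (rule operatorsI[OF _ _ _ hs]) (use psc p(1) uniq H(1) in \<open>auto simp: app\<close>)
  moreover have "p x = x" if "x \<in> H" for x using uniq[of x x] that by simp
  ultimately show ?thesis by (intro bexI[of _ "Blinfun p"]) (auto simp: app)
qed

lemma operators_orthogonal:
  "T \<in> operators H \<Longrightarrow> (\<And>y. y \<in> H \<Longrightarrow> inner x y = 0) \<Longrightarrow> T \<cdot> x = 0"
  using orthogonal_iff_inner[OF hs, of x] by (auto simp: operators_def)

lemma operators_eqI:
  assumes "S \<in> operators H" "T \<in> operators H" "\<And>x. x \<in> H \<Longrightarrow> S \<cdot> x = T \<cdot> x"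
  shows "S = T"
proof (rule blinfun_eqI)
  fix x
  obtain y where y: "y \<in> H" "\<forall>z\<in>H. inner (x - y) z = 0" using orthogonal_decomposition[OF hs] by blast
  then have "S \<cdot> (x - y) = 0" "T \<cdot> (x - y) = 0"
    using assms by (auto intro: operators_orthogonal)
  then show "S \<cdot> x = T \<cdot> x" using assms(3)[OF y(1)]
    by (simp add: blinfun.bilinear_simps)
qed

lemma ident: "ident H \<in> operators H" "x \<in> H \<Longrightarrow> (ident H) \<cdot> x = x"
proof -
  have "\<exists>!P. P \<in> operators H \<and> (\<forall>x\<in>H. P \<cdot> x = x)"
    using projection_exists operators_eqI by (smt (verit, best))
  from theI'[OF this] show "ident H \<in> operators H" "x \<in> H \<Longrightarrow> (ident H) \<cdot> x = x"
    unfolding ident_def by auto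
qed

lemma ident_orthogonal: "z \<in> H \<Longrightarrow> inner (x - (ident H) \<cdot> x) z = 0"
proof -
  assume z: "z \<in> H"
  obtain y where y: "y \<in> H" "\<forall>z\<in>H. inner (x - y) z = 0" using orthogonal_decomposition[OF hs] by blast
  have "(ident H) \<cdot> (x - y) = 0"
    using y by (intro operators_orthogonal ident) auto
  then have "(ident H) \<cdot> x = y" using ident(2)[OF y(1)] by (simp add: blinfun.bilinear_simps)
  then show ?thesis using y z by simp
qed

lemma operators_ident [simp]:
  assumes "T \<in> operators H"
  shows "T o\<^sub>L ident H = T" "ident H o\<^sub>L T = T" "T \<cdot> ((ident H) \<cdot> x) = T \<cdot> x"
proof -
  have "T \<cdot> (x - (ident H) \<cdot> x) = 0" for x
    by (intro operators_orthogonal assms ident_orthogonal)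
  then show *: "T \<cdot> ((ident H) \<cdot> x) = T \<cdot> x" for x
    by (simp add: blinfun.bilinear_simps)
  show "T o\<^sub>L ident H = T" "ident H o\<^sub>L T = T"
    by (auto intro!: blinfun_eqI simp: * ident operators_in[OF assms])
qed

lemma inner_ident: "inner ((ident H) \<cdot> x) y = inner x ((ident H) \<cdot> y)"
proof -
  have "inner (x - (ident H) \<cdot> x) ((ident H) \<cdot> y) = 0"
       "inner (y - (ident H) \<cdot> y) ((ident H) \<cdot> x) = 0"
    by (intro ident_orthogonal operators_in[OF ident(1)])+
  then show ?thesis by (simp add: algebra_simps inner_commute)
qed

lemma norm_ident_apply_le: "norm ((ident H) \<cdot> x) \<le> norm x"
proof -
  let ?P = "(ident H) \<cdot> x"
  have "(norm ?P)\<^sup>2 = inner x ?P"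
    using ident_orthogonal[OF operators_in[OF ident(1)], of x x] by (simp add: power2_norm_eq_inner algebra_simps)
  also have "\<dots> \<le> norm x * norm ?P" by (rule norm_cauchy_schwarz)
  finally show ?thesis by (cases "norm ?P = 0") (auto simp: power2_eq_square)
qed

lemma operators_zero: "0 \<in> operators H"
  by (simp add: operators_def hilbert_space_D[OF hs])

lemma operators_add: "S \<in> operators H \<Longrightarrow> T \<in> operators H \<Longrightarrow> S + T \<in> operators H"
  by (simp add: operators_def hilbert_space_D[OF hs] blinfun.bilinear_simps scaleC_add_right)

lemma operators_scaleR: "T \<in> operators H \<Longrightarrow> r *\<^sub>R T \<in> operators H"
  by (simp add: operators_def hilbert_space_D[OF hs] blinfun.bilinear_simps scaleC_scaleR)

lemma operators_diff: "S \<in> operators H \<Longrightarrow> T \<in> operators H \<Longrightarrow> S - T \<in> operators H"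
  by (simp add: operators_def hilbert_space_D[OF hs] blinfun.bilinear_simps scaleC_diff_right)

lemma operators_compose: "S \<in> operators H \<Longrightarrow> T \<in> operators H \<Longrightarrow> S o\<^sub>L T \<in> operators H"
  by (simp add: operators_def)

lemma operators_limit:
  assumes "\<And>n. X n \<in> operators H" "X \<longlonglongrightarrow> T"
  shows "T \<in> operators H"
proof -
  have lim: "(\<lambda>n. (X n) \<cdot> x) \<longlonglongrightarrow> T \<cdot> x" for x
    by (intro tendsto_intros assms)
  have cs: "(\<lambda>n. c *\<^sub>C (X n) \<cdot> x) \<longlonglongrightarrow> c *\<^sub>C T \<cdot> x" for c x
  proof -
    have "bounded_linear (\<lambda>x::'u. c *\<^sub>C x)"
      by (rule bounded_linear_intro[of _ "cmod c"])
        (auto simp: scaleC_add_right scaleC_scaleR norm_scaleC)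
    from bounded_linear.tendsto[OF this lim] show ?thesis .
  qed
  show ?thesis
  proof (rule operatorsI[OF _ _ _ hs])
    fix c x
    have "(\<lambda>n. (X n) \<cdot> (c *\<^sub>C x)) \<longlonglongrightarrow> c *\<^sub>C T \<cdot> x"
      using cs[of c x] operators_scaleC[OF assms(1)] by simp
    then show "T \<cdot> (c *\<^sub>C x) = c *\<^sub>C T \<cdot> x"
      using lim LIMSEQ_unique by blast
  next
    fix x show "T \<cdot> x \<in> H"
      using closed_sequentially[OF hilbert_space_D(6)[OF hs] _ lim[of x]] operators_in[OF assms(1)] by auto
  next
    fix x assume "\<forall>y\<in>H. inner x y = 0"
    then have "(X n) \<cdot> x = 0" for n using operators_orthogonal[OF assms(1)] by blast
    then show "T \<cdot> x = 0" using lim[of x] by (simp add: LIMSEQ_const_iff)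
  qed
qed

end

section \<open>Self-adjoint operators and their form bounds\<close>

text \<open>An operator vanishes on the orthogonal complement of \<open>H\<close> and has its values in \<open>H\<close>; its symmetry
  can therefore be stated for all vectors of the ambient space.\<close>

definition self_adjoint_on :: "'u::complex_hilbert set \<Rightarrow> ('u \<Rightarrow>\<^sub>L 'u) \<Rightarrow> bool" where
  "self_adjoint_on H A \<longleftrightarrow> A \<in> operators H \<and>
     (\<forall>x y. inner (A \<cdot> x) y = inner x (A \<cdot> y))"

text \<open>\<open>m \<le> A \<le> M\<close> in the sense of quadratic forms; positive definite means \<open>0 < m\<close> for some
  such bounds.\<close>

definition form_bounds :: "'u::complex_hilbert set \<Rightarrow> real \<Rightarrow> real \<Rightarrow> ('u \<Rightarrow>\<^sub>L 'u) \<Rightarrow> bool" where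
  "form_bounds H m M A \<longleftrightarrow> self_adjoint_on H A \<and>
     (\<forall>x\<in>H. m * inner x x \<le> inner (A \<cdot> x) x \<and> inner (A \<cdot> x) x \<le> M * inner x x)"

lemma self_adjoint_onD:
  assumes "self_adjoint_on H A"
  shows "A \<in> operators H" "inner (A \<cdot> x) y = inner x (A \<cdot> y)"
  using assms by (auto simp: self_adjoint_on_def)

lemma form_boundsD:
  assumes "form_bounds H m M A"
  shows "self_adjoint_on H A" "A \<in> operators H"
    "inner (A \<cdot> x) y = inner x (A \<cdot> y)"
    "x \<in> H \<Longrightarrow> m * inner x x \<le> inner (A \<cdot> x) x"
    "x \<in> H \<Longrightarrow> inner (A \<cdot> x) x \<le> M * inner x x"
  using assms by (auto simp: form_bounds_def self_adjoint_on_def)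

lemma form_bounds_mono:
  "form_bounds H m M A \<Longrightarrow> m' \<le> m \<Longrightarrow> M \<le> M' \<Longrightarrow> form_bounds H m' M' A"
  unfolding form_bounds_def by (meson inner_ge_zero mult_right_mono order_trans)

text \<open>The inner product with \<open>\<i> x\<close> is the imaginary part of the complex form, so the form of a self-adjoint
  operator is real.\<close>

lemma self_adjoint_inner_iC:
  assumes "self_adjoint_on H A"
  shows "inner (A \<cdot> x) (\<i> *\<^sub>C x) = 0"
proof -
  have "inner (A \<cdot> x) (\<i> *\<^sub>C x) = inner x (\<i> *\<^sub>C A \<cdot> x)"
    by (simp add: self_adjoint_onD(2)[OF assms] operators_scaleC[OF self_adjoint_onD(1)[OF assms]])
  also have "\<dots> = - inner (A \<cdot> x) (\<i> *\<^sub>C x)"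
    using inner_iC_left[of x "A \<cdot> x"] by (simp add: inner_commute)
  finally show ?thesis by simp
qed

context
  fixes H :: "'u::complex_hilbert set"
  assumes hs: "hilbert_space H"
begin

text \<open>Positivity makes the form real, and polarisation along \<open>x + \<i> y\<close> turns this into symmetry.\<close>

lemma positive_on_iff:
  "positive_on H T \<longleftrightarrow> self_adjoint_on H T \<and> (\<forall>x\<in>H. 0 \<le> inner (T \<cdot> x) x)"
proof
  assume pos: "positive_on H T"
  then have T: "T \<in> operators H" by (simp add: positive_on_def)
  have c: "Im (cinner (T \<cdot> x) x) = 0" "0 \<le> Re (cinner (T \<cdot> x) x)" if "x \<in> H" for x
    using pos that by (auto simp: positive_on_def complex_nonneg_Reals_iff)
  have sym: "inner (T \<cdot> x) y = inner (T \<cdot> y) x" if "x \<in> H" "y \<in> H" for x y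
  proof -
    have "Im (cinner (T \<cdot> (x + \<i> *\<^sub>C y)) (x + \<i> *\<^sub>C y)) = 0"
      by (intro c hilbert_space_D[OF hs] that)
    then show ?thesis using c(1)[OF that(1)] c(1)[OF that(2)]
      by (simp add: blinfun.bilinear_simps operators_scaleC[OF T] cinner_add_left cinner_add_right
          cinner_scaleC_left cinner_scaleC_right inner_eq_Re_cinner)
  qed
  have "inner (T \<cdot> x) y = inner x (T \<cdot> y)" for x y
  proof -
    let ?P = "blinfun_apply (ident H)"
    have "inner (T \<cdot> x) y = inner (?P (T \<cdot> (?P x))) y"
      by (simp add: operators_ident[OF hs T] ident[OF hs] operators_in[OF T])
    also have "\<dots> = inner (T \<cdot> (?P x)) (?P y)" by (simp add: inner_ident[OF hs])
    also have "\<dots> = inner (T \<cdot> (?P y)) (?P x)"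
      by (intro sym operators_in[OF ident(1)[OF hs]])
    also have "\<dots> = inner (?P (T \<cdot> (?P y))) x" by (simp add: inner_ident[OF hs])
    also have "\<dots> = inner x (T \<cdot> y)"
      by (simp add: operators_ident[OF hs T] ident[OF hs] operators_in[OF T] inner_commute)
    finally show ?thesis .
  qed
  with T c(2) show "self_adjoint_on H T \<and> (\<forall>x\<in>H. 0 \<le> inner (T \<cdot> x) x)"
    by (auto simp: self_adjoint_on_def inner_eq_Re_cinner)
next
  assume "self_adjoint_on H T \<and> (\<forall>x\<in>H. 0 \<le> inner (T \<cdot> x) x)"
  then show "positive_on H T"
    using self_adjoint_inner_iC[of H T]
    by (auto simp: positive_on_def self_adjoint_on_def cinner_eq complex_nonneg_Reals_iff)
qed

lemma op_le_iff:
  assumes "self_adjoint_on H A" "self_adjoint_on H B"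
  shows "op_le H A B \<longleftrightarrow> (\<forall>x\<in>H. inner (A \<cdot> x) x \<le> inner (B \<cdot> x) x)"
proof -
  have "self_adjoint_on H (B - A)"
    using assms by (auto simp: self_adjoint_on_def operators_diff[OF hs] blinfun.bilinear_simps inner_diff)
  then show ?thesis by (simp add: op_le_def positive_on_iff blinfun.bilinear_simps inner_diff)
qed

lemma self_adjoint_ident: "self_adjoint_on H (ident H)"
  by (simp add: self_adjoint_on_def inner_ident[OF hs] ident[OF hs])

lemma self_adjoint_zero: "self_adjoint_on H 0"
  by (simp add: self_adjoint_on_def operators_zero[OF hs])

lemma self_adjoint_add: "self_adjoint_on H A \<Longrightarrow> self_adjoint_on H B \<Longrightarrow> self_adjoint_on H (A + B)"
  by (simp add: self_adjoint_on_def operators_add[OF hs] blinfun.bilinear_simps inner_add)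

lemma self_adjoint_scaleR: "self_adjoint_on H A \<Longrightarrow> self_adjoint_on H (r *\<^sub>R A)"
  by (simp add: self_adjoint_on_def operators_scaleR[OF hs] blinfun.bilinear_simps)

lemma self_adjoint_conj:
  "self_adjoint_on H A \<Longrightarrow> self_adjoint_on H T \<Longrightarrow> self_adjoint_on H (T o\<^sub>L A o\<^sub>L T)"
  by (simp add: self_adjoint_on_def operators_compose[OF hs])

lemma self_adjoint_limit:
  assumes "\<And>n. self_adjoint_on H (X n)" "X \<longlonglongrightarrow> T"
  shows "self_adjoint_on H T"
proof -
  have "inner (T \<cdot> x) y = inner x (T \<cdot> y)" for x y
  proof (rule LIMSEQ_unique)
    show "(\<lambda>n. inner ((X n) \<cdot> x) y) \<longlonglongrightarrow> inner (T \<cdot> x) y"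
      by (intro tendsto_intros assms)
    show "(\<lambda>n. inner ((X n) \<cdot> x) y) \<longlonglongrightarrow> inner x (T \<cdot> y)"
      unfolding self_adjoint_onD(2)[OF assms(1)] by (intro tendsto_intros assms)
  qed
  then show ?thesis
    using operators_limit[OF hs self_adjoint_onD(1)[OF assms(1)] assms(2)] by (simp add: self_adjoint_on_def)
qed

text \<open>The projection onto \<open>H\<close> is contractive, so a bound on \<open>H\<close> is a bound for the operator norm.\<close>

lemma norm_blinfun_le_on:
  assumes "T \<in> operators H" "0 \<le> c" "\<And>x. x \<in> H \<Longrightarrow> norm (T \<cdot> x) \<le> c * norm x"
  shows "norm T \<le> c"
proof (rule norm_blinfun_bound[OF assms(2)])
  fix x
  let ?P = "(ident H) \<cdot> x"
  have "norm (T \<cdot> x) = norm (T \<cdot> ?P)" by (simp add: operators_ident[OF hs assms(1)])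
  also have "\<dots> \<le> c * norm ?P" by (intro assms(3) operators_in[OF ident(1)[OF hs]])
  also have "norm ?P \<le> norm x" by (rule norm_ident_apply_le[OF hs])
  finally show "norm (T \<cdot> x) \<le> c * norm x" using \<open>0 \<le> c\<close> by (simp add: mult_left_mono)
qed

lemma form_bounds_norm:
  assumes "self_adjoint_on H A" "norm (A - c *\<^sub>R ident H) \<le> r"
  shows "form_bounds H (c - r) (c + r) A"
  unfolding form_bounds_def
proof (intro conjI ballI assms)
  fix x assume x: "x \<in> H"
  have "\<bar>inner ((A - c *\<^sub>R ident H) \<cdot> x) x\<bar> \<le> norm ((A - c *\<^sub>R ident H) \<cdot> x) * norm x"
    by (rule Cauchy_Schwarz_ineq2)
  also have "\<dots> \<le> (norm (A - c *\<^sub>R ident H) * norm x) * norm x"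
    by (intro mult_right_mono norm_blinfun) simp
  also have "\<dots> \<le> (r * norm x) * norm x" by (intro mult_right_mono assms) simp_all
  finally have "\<bar>inner (A \<cdot> x) x - c * inner x x\<bar> \<le> r * inner x x"
    using ident(2)[OF hs x] by (simp add: blinfun.bilinear_simps inner_diff mult.assoc norm_eq_sqrt_inner)
  then show "(c - r) * inner x x \<le> inner (A \<cdot> x) x"
    "inner (A \<cdot> x) x \<le> (c + r) * inner x x" by (auto simp: algebra_simps abs_le_iff)
qed

lemma form_bounds_of_norm:
  "self_adjoint_on H A \<Longrightarrow> form_bounds H (- norm A) (norm A) A"
  using form_bounds_norm[of A 0 "norm A"] by simp

section \<open>Inverses and the spectrum\<close>

text \<open>An operator that is bounded below by a positive constant is invertible: for a small
  step size \<open>\<tau>\<close> the map \<open>x \<mapsto> x - \<tau> (T x - y)\<close> is a contraction, whose fixed point solves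
  \<open>T x = y\<close>.\<close>

lemma invertible_on_coercive:
  assumes T: "T \<in> operators H" and c: "0 < c"
    and low: "\<And>x. x \<in> H \<Longrightarrow> c * inner x x \<le> inner (T \<cdot> x) x"
  shows "invertible_on H T"
proof -
  note H = hilbert_space_D[OF hs]
  let ?P = "blinfun_apply (ident H)"
  define L where "L = norm T + c"
  have L: "0 < L" "norm T \<le> L" "c \<le> L" using c by (auto simp: L_def add_nonneg_pos)
  define \<tau> where "\<tau> = c / L\<^sup>2"
  have \<tau>: "0 < \<tau>" using c L by (simp add: \<tau>_def)
  define k where "k = sqrt (1 - c\<^sup>2 / L\<^sup>2)"
  have "c\<^sup>2 / L\<^sup>2 \<le> 1" using L c by (simp add: divide_le_eq power_mono)
  then have k: "0 \<le> k" "k < 1" "k\<^sup>2 = 1 - c\<^sup>2 / L\<^sup>2" using c L by (auto simp: k_def)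
  have contr: "norm (x - \<tau> *\<^sub>R T \<cdot> x) \<le> k * norm x" if "x \<in> H" for x
  proof (rule power2_le_imp_le)
    have "norm (T \<cdot> x) \<le> L * norm x"
      by (rule order_trans[OF norm_blinfun]) (use L in \<open>simp add: mult_right_mono\<close>)
    then have "(norm (T \<cdot> x))\<^sup>2 \<le> (L * norm x)\<^sup>2" by (intro power_mono) auto
    then have T2: "inner (T \<cdot> x) (T \<cdot> x) \<le> L\<^sup>2 * inner x x"
      by (simp add: power2_norm_eq_inner power_mult_distrib)
    have "(norm (x - \<tau> *\<^sub>R T \<cdot> x))\<^sup>2
       = inner x x - 2 * \<tau> * inner (T \<cdot> x) x + \<tau>\<^sup>2 * inner (T \<cdot> x) (T \<cdot> x)"
      unfolding power2_norm_eq_inner by (simp add: algebra_simps inner_commute power2_eq_square)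
    also have "\<dots> \<le> inner x x - 2 * \<tau> * (c * inner x x) + \<tau>\<^sup>2 * (L\<^sup>2 * inner x x)"
      using \<tau> low[OF that] T2 by (intro add_mono diff_mono mult_left_mono) auto
    also have "\<dots> = (1 - c\<^sup>2 / L\<^sup>2) * inner x x"
      using L by (simp add: \<tau>_def field_simps power2_eq_square)
    finally show "(norm (x - \<tau> *\<^sub>R T \<cdot> x))\<^sup>2 \<le> (k * norm x)\<^sup>2"
      by (simp add: power_mult_distrib k(3) power2_norm_eq_inner)
  qed (use k in simp)
  have ex: "\<exists>x\<in>H. T \<cdot> x = y" if y: "y \<in> H" for y
  proof -
    define f where "f x = ?P x - \<tau> *\<^sub>R (T \<cdot> x - y)" for x
    have "dist (f x) (f x') \<le> k * dist x x'" for x x'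
    proof -
      let ?d = "?P (x - x')"
      have "f x - f x' = ?d - \<tau> *\<^sub>R T \<cdot> ?d"
        by (simp add: f_def blinfun.bilinear_simps operators_ident(3)[OF hs T] algebra_simps)
      then have "dist (f x) (f x') \<le> k * norm ?d"
        using contr[OF operators_in[OF ident(1)[OF hs]]] by (simp add: dist_norm)
      also have "norm ?d \<le> norm (x - x')" by (rule norm_ident_apply_le[OF hs])
      finally show ?thesis using k by (simp add: dist_norm mult_left_mono)
    qed
    then obtain x where x: "f x = x" using banach_fix_type[of k f] k by auto
    have "f x \<in> H" unfolding f_def by (intro H y operators_in[OF T] operators_in[OF ident(1)[OF hs]])
    then have xH: "x \<in> H" by (simp add: x)
    then have "\<tau> *\<^sub>R (T \<cdot> x - y) = 0" using x by (simp add: f_def ident(2)[OF hs])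
    then show ?thesis using \<tau> xH by auto
  qed
  have below: "c * norm x \<le> norm (T \<cdot> x)" if "x \<in> H" for x
  proof -
    have "c * norm x * norm x \<le> inner (T \<cdot> x) x"
      using low[OF that] by (simp add: norm_eq_sqrt_inner mult.assoc)
    also have "\<dots> \<le> norm (T \<cdot> x) * norm x" by (rule norm_cauchy_schwarz)
    finally show ?thesis by (cases "norm x = 0") auto
  qed
  have inj: "x = x'" if "x \<in> H" "x' \<in> H" "T \<cdot> x = T \<cdot> x'" for x x'
  proof -
    have "c * norm (x - x') \<le> 0"
      using below[OF H(5)[OF that(1,2)]] that(3) by (simp add: blinfun.bilinear_simps)
    then show ?thesis using c by (simp add: mult_le_0_iff)
  qed
  define r where "r y = (SOME x. x \<in> H \<and> T \<cdot> x = ?P y)" for y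
  have "r y \<in> H \<and> T \<cdot> (r y) = ?P y" for y
    unfolding r_def by (rule someI_ex) (use ex[OF operators_in[OF ident(1)[OF hs]]] in blast)
  then have r: "\<And>y. r y \<in> H" "\<And>y. T \<cdot> (r y) = ?P y" by blast+
  have radd: "r (x + y) = r x + r y" for x y
    by (rule inj) (simp_all add: r H blinfun.bilinear_simps)
  have rsc: "r (a *\<^sub>C x) = a *\<^sub>C r x" for a x
    by (rule inj) (simp_all add: r H operators_scaleC[OF T] operators_scaleC[OF ident(1)[OF hs]])
  have rnorm: "norm (r y) \<le> norm y * (1 / c)" for y
  proof -
    have "c * norm (r y) \<le> norm (?P y)" using below[OF r(1)[of y]] by (simp add: r(2))
    also have "norm (?P y) \<le> norm y" by (rule norm_ident_apply_le[OF hs])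
    finally show ?thesis using c by (simp add: field_simps)
  qed
  have "bounded_linear r"
    by (rule bounded_linear_intro[OF radd _ rnorm]) (simp add: scaleR_scaleC rsc)
  then have app: "blinfun_apply (Blinfun r) = r" by (rule bounded_linear_Blinfun_apply)
  have rTx: "r (T \<cdot> x) = ?P x" for x
    by (rule inj) (simp_all add: r operators_in[OF ident(1)[OF hs]] operators_ident(3)[OF hs T]
        ident(2)[OF hs operators_in[OF T]])
  have "Blinfun r \<in> operators H"
  proof (rule operatorsI[OF _ _ _ hs])
    fix x assume "\<forall>y\<in>H. inner x y = 0"
    then have "?P x = 0" using operators_orthogonal[OF hs ident(1)[OF hs]] by blast
    from this inj[of "r x" 0] show "(Blinfun r) \<cdot> x = 0" unfolding app by (simp add: r H)
  qed (simp_all add: app rsc r)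
  moreover have "T o\<^sub>L Blinfun r = ident H" "Blinfun r o\<^sub>L T = ident H"
    by (auto intro!: blinfun_eqI simp: app r rTx)
  ultimately show ?thesis using T by (auto simp: invertible_on_def)
qed

lemma invertible_on_uminus: "invertible_on H (- T) \<Longrightarrow> invertible_on H T"
proof -
  assume "invertible_on H (- T)"
  then obtain R where R: "- T \<in> operators H" "R \<in> operators H" "(- T) o\<^sub>L R = ident H" "R o\<^sub>L (- T) = ident H"
    by (auto simp: invertible_on_def)
  have "T \<in> operators H" using operators_scaleR[OF hs R(1), of "-1"] by simp
  moreover have "- R \<in> operators H" using operators_scaleR[OF hs R(2), of "-1"] by simp
  moreover have "T o\<^sub>L (- R) = (- T) o\<^sub>L R" "(- R) o\<^sub>L T = R o\<^sub>L (- T)"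
    by (auto intro!: blinfun_eqI simp: blinfun.bilinear_simps)
  ultimately show ?thesis using R(3,4) by (auto simp: invertible_on_def)
qed

text \<open>For \<open>z < m\<close> the operator \<open>A - z\<close>, and for \<open>z > M\<close> the operator \<open>z - A\<close>, is bounded below by a
  positive constant.\<close>

lemma spectrum_form_bounds:
  assumes "form_bounds H m M A"
  shows "spectrum_on H A \<subseteq> {m..M}"
proof
  fix z assume z: "z \<in> spectrum_on H A"
  note A = form_boundsD[OF assms]
  have op: "A - z *\<^sub>R ident H \<in> operators H" by (intro operators_diff[OF hs] operators_scaleR[OF hs] A ident(1)[OF hs])
  have op': "- (A - z *\<^sub>R ident H) \<in> operators H" using operators_scaleR[OF hs op, of "-1"] by simp
  show "z \<in> {m..M}"
  proof (rule ccontr)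
    assume "z \<notin> {m..M}"
    then consider "z < m" | "M < z" by fastforce
    then show False
    proof cases
      case 1
      have "invertible_on H (A - z *\<^sub>R ident H)"
        by (rule invertible_on_coercive[OF op, of "m - z"])
          (use 1 A(4) in \<open>auto simp: blinfun.bilinear_simps ident(2)[OF hs] algebra_simps\<close>)
      then show False using z by (simp add: spectrum_on_def)
    next
      case 2
      have "invertible_on H (- (A - z *\<^sub>R ident H))"
        by (rule invertible_on_coercive[OF op', of "z - M"])
          (use 2 A(5) in \<open>auto simp: blinfun.bilinear_simps ident(2)[OF hs] algebra_simps\<close>)
      then show False using z invertible_on_uminus by (simp add: spectrum_on_def)
    qed
  qed
qed

text \<open>A positive operator with inverse \<open>R\<close> is bounded below: expand
  \<open>\<langle>A (x - c R x), x - c R x\<rangle> \<ge> 0\<close> with a \<open>c\<close> slightly smaller than \<open>1 / \<parallel>R\<parallel>\<close>.\<close>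

lemma positive_definite_form_bounds:
  assumes "positive_definite_on H A"
  obtains m M where "0 < m" "m \<le> M" "form_bounds H m M A"
proof -
  have sa: "self_adjoint_on H A" and pos: "\<And>x. x \<in> H \<Longrightarrow> 0 \<le> inner (A \<cdot> x) x"
    using assms positive_on_iff by (auto simp: positive_definite_on_def)
  note A = self_adjoint_onD[OF sa]
  obtain R where R: "R \<in> operators H" "A o\<^sub>L R = ident H"
    using assms by (auto simp: positive_definite_on_def invertible_on_def)
  define c where "c = 1 / (norm R + 1)"
  have c: "0 < c" "c * (norm R + 1) = 1" by (auto simp: c_def add_nonneg_pos add_nonneg_eq_0_iff)
  have low: "c * inner x x \<le> inner (A \<cdot> x) x" if x: "x \<in> H" for x
  proof -
    have AR: "A \<cdot> (R \<cdot> x) = x"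
      using arg_cong[OF R(2), of "\<lambda>T. T \<cdot> x"] ident(2)[OF hs x] by simp
    have "inner x (R \<cdot> x) \<le> norm x * norm (R \<cdot> x)" by (rule norm_cauchy_schwarz)
    also have "\<dots> \<le> norm x * (norm R * norm x)" by (intro mult_left_mono norm_blinfun) simp
    finally have xR: "inner x (R \<cdot> x) \<le> norm R * inner x x"
      by (simp add: norm_eq_sqrt_inner algebra_simps)
    have "0 \<le> inner (A \<cdot> (x - c *\<^sub>R R \<cdot> x)) (x - c *\<^sub>R R \<cdot> x)"
      by (intro pos hilbert_space_D[OF hs] x operators_in[OF R(1)])
    also have "\<dots> = inner (A \<cdot> x) x - 2 * c * inner x x + c * (c * inner x (R \<cdot> x))"
      using A(2)[of x "R \<cdot> x"] by (simp add: blinfun.bilinear_simps AR algebra_simps)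
    also have "c * (c * inner x (R \<cdot> x)) \<le> c * (c * (norm R * inner x x))"
      using c by (intro mult_left_mono xR) auto
    also have "c * (c * (norm R * inner x x)) = c * inner x x * (c * norm R)" by simp
    also have "c * norm R = 1 - c" using c(2) by (simp add: algebra_simps)
    also have "c * inner x x * (1 - c) \<le> c * inner x x * 1" using c by (intro mult_left_mono) auto
    finally show ?thesis by simp
  qed
  have "form_bounds H c (max c (norm A)) A"
    using form_boundsD(5)[OF form_bounds_of_norm[OF sa]] low sa unfolding form_bounds_def
    by (meson inner_ge_zero max.cobounded2 mult_right_mono order_trans)
  from that[OF c(1) max.cobounded1 this] show thesis .
qed

lemma positive_definite_onI:
  assumes "form_bounds H m M A" "0 < m"
  shows "positive_definite_on H A"
proof -
  note A = form_boundsD[OF assms(1)]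
  have "0 \<le> inner (A \<cdot> x) x" if "x \<in> H" for x
    using A(4)[OF that] assms(2) by (meson inner_ge_zero less_imp_le mult_nonneg_nonneg order_trans)
  then show ?thesis
    using invertible_on_coercive[OF A(2) assms(2) A(4)] A(1)
    by (simp add: positive_definite_on_def positive_on_iff)
qed

end

section \<open>Polynomials of an operator\<close>

lemmas compose_simps =
  bounded_bilinear.add_left[OF bounded_bilinear_blinfun_compose]
  bounded_bilinear.add_right[OF bounded_bilinear_blinfun_compose]
  bounded_bilinear.diff_left[OF bounded_bilinear_blinfun_compose]
  bounded_bilinear.diff_right[OF bounded_bilinear_blinfun_compose]
  bounded_bilinear.scaleR_left[OF bounded_bilinear_blinfun_compose]
  bounded_bilinear.scaleR_right[OF bounded_bilinear_blinfun_compose]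

lemmas blinfun_compose_sum_right = bounded_bilinear.sum_right[OF bounded_bilinear_blinfun_compose]

lemma blinfun_compose_assoc: "(A o\<^sub>L B) o\<^sub>L C = A o\<^sub>L (B o\<^sub>L C)"
  by (rule blinfun_eqI) simp

lemma poly_op_sum:
  "degree p \<le> n \<Longrightarrow> poly_op H p A = (\<Sum>i\<le>n. coeff p i *\<^sub>R ((\<lambda>T. A o\<^sub>L T) ^^ i) (ident H))"
  unfolding poly_op_def by (rule sum.mono_neutral_left) (auto simp: coeff_eq_0)

lemma poly_op_0 [simp]: "poly_op H 0 A = 0"
  by (simp add: poly_op_def)

lemma poly_op_pCons: "poly_op H (pCons c p) A = c *\<^sub>R ident H + (A o\<^sub>L poly_op H p A)"
proof -
  have "poly_op H (pCons c p) A
      = (\<Sum>i\<le>Suc (degree p). coeff (pCons c p) i *\<^sub>R ((\<lambda>T. A o\<^sub>L T) ^^ i) (ident H))"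
    by (rule poly_op_sum) (simp add: degree_pCons_le)
  then show ?thesis
    by (simp only: sum.atMost_Suc_shift coeff_pCons_0 coeff_pCons_Suc funpow.simps o_apply id_apply)
      (simp add: poly_op_def blinfun_compose_sum_right compose_simps)
qed

lemma poly_op_add: "poly_op H (p + q) A = poly_op H p A + poly_op H q A"
proof (induction p arbitrary: q)
  case (pCons c p)
  obtain d r where q: "q = pCons d r" by (cases q)
  show ?case by (simp add: q poly_op_pCons pCons.IH compose_simps scaleR_add_left)
qed simp

lemma poly_op_smult: "poly_op H (smult r p) A = r *\<^sub>R poly_op H p A"
  by (induction p) (auto simp: poly_op_pCons compose_simps scaleR_add_right)

lemma poly_op_diff: "poly_op H (p - q) A = poly_op H p A - poly_op H q A"
  using poly_op_add[of H "p - q" q A] by simp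

context
  fixes H :: "'u::complex_hilbert set"
  assumes hs: "hilbert_space H"
begin

lemma poly_op_operators: "A \<in> operators H \<Longrightarrow> poly_op H p A \<in> operators H"
  by (induction p) (auto simp: poly_op_pCons intro!: operators_add[OF hs] operators_scaleR[OF hs]
      operators_compose[OF hs] ident[OF hs] operators_zero[OF hs])

lemma poly_op_const: "poly_op H [:c:] A = c *\<^sub>R ident H"
  by (simp add: poly_op_pCons)

lemma poly_op_mult:
  assumes "A \<in> operators H"
  shows "poly_op H (p * q) A = poly_op H p A o\<^sub>L poly_op H q A"
  by (induction p) (simp_all add: mult_pCons_left poly_op_add poly_op_smult poly_op_pCons compose_simps
      blinfun_compose_assoc operators_ident(2)[OF hs poly_op_operators[OF assms]])

lemma poly_op_commute:
  assumes "A \<in> operators H"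
  shows "A o\<^sub>L poly_op H p A = poly_op H p A o\<^sub>L A"
proof -
  have "poly_op H [:0, 1:] A = A" using assms by (simp add: poly_op_pCons operators_ident(1)[OF hs])
  then show ?thesis using poly_op_mult[OF assms, of "[:0, 1:]" p] poly_op_mult[OF assms, of p "[:0, 1:]"]
    by (simp add: mult.commute)
qed

lemma self_adjoint_poly_op:
  assumes A: "self_adjoint_on H A"
  shows "self_adjoint_on H (poly_op H p A)"
proof (induction p)
  case (pCons c p)
  note op = self_adjoint_onD(1)[OF A]
  have "inner ((A o\<^sub>L poly_op H p A) \<cdot> x) y = inner x ((A o\<^sub>L poly_op H p A) \<cdot> y)" for x y
  proof -
    have "inner ((A o\<^sub>L poly_op H p A) \<cdot> x) y = inner x ((poly_op H p A o\<^sub>L A) \<cdot> y)"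
      by (simp add: self_adjoint_onD(2)[OF A] self_adjoint_onD(2)[OF pCons.IH])
    then show ?thesis by (simp only: poly_op_commute[OF op])
  qed
  then have "self_adjoint_on H (A o\<^sub>L poly_op H p A)"
    by (simp add: self_adjoint_on_def operators_compose[OF hs] op poly_op_operators)
  then show ?case unfolding poly_op_pCons
    by (intro self_adjoint_add[OF hs] self_adjoint_scaleR[OF hs] self_adjoint_ident[OF hs])
qed (simp add: self_adjoint_zero[OF hs])

lemma poly_op_affine:
  assumes "A \<in> operators H"
  shows "poly_op H p (a *\<^sub>R A + b *\<^sub>R ident H) = poly_op H (pcompose p [:b, a:]) A"
proof (induction p)
  case (pCons c p)
  have lin: "a *\<^sub>R A + b *\<^sub>R ident H = poly_op H [:b, a:] A"
    using assms by (simp add: poly_op_pCons compose_simps operators_ident(1)[OF hs])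
  have "poly_op H (pCons c p) (a *\<^sub>R A + b *\<^sub>R ident H)
      = c *\<^sub>R ident H + (poly_op H [:b, a:] A o\<^sub>L poly_op H (pcompose p [:b, a:]) A)"
    unfolding poly_op_pCons[of H c p] pCons.IH by (simp only: lin)
  then show ?case
    by (simp only: pcompose_pCons poly_op_add poly_op_mult[OF assms] poly_op_const)
qed simp

end

section \<open>The norm of a polynomial of a self-adjoint operator\<close>

text \<open>Real polynomials of \<open>A\<close> are factored over the complex numbers.  Complex multiples of \<open>A\<close> are needed
  only pointwise, by Horner's scheme.\<close>

definition complex_poly_apply :: "('u::complex_hilbert \<Rightarrow>\<^sub>L 'u) \<Rightarrow> complex poly \<Rightarrow> 'u \<Rightarrow> 'u" where
  "complex_poly_apply A p x = fold_coeffs (\<lambda>c v. c *\<^sub>C x + A \<cdot> v) p 0"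

lemma complex_poly_apply_0 [simp]: "complex_poly_apply A 0 x = 0"
  by (simp add: complex_poly_apply_def)

lemma complex_poly_apply_pCons:
  "complex_poly_apply A (pCons c p) x = c *\<^sub>C x + A \<cdot> (complex_poly_apply A p x)"
  by (cases "p = 0 \<and> c = 0") (auto simp: complex_poly_apply_def)

lemma complex_poly_apply_add:
  "complex_poly_apply A (p + q) x = complex_poly_apply A p x + complex_poly_apply A q x"
proof (induction p arbitrary: q)
  case (pCons c p)
  obtain d r where q: "q = pCons d r" by (cases q)
  show ?case by (simp add: q complex_poly_apply_pCons pCons.IH blinfun.bilinear_simps scaleC_add_left)
qed simp

lemma complex_poly_apply_diff:
  "complex_poly_apply A (p - q) x = complex_poly_apply A p x - complex_poly_apply A q x"
  using complex_poly_apply_add[of A "p - q" q x] by simp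

definition bounded_below_on :: "'u::real_normed_vector set \<Rightarrow> ('u \<Rightarrow> 'u) \<Rightarrow> bool" where
  "bounded_below_on H f \<longleftrightarrow> (\<exists>c>0. \<forall>x\<in>H. c * norm x \<le> norm (f x))"

context
  fixes H :: "'u::complex_hilbert set"
  assumes hs: "hilbert_space H"
begin

lemma complex_poly_apply_smult:
  "A \<in> operators H \<Longrightarrow> complex_poly_apply A (smult r p) x = r *\<^sub>C complex_poly_apply A p x"
  by (induction p) (auto simp: complex_poly_apply_pCons scaleC_add_right scaleC_scaleC operators_scaleC)

lemma complex_poly_apply_in: "A \<in> operators H \<Longrightarrow> x \<in> H \<Longrightarrow> complex_poly_apply A p x \<in> H"
  by (induction p) (auto simp: complex_poly_apply_pCons intro!: hilbert_space_D[OF hs] operators_in)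

lemma complex_poly_apply_of_real:
  assumes "x \<in> H"
  shows "complex_poly_apply A (map_poly complex_of_real p) x = (poly_op H p A) \<cdot> x"
  by (induction p) (simp_all add: complex_poly_apply_pCons poly_op_pCons map_poly_pCons
      blinfun.bilinear_simps scaleR_scaleC ident(2)[OF hs assms])

text \<open>Over the complex numbers a polynomial splits into linear factors, and a composition of
  maps that are bounded below is bounded below.\<close>

lemma complex_poly_bounded_below:
  assumes A: "A \<in> operators H" and "p \<noteq> 0"
    and "\<And>z. poly p z = 0 \<Longrightarrow> bounded_below_on H (\<lambda>x. A \<cdot> x - z *\<^sub>C x)"
  shows "bounded_below_on H (complex_poly_apply A p)"
  using assms(2,3)
proof (induction "degree p" arbitrary: p)
  case 0
  then obtain c where c: "p = [:c:]" "c \<noteq> 0" by (metis degree_eq_zeroE pCons_0_0)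
  then show ?case unfolding bounded_below_on_def
    by (intro exI[of _ "cmod c"]) (simp add: complex_poly_apply_pCons norm_scaleC)
next
  case (Suc n)
  then have "\<not> constant (poly p)" by (simp add: constant_degree)
  then obtain z where z: "poly p z = 0" using fundamental_theorem_of_algebra by blast
  then obtain q where q: "p = [:- z, 1:] * q" by (auto simp: poly_eq_0_iff_dvd)
  with Suc.prems(1) have "q \<noteq> 0" by auto
  then have "degree p = Suc (degree q)" by (simp add: q degree_mult_eq del: mult_pCons_left)
  then have "bounded_below_on H (complex_poly_apply A q)"
    using Suc \<open>q \<noteq> 0\<close> by (intro Suc.hyps(1)) (auto simp: q)
  moreover have "bounded_below_on H (\<lambda>x. A \<cdot> x - z *\<^sub>C x)" by (rule Suc.prems(2)[OF z])
  ultimately obtain c d where c: "0 < c" "\<And>x. x \<in> H \<Longrightarrow> c * norm x \<le> norm (complex_poly_apply A q x)"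
    and d: "0 < d" "\<And>x. x \<in> H \<Longrightarrow> d * norm x \<le> norm (A \<cdot> x - z *\<^sub>C x)"
    unfolding bounded_below_on_def by blast
  have "(d * c) * norm x \<le> norm (complex_poly_apply A p x)" if x: "x \<in> H" for x
  proof -
    let ?y = "complex_poly_apply A q x"
    have "complex_poly_apply A p x = A \<cdot> ?y - z *\<^sub>C ?y"
      by (simp add: q mult_pCons_left complex_poly_apply_diff complex_poly_apply_smult[OF A]
          complex_poly_apply_pCons)
    moreover have "d * (c * norm x) \<le> d * norm ?y" using c(2)[OF x] d(1) by simp
    moreover have "d * norm ?y \<le> norm (A \<cdot> ?y - z *\<^sub>C ?y)"
      by (intro d(2) complex_poly_apply_in A x)
    ultimately show ?thesis by (simp add: mult.assoc)
  qed
  then show ?case unfolding bounded_below_on_def using c(1) d(1) by (intro exI[of _ "d * c"]) auto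
qed

text \<open>For \<open>z = a + \<i> b\<close> the vectors \<open>A x - a x\<close> and \<open>\<i> b x\<close> are orthogonal, whence
  \<open>\<parallel>A x - z x\<parallel> \<ge> \<bar>b\<bar> \<parallel>x\<parallel>\<close>.\<close>

lemma nonreal_bounded_below:
  assumes A: "self_adjoint_on H A" and "Im z \<noteq> 0"
  shows "bounded_below_on H (\<lambda>x. A \<cdot> x - z *\<^sub>C x)"
  unfolding bounded_below_on_def
proof (intro exI[of _ "\<bar>Im z\<bar>"] conjI ballI)
  fix x
  let ?u = "A \<cdot> x - Re z *\<^sub>R x"
  have "inner x (\<i> *\<^sub>C x) = 0" using inner_iC_left[of x x] by (simp add: inner_commute)
  then have orth: "inner ?u (\<i> *\<^sub>C x) = 0" using self_adjoint_inner_iC[OF A, of x] by (simp add: inner_diff_left)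
  have pythagoras: "(norm (u - v))\<^sup>2 = (norm u)\<^sup>2 + (norm v)\<^sup>2" if "inner u v = 0" for u v :: 'u
    using that by (simp add: power2_norm_eq_inner inner_diff inner_commute[of v u])
  have "A \<cdot> x - z *\<^sub>C x = ?u - Im z *\<^sub>R (\<i> *\<^sub>C x)" by (subst scaleC_eq) simp
  then have "(norm (A \<cdot> x - z *\<^sub>C x))\<^sup>2 = (norm ?u)\<^sup>2 + (norm (Im z *\<^sub>R (\<i> *\<^sub>C x)))\<^sup>2"
    using orth by (simp only: pythagoras inner_scaleR_right mult_zero_right)
  also have "norm (Im z *\<^sub>R (\<i> *\<^sub>C x)) = \<bar>Im z\<bar> * norm x" by (simp add: norm_scaleC)
  finally show "\<bar>Im z\<bar> * norm x \<le> norm (A \<cdot> x - z *\<^sub>C x)"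
    by - (rule power2_le_imp_le, simp_all)
qed (use assms in simp)

lemma regular_bounded_below:
  assumes "r \<notin> spectrum_on H A"
  shows "bounded_below_on H (\<lambda>x. A \<cdot> x - complex_of_real r *\<^sub>C x)"
proof -
  obtain R where R: "R o\<^sub>L (A - r *\<^sub>R ident H) = ident H"
    using assms by (auto simp: spectrum_on_def invertible_on_def)
  have N: "0 < norm R + 1" by (simp add: add_nonneg_pos)
  have "1 / (norm R + 1) * norm x \<le> norm (A \<cdot> x - complex_of_real r *\<^sub>C x)" if x: "x \<in> H" for x
  proof -
    let ?y = "A \<cdot> x - complex_of_real r *\<^sub>C x"
    have "R \<cdot> ?y = x"
      using arg_cong[OF R, of "\<lambda>T. T \<cdot> x"] ident(2)[OF hs x]
      by (simp add: blinfun.bilinear_simps flip: scaleR_scaleC)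
    then have "norm x \<le> norm R * norm ?y" by (metis norm_blinfun)
    also have "\<dots> \<le> (norm R + 1) * norm ?y" by (simp add: mult_right_mono)
    finally show ?thesis using N by (simp add: field_simps)
  qed
  then show ?thesis unfolding bounded_below_on_def using N by (intro exI[of _ "1 / (norm R + 1)"]) auto
qed

text \<open>The half of the spectral mapping theorem that is used: if \<open>f(A)\<close> is not bounded below, then one of
  the linear factors \<open>A - z\<close> is not, so the root \<open>z\<close> is real and belongs to the spectrum.\<close>

lemma spectral_zero:
  assumes A: "self_adjoint_on H A" and "f \<noteq> 0" and nb: "\<not> bounded_below_on H (blinfun_apply (poly_op H f A))"
  shows "\<exists>r\<in>spectrum_on H A. poly f r = 0"
proof (rule ccontr)
  assume no: "\<not> ?thesis"
  have "bounded_below_on H (complex_poly_apply A (map_poly complex_of_real f))"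
  proof (rule complex_poly_bounded_below[OF self_adjoint_onD(1)[OF A]])
    show "map_poly complex_of_real f \<noteq> 0" using \<open>f \<noteq> 0\<close> by (simp add: map_poly_eq_0_iff)
    fix z assume z: "poly (map_poly complex_of_real f) z = 0"
    show "bounded_below_on H (\<lambda>x. A \<cdot> x - z *\<^sub>C x)"
    proof (cases "Im z = 0")
      case True
      then have zr: "z = complex_of_real (Re z)" by (simp add: complex_eq_iff)
      have "poly (map_poly complex_of_real f) (complex_of_real r) = complex_of_real (poly f r)" for r
        by (induction f) (simp_all add: map_poly_pCons)
      then have "poly f (Re z) = 0" using z zr by (metis of_real_eq_0_iff)
      then have "Re z \<notin> spectrum_on H A" using no by auto
      from regular_bounded_below[OF this] zr show ?thesis by simp
    qed (rule nonreal_bounded_below[OF A])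
  qed
  then show False using nb complex_poly_apply_of_real by (simp add: bounded_below_on_def)
qed

text \<open>A vector on which \<open>T\<close> nearly attains its norm \<open>N\<close> is nearly annihilated by \<open>N\<^sup>2 - T\<^sup>2\<close>.\<close>

lemma norm_square_not_bounded_below:
  assumes T: "self_adjoint_on H T" and "x0 \<in> H" "x0 \<noteq> 0"
  shows "\<not> bounded_below_on H (\<lambda>x. (norm T)\<^sup>2 *\<^sub>R x - T \<cdot> (T \<cdot> x))"
proof
  define N where "N = norm T"
  assume "bounded_below_on H (\<lambda>x. (norm T)\<^sup>2 *\<^sub>R x - T \<cdot> (T \<cdot> x))"
  then obtain c where c: "0 < c" "\<And>x. x \<in> H \<Longrightarrow> c * norm x \<le> norm (N\<^sup>2 *\<^sub>R x - T \<cdot> (T \<cdot> x))"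
    unfolding bounded_below_on_def N_def by blast
  have N0: "0 \<le> N" by (simp add: N_def)
  have key: "c\<^sup>2 * (norm x)\<^sup>2 \<le> N ^ 4 * (norm x)\<^sup>2 - N\<^sup>2 * (norm (T \<cdot> x))\<^sup>2" if "x \<in> H" for x
  proof -
    let ?y = "T \<cdot> x" and ?z = "T \<cdot> (T \<cdot> x)"
    have "inner x ?z = inner ?y ?y" by (simp add: self_adjoint_onD(2)[OF T])
    then have e: "(norm (N\<^sup>2 *\<^sub>R x - ?z))\<^sup>2 = N ^ 4 * (norm x)\<^sup>2 - 2 * N\<^sup>2 * (norm ?y)\<^sup>2 + (norm ?z)\<^sup>2"
      unfolding power2_norm_eq_inner
      by (simp add: inner_diff inner_commute power4_eq_xxxx power2_eq_square algebra_simps)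
    have "norm ?z \<le> N * norm ?y" unfolding N_def by (rule norm_blinfun)
    then have "(norm ?z)\<^sup>2 \<le> (N * norm ?y)\<^sup>2" by (intro power_mono) auto
    moreover have "(c * norm x)\<^sup>2 \<le> (norm (N\<^sup>2 *\<^sub>R x - ?z))\<^sup>2" using c that by (intro power_mono) auto
    ultimately show ?thesis using e by (simp add: power_mult_distrib)
  qed
  show False
  proof (cases "N = 0")
    case True
    then show False using key[OF assms(2)] c(1) assms(3) by (simp add: mult_le_0_iff)
  next
    case False
    then have N: "0 < N" using N0 by simp
    \<comment> \<open>Being bounded below by \<open>c\<close> would give \<open>\<parallel>T\<parallel>\<^sup>2 \<le> k\<close>, although \<open>k < \<parallel>T\<parallel>\<^sup>2\<close>.\<close>
    define k where "k = N\<^sup>2 - c\<^sup>2 / N\<^sup>2"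
    have kx: "(norm (T \<cdot> x))\<^sup>2 \<le> k * (norm x)\<^sup>2" if "x \<in> H" for x
    proof -
      have "N\<^sup>2 * k = N ^ 4 - c\<^sup>2"
        using N by (simp add: k_def right_diff_distrib flip: power_add)
      then have "N\<^sup>2 * (k * (norm x)\<^sup>2) = N ^ 4 * (norm x)\<^sup>2 - c\<^sup>2 * (norm x)\<^sup>2"
        by (simp add: mult.assoc[symmetric] left_diff_distrib)
      then have "N\<^sup>2 * (norm (T \<cdot> x))\<^sup>2 \<le> N\<^sup>2 * (k * (norm x)\<^sup>2)"
        using key[OF that] by simp
      then show ?thesis using N by simp
    qed
    have "0 \<le> k * (norm x0)\<^sup>2" using kx[OF assms(2)] zero_le_power2 order_trans by blast
    then have k: "0 \<le> k" using assms(3) by (simp add: zero_le_mult_iff)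
    have "norm T \<le> sqrt k"
    proof (rule norm_blinfun_le_on[OF hs self_adjoint_onD(1)[OF T]])
      fix x assume "x \<in> H"
      then show "norm (T \<cdot> x) \<le> sqrt k * norm x"
        using kx k by - (rule power2_le_imp_le, simp_all add: power_mult_distrib)
    qed (use k in simp)
    then have "N\<^sup>2 \<le> k" using k by (simp add: N_def real_le_rsqrt sqrt_ge_absD)
    moreover have "0 < c\<^sup>2 / N\<^sup>2" using c(1) N by simp
    ultimately show False unfolding k_def by linarith
  qed
qed

text \<open>With \<open>N = \<parallel>q(A)\<parallel>\<close> the polynomial \<open>N\<^sup>2 - q\<^sup>2\<close> has a zero in the spectrum.  If this polynomial is zero,
  any point of the spectrum will do; such a point exists by the same argument for the
  polynomial \<open>x\<close>.\<close>

lemma norm_poly_op_attained: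
  assumes A: "self_adjoint_on H A" and "x0 \<in> H" "x0 \<noteq> 0"
  shows "\<exists>r\<in>spectrum_on H A. \<bar>poly q r\<bar> = norm (poly_op H q A)"
proof -
  note op = self_adjoint_onD(1)[OF A]
  have main: "\<exists>r\<in>spectrum_on H A. \<bar>poly q r\<bar> = norm (poly_op H q A)"
    if nz: "[:(norm (poly_op H q A))\<^sup>2:] - q * q \<noteq> 0" for q
  proof -
    let ?N = "norm (poly_op H q A)"
    have "\<not> bounded_below_on H (blinfun_apply (poly_op H ([:?N\<^sup>2:] - q * q) A))"
      using norm_square_not_bounded_below[OF self_adjoint_poly_op[OF hs A] assms(2,3), of q]
      by (simp add: bounded_below_on_def poly_op_diff poly_op_mult[OF hs op] poly_op_const[OF hs]
          blinfun.bilinear_simps ident(2)[OF hs])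
    from spectral_zero[OF A nz this] obtain r where "r \<in> spectrum_on H A" "(poly q r)\<^sup>2 = ?N\<^sup>2"
      by (auto simp: power2_eq_square)
    then show ?thesis by (intro bexI[of _ r]) (auto simp: power2_eq_iff)
  qed
  show ?thesis
  proof (cases "[:(norm (poly_op H q A))\<^sup>2:] - q * q = 0")
    case True
    have "[:(norm (poly_op H [:0, 1:] A))\<^sup>2:] - [:0, 1:] * [:0, 1:] \<noteq> (0 :: real poly)" by simp
    from main[OF this] obtain r where r: "r \<in> spectrum_on H A" by blast
    have "poly ([:(norm (poly_op H q A))\<^sup>2:] - q * q) r = 0" using True by simp
    then have "(poly q r)\<^sup>2 = (norm (poly_op H q A))\<^sup>2" by (simp add: power2_eq_square)
    then show ?thesis using r by (intro bexI[of _ r]) (auto simp: power2_eq_iff)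
  qed (rule main)
qed

lemma norm_poly_op_le:
  assumes A: "self_adjoint_on H A" and "0 \<le> c" and "\<And>r. r \<in> spectrum_on H A \<Longrightarrow> \<bar>poly q r\<bar> \<le> c"
  shows "norm (poly_op H q A) \<le> c"
proof (cases "\<exists>x\<in>H. x \<noteq> 0")
  case True
  then obtain x where "x \<in> H" "x \<noteq> 0" by blast
  from norm_poly_op_attained[OF A this, of q] obtain r where "r \<in> spectrum_on H A" "\<bar>poly q r\<bar> = norm (poly_op H q A)" ..
  then show ?thesis using assms(3)[of r] by simp
next
  case False
  then have "poly_op H q A = 0"
    by (intro operators_eqI[OF hs poly_op_operators[OF hs self_adjoint_onD(1)[OF A]] operators_zero[OF hs]]) auto
  then show ?thesis using \<open>0 \<le> c\<close> by simp
qed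

end

section \<open>Continuous functional calculus\<close>

lemma polynomial_approximation:
  fixes f :: "real \<Rightarrow> real"
  assumes "continuous_on {m..M} f" "0 < e"
  shows "\<exists>p. \<forall>x\<in>{m..M}. \<bar>f x - poly p x\<bar> \<le> e"
proof -
  obtain g where g: "real_polynomial_function g" "\<And>x. x \<in> {m..M} \<Longrightarrow> \<bar>f x - g x\<bar> < e"
    using Stone_Weierstrass_real_polynomial_function[OF compact_Icc assms] by metis
  then obtain a n where "g = (\<lambda>x. \<Sum>i\<le>n. a i * x ^ i)" by (auto simp: real_polynomial_function_iff_sum)
  then have "g x = poly (\<Sum>i\<le>n. monom (a i) i) x" for x by (simp add: poly_sum poly_monom)
  then show ?thesis using g(2) by (intro exI[of _ "\<Sum>i\<le>n. monom (a i) i"]) (auto intro: less_imp_le)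
qed

lemma polynomial_sequence:
  fixes f :: "real \<Rightarrow> real"
  assumes "continuous_on {m..M} f"
  obtains p where "\<And>n x. x \<in> {m..M} \<Longrightarrow> \<bar>f x - poly (p n) x\<bar> \<le> inverse (real (Suc n))"
proof -
  have "\<exists>q. \<forall>x\<in>{m..M}. \<bar>f x - poly q x\<bar> \<le> inverse (real (Suc n))" for n
    by (rule polynomial_approximation[OF assms]) simp
  then obtain p where "\<And>n. \<forall>x\<in>{m..M}. \<bar>f x - poly (p n) x\<bar> \<le> inverse (real (Suc n))" by metis
  then show thesis using that by blast
qed

lemma bounded_on_Icc:
  fixes f :: "real \<Rightarrow> real"
  assumes "continuous_on {m..M} f"
  obtains K where "0 \<le> K" "\<And>x. x \<in> {m..M} \<Longrightarrow> \<bar>f x\<bar> \<le> K"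
proof -
  have "bounded (f ` {m..M})" by (intro compact_imp_bounded compact_continuous_image assms compact_Icc)
  then obtain K where K: "\<forall>x\<in>{m..M}. \<bar>f x\<bar> \<le> K" by (auto simp: bounded_iff)
  show thesis
    by (rule that[of "max 0 K"]) (use K in \<open>auto simp: le_max_iff_disj\<close>)
qed

context
  fixes H :: "'u::complex_hilbert set"
  assumes hs: "hilbert_space H"
begin

text \<open>The polynomial norm bound by the spectrum makes the operator in the definition of the
  calculus unique and makes the approximating polynomials a Cauchy sequence.\<close>

lemma is_cfc_norm_le:
  assumes A: "self_adjoint_on H A" and T: "is_cfc H f A T" and "0 \<le> e"
    and p: "\<And>x. x \<in> spectrum_on H A \<Longrightarrow> \<bar>f x - poly p x\<bar> \<le> e"
  shows "norm (T - poly_op H p A) \<le> e"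
proof (rule field_le_epsilon)
  fix d :: real assume "0 < d"
  then obtain q where q: "\<And>x. x \<in> spectrum_on H A \<Longrightarrow> \<bar>f x - poly q x\<bar> \<le> d / 2"
    "norm (T - poly_op H q A) \<le> d / 2"
    using T unfolding is_cfc_def by (metis half_gt_zero)
  have "norm (poly_op H (q - p) A) \<le> d / 2 + e"
  proof (rule norm_poly_op_le[OF hs A])
    fix x assume "x \<in> spectrum_on H A"
    from q(1)[OF this] p[OF this] show "\<bar>poly (q - p) x\<bar> \<le> d / 2 + e" unfolding poly_diff by linarith
  qed (use \<open>0 < d\<close> \<open>0 \<le> e\<close> in simp)
  moreover have "norm (T - poly_op H p A) \<le> norm (T - poly_op H q A) + norm (poly_op H (q - p) A)"
    using norm_triangle_ineq[of "T - poly_op H q A" "poly_op H (q - p) A"] by (simp add: poly_op_diff)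
  ultimately show "norm (T - poly_op H p A) \<le> e + d" using q(2) by linarith
qed

lemma cfc_is_cfc:
  assumes fb: "form_bounds H m M A" and f: "continuous_on {m..M} f"
  shows "is_cfc H f A (cfc H f A)"
proof -
  note A = form_boundsD(1,2)[OF fb]
  note spec = spectrum_form_bounds[OF hs fb]
  obtain p where p: "\<And>n x. x \<in> {m..M} \<Longrightarrow> \<bar>f x - poly (p n) x\<bar> \<le> inverse (real (Suc n))"
    using polynomial_sequence[OF f] by metis
  have close: "norm (poly_op H (p k) A - poly_op H (p n) A) \<le> inverse (real (Suc k)) + inverse (real (Suc n))" for k n
    unfolding poly_op_diff[symmetric]
  proof (rule norm_poly_op_le[OF hs A(1)])
    fix x assume "x \<in> spectrum_on H A"
    then have "x \<in> {m..M}" using spec by blast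
    from p[OF this, of k] p[OF this, of n]
    show "\<bar>poly (p k - p n) x\<bar> \<le> inverse (real (Suc k)) + inverse (real (Suc n))"
      unfolding poly_diff by linarith
  qed simp
  have "Cauchy (\<lambda>n. poly_op H (p n) A)"
  proof (rule metric_CauchyI)
    fix e :: real assume "0 < e"
    then obtain N where N: "inverse (real (Suc N)) < e / 2" using reals_Archimedean[of "e / 2"] by auto
    have small: "inverse (real (Suc k)) < e / 2" if "k \<ge> N" for k
      using le_less_trans[OF le_imp_inverse_le N] that by simp
    show "\<exists>N. \<forall>k\<ge>N. \<forall>n\<ge>N. dist (poly_op H (p k) A) (poly_op H (p n) A) < e"
    proof (intro exI allI impI)
      fix k n assume "N \<le> k" "N \<le> n"
      from add_strict_mono[OF small[OF this(1)] small[OF this(2)]] close[of k n]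
      show "dist (poly_op H (p k) A) (poly_op H (p n) A) < e" by (simp add: dist_norm)
    qed
  qed
  then obtain T where T: "(\<lambda>n. poly_op H (p n) A) \<longlonglongrightarrow> T" by (auto simp: Cauchy_convergent_iff convergent_def)
  have TH: "T \<in> operators H" by (rule operators_limit[OF hs poly_op_operators[OF hs A(2)] T])
  have isT: "is_cfc H f A T"
    unfolding is_cfc_def
  proof (intro conjI TH allI impI)
    fix e :: real assume "0 < e"
    then have "\<forall>\<^sub>F n in sequentially. norm (poly_op H (p n) A - T) < e"
      using T by (auto simp: tendsto_iff dist_norm)
    moreover have "\<forall>\<^sub>F n in sequentially. inverse (real (Suc n)) < e"
      using order_tendstoD(2)[OF LIMSEQ_inverse_real_of_nat \<open>0 < e\<close>] .
    ultimately have "\<forall>\<^sub>F n in sequentially. norm (poly_op H (p n) A - T) < e \<and> inverse (real (Suc n)) < e"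
      by (rule eventually_conj)
    then obtain n where n: "norm (poly_op H (p n) A - T) < e" "inverse (real (Suc n)) < e"
      by (auto simp: eventually_sequentially)
    have "\<bar>f x - poly (p n) x\<bar> \<le> e" if "x \<in> spectrum_on H A" for x
      using order_trans[OF p less_imp_le[OF n(2)], of x] spec that by blast
    then show "\<exists>q. (\<forall>x\<in>spectrum_on H A. \<bar>f x - poly q x\<bar> \<le> e) \<and> norm (T - poly_op H q A) \<le> e"
      using n(1) by (intro exI[of _ "p n"]) (simp add: norm_minus_commute)
  qed
  have "T' = T" if T': "is_cfc H f A T'" for T'
  proof -
    have "norm (T' - T) \<le> 0"
    proof (rule field_le_epsilon)
      fix d :: real assume "0 < d"
      then obtain q where q: "\<And>x. x \<in> spectrum_on H A \<Longrightarrow> \<bar>f x - poly q x\<bar> \<le> d / 2"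
        using T' unfolding is_cfc_def by (metis half_gt_zero)
      from \<open>0 < d\<close> have "0 \<le> d / 2" by simp
      from is_cfc_norm_le[OF A(1) T' this q] is_cfc_norm_le[OF A(1) isT this q]
      have "norm (T' - poly_op H q A) \<le> d / 2" "norm (T - poly_op H q A) \<le> d / 2" by blast+
      then show "norm (T' - T) \<le> 0 + d"
        using norm_triangle_ineq4[of "T' - poly_op H q A" "T - poly_op H q A"] by simp
    qed
    then show ?thesis by simp
  qed
  then show ?thesis unfolding cfc_def by (rule theI[of "is_cfc H f A", OF isT])
qed

context
  fixes A m M
  assumes fb: "form_bounds H m M A"
begin

lemma cfc_operators: "continuous_on {m..M} f \<Longrightarrow> cfc H f A \<in> operators H"
  using cfc_is_cfc[OF fb] by (simp add: is_cfc_def)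

text \<open>From here on the spectrum is replaced by the interval of the form bounds.\<close>

lemma cfc_approx:
  assumes "continuous_on {m..M} f" "0 \<le> e" "\<And>x. x \<in> {m..M} \<Longrightarrow> \<bar>f x - poly p x\<bar> \<le> e"
  shows "norm (cfc H f A - poly_op H p A) \<le> e"
  using is_cfc_norm_le[OF form_boundsD(1)[OF fb] cfc_is_cfc[OF fb assms(1)] assms(2)]
    spectrum_form_bounds[OF hs fb] assms(3) by blast

lemma cfc_tendsto:
  assumes "continuous_on {m..M} f" "\<And>n. 0 \<le> e n" "\<And>n x. x \<in> {m..M} \<Longrightarrow> \<bar>f x - poly (p n) x\<bar> \<le> e n"
    and "e \<longlonglongrightarrow> 0"
  shows "(\<lambda>n. poly_op H (p n) A) \<longlonglongrightarrow> cfc H f A"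
proof -
  have "(\<lambda>n. poly_op H (p n) A - cfc H f A) \<longlonglongrightarrow> 0"
  proof (rule Lim_null_comparison[OF _ assms(4)])
    show "\<forall>\<^sub>F n in sequentially. norm (poly_op H (p n) A - cfc H f A) \<le> e n"
      using cfc_approx[OF assms(1-3)] by (simp add: norm_minus_commute)
  qed
  then show ?thesis by (rule LIM_zero_cancel)
qed

lemma cfc_sequence:
  assumes "continuous_on {m..M} f"
  obtains p where "\<And>n x. x \<in> {m..M} \<Longrightarrow> \<bar>f x - poly (p n) x\<bar> \<le> inverse (real (Suc n))"
    "(\<lambda>n. poly_op H (p n) A) \<longlonglongrightarrow> cfc H f A"
proof -
  obtain p where p: "\<And>n x. x \<in> {m..M} \<Longrightarrow> \<bar>f x - poly (p n) x\<bar> \<le> inverse (real (Suc n))"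
    using polynomial_sequence[OF assms] by metis
  moreover have "(\<lambda>n. poly_op H (p n) A) \<longlonglongrightarrow> cfc H f A"
    by (rule cfc_tendsto[OF assms _ p LIMSEQ_inverse_real_of_nat]) simp_all
  ultimately show thesis by (rule that)
qed

lemma cfc_self_adjoint:
  assumes "continuous_on {m..M} f"
  shows "self_adjoint_on H (cfc H f A)"
  by (rule cfc_sequence[OF assms])
    (erule self_adjoint_limit[OF hs self_adjoint_poly_op[OF hs form_boundsD(1)[OF fb]]])

lemma cfc_cong:
  assumes "\<And>x. x \<in> {m..M} \<Longrightarrow> f x = g x"
  shows "cfc H f A = cfc H g A"
proof -
  have "f x = g x" if "x \<in> spectrum_on H A" for x
    using assms spectrum_form_bounds[OF hs fb] that by blast
  then show ?thesis by (simp add: cfc_def is_cfc_def)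
qed

lemma cfc_poly: "cfc H (poly p) A = poly_op H p A"
  using cfc_approx[of "poly p" 0 p] by (simp add: continuous_on_poly)

lemma cfc_const: "cfc H (\<lambda>x. c) A = c *\<^sub>R ident H"
proof -
  have "poly [:c:] = (\<lambda>x. c)" by (simp add: fun_eq_iff)
  then show ?thesis using cfc_poly[of "[:c:]"] by (simp add: poly_op_const[OF hs])
qed

lemma cfc_ident: "cfc H (\<lambda>x. x) A = A"
proof -
  have "poly [:0, 1:] = (\<lambda>x::real. x)" by (simp add: fun_eq_iff)
  then show ?thesis using cfc_poly[of "[:0, 1:]"]
    by (simp add: poly_op_pCons operators_ident(1)[OF hs form_boundsD(2)[OF fb]])
qed

lemma cfc_add:
  assumes f: "continuous_on {m..M} f" and g: "continuous_on {m..M} g"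
  shows "cfc H (\<lambda>x. f x + g x) A = cfc H f A + cfc H g A"
proof -
  obtain p where p: "\<And>n x. x \<in> {m..M} \<Longrightarrow> \<bar>f x - poly (p n) x\<bar> \<le> inverse (real (Suc n))"
    "(\<lambda>n. poly_op H (p n) A) \<longlonglongrightarrow> cfc H f A" using cfc_sequence[OF f] by blast
  obtain q where q: "\<And>n x. x \<in> {m..M} \<Longrightarrow> \<bar>g x - poly (q n) x\<bar> \<le> inverse (real (Suc n))"
    "(\<lambda>n. poly_op H (q n) A) \<longlonglongrightarrow> cfc H g A" using cfc_sequence[OF g] by blast
  have "(\<lambda>n. poly_op H (p n + q n) A) \<longlonglongrightarrow> cfc H (\<lambda>x. f x + g x) A"
  proof (rule cfc_tendsto)
    show "(\<lambda>n. 2 * inverse (real (Suc n))) \<longlonglongrightarrow> 0"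
      using tendsto_mult_left[OF LIMSEQ_inverse_real_of_nat, of 2] by simp
    show "\<bar>f x + g x - poly (p n + q n) x\<bar> \<le> 2 * inverse (real (Suc n))" if "x \<in> {m..M}" for x n
      using p(1)[OF that, of n] q(1)[OF that, of n] unfolding poly_add by linarith
  qed (intro continuous_intros f g, simp)
  moreover have "(\<lambda>n. poly_op H (p n + q n) A) \<longlonglongrightarrow> cfc H f A + cfc H g A"
    unfolding poly_op_add by (intro tendsto_intros p q)
  ultimately show ?thesis by (rule LIMSEQ_unique)
qed

lemma cfc_mult:
  assumes f: "continuous_on {m..M} f" and g: "continuous_on {m..M} g"
  shows "cfc H (\<lambda>x. f x * g x) A = cfc H f A o\<^sub>L cfc H g A"
proof -
  obtain p where p: "\<And>n x. x \<in> {m..M} \<Longrightarrow> \<bar>f x - poly (p n) x\<bar> \<le> inverse (real (Suc n))"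
    "(\<lambda>n. poly_op H (p n) A) \<longlonglongrightarrow> cfc H f A" using cfc_sequence[OF f] by blast
  obtain q where q: "\<And>n x. x \<in> {m..M} \<Longrightarrow> \<bar>g x - poly (q n) x\<bar> \<le> inverse (real (Suc n))"
    "(\<lambda>n. poly_op H (q n) A) \<longlonglongrightarrow> cfc H g A" using cfc_sequence[OF g] by blast
  obtain F where F: "0 \<le> F" "\<And>x. x \<in> {m..M} \<Longrightarrow> \<bar>f x\<bar> \<le> F" using bounded_on_Icc[OF f] by metis
  obtain G where G: "0 \<le> G" "\<And>x. x \<in> {m..M} \<Longrightarrow> \<bar>g x\<bar> \<le> G" using bounded_on_Icc[OF g] by metis
  have "(\<lambda>n. poly_op H (p n * q n) A) \<longlonglongrightarrow> cfc H (\<lambda>x. f x * g x) A"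
  proof (rule cfc_tendsto)
    show "(\<lambda>n. (F + (G + 1)) * inverse (real (Suc n))) \<longlonglongrightarrow> 0"
      using tendsto_mult_left[OF LIMSEQ_inverse_real_of_nat, of "F + (G + 1)"] by simp
    fix x n assume x: "x \<in> {m..M}"
    let ?e = "inverse (real (Suc n))"
    have e1: "?e \<le> 1" by (simp add: inverse_le_1_iff)
    have "\<bar>poly (q n) x\<bar> \<le> G + 1" using q(1)[OF x, of n] G(2)[OF x] e1 by linarith
    then have "\<bar>f x - poly (p n) x\<bar> * \<bar>poly (q n) x\<bar> \<le> ?e * (G + 1)"
      by (intro mult_mono p x) auto
    moreover have "\<bar>f x\<bar> * \<bar>g x - poly (q n) x\<bar> \<le> F * ?e"
      by (intro mult_mono F q x) auto
    moreover have "f x * g x - poly (p n * q n) x = f x * (g x - poly (q n) x) + (f x - poly (p n) x) * poly (q n) x"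
      by (simp add: algebra_simps)
    moreover have "\<bar>f x * (g x - poly (q n) x) + (f x - poly (p n) x) * poly (q n) x\<bar>
        \<le> \<bar>f x\<bar> * \<bar>g x - poly (q n) x\<bar> + \<bar>f x - poly (p n) x\<bar> * \<bar>poly (q n) x\<bar>"
      unfolding abs_mult[symmetric] by (rule abs_triangle_ineq)
    ultimately have "\<bar>f x * g x - poly (p n * q n) x\<bar> \<le> F * ?e + ?e * (G + 1)" by linarith
    also have "\<dots> = (F + (G + 1)) * ?e" by (simp only: distrib_right mult.commute[of ?e])
    finally show "\<bar>f x * g x - poly (p n * q n) x\<bar> \<le> (F + (G + 1)) * ?e" .
  qed (use F G in \<open>auto intro!: continuous_intros f g\<close>)
  moreover have "(\<lambda>n. poly_op H (p n * q n) A) \<longlonglongrightarrow> (cfc H f A o\<^sub>L cfc H g A)"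
    unfolding poly_op_mult[OF hs form_boundsD(2)[OF fb]]
    by (intro bounded_bilinear.tendsto[OF bounded_bilinear_blinfun_compose] p q)
  ultimately show ?thesis by (rule LIMSEQ_unique)
qed

lemma cfc_cmult: "continuous_on {m..M} f \<Longrightarrow> cfc H (\<lambda>x. c * f x) A = c *\<^sub>R cfc H f A"
  using cfc_mult[of "\<lambda>x. c" f] by (simp add: cfc_const compose_simps operators_ident(2)[OF hs cfc_operators])

lemma cfc_diff:
  assumes f: "continuous_on {m..M} f" and g: "continuous_on {m..M} g"
  shows "cfc H (\<lambda>x. f x - g x) A = cfc H f A - cfc H g A"
  using cfc_add[of "\<lambda>x. f x - g x" g] assms by (simp add: continuous_on_diff)

text \<open>\<open>a \<le> f \<le> b\<close> says that \<open>f\<close> differs from the constant \<open>(a + b) / 2\<close> by at most \<open>(b - a) / 2\<close>, and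
  the norm bound for this difference turns back into form bounds.\<close>

lemma cfc_form_bounds:
  assumes "continuous_on {m..M} f" "\<And>x. x \<in> {m..M} \<Longrightarrow> a \<le> f x" "\<And>x. x \<in> {m..M} \<Longrightarrow> f x \<le> b" "a \<le> b"
  shows "form_bounds H a b (cfc H f A)"
proof -
  have "norm (cfc H f A - poly_op H [:(a + b) / 2:] A) \<le> (b - a) / 2"
  proof (rule cfc_approx[OF assms(1)])
    fix x assume "x \<in> {m..M}"
    from assms(2,3)[OF this] show "\<bar>f x - poly [:(a + b) / 2:] x\<bar> \<le> (b - a) / 2"
      by (simp add: abs_if field_simps)
  qed (use assms(4) in simp)
  then have "form_bounds H ((a + b) / 2 - (b - a) / 2) ((a + b) / 2 + (b - a) / 2) (cfc H f A)"
    by (intro form_bounds_norm[OF hs cfc_self_adjoint[OF assms(1)]]) (simp add: poly_op_const[OF hs])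
  then show ?thesis by (simp add: field_simps)
qed

lemma cfc_mono:
  assumes f: "continuous_on {m..M} f" and g: "continuous_on {m..M} g"
    and le: "\<And>y. y \<in> {m..M} \<Longrightarrow> f y \<le> g y" and x: "x \<in> H"
  shows "inner ((cfc H f A) \<cdot> x) x \<le> inner ((cfc H g A) \<cdot> x) x"
proof -
  have c: "continuous_on {m..M} (\<lambda>x. g x - f x)" by (intro continuous_intros f g)
  obtain K where K: "0 \<le> K" "\<And>x. x \<in> {m..M} \<Longrightarrow> \<bar>g x - f x\<bar> \<le> K" using bounded_on_Icc[OF c] by metis
  have "form_bounds H 0 K (cfc H (\<lambda>x. g x - f x) A)"
    by (rule cfc_form_bounds[OF c]) (use le K in \<open>force simp: abs_le_iff\<close>)+
  from form_boundsD(4)[OF this x] show ?thesis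
    by (simp add: cfc_diff[OF g f] blinfun.bilinear_simps inner_diff)
qed

lemma cfc_dist_le:
  assumes f: "continuous_on {m..M} f" and g: "continuous_on {m..M} g" and "0 \<le> e"
    and le: "\<And>y. y \<in> {m..M} \<Longrightarrow> \<bar>f y - g y\<bar> \<le> e"
  shows "norm (cfc H f A - cfc H g A) \<le> e"
  using cfc_approx[of "\<lambda>x. f x - g x" e 0] assms by (simp add: cfc_diff[OF f g, symmetric] continuous_on_diff)

lemma cfc_affine:
  assumes fb': "form_bounds H m' M' (a *\<^sub>R A + b *\<^sub>R ident H)" and f: "continuous_on {m'..M'} f"
    and maps: "\<And>x. x \<in> {m..M} \<Longrightarrow> a * x + b \<in> {m'..M'}"
  shows "cfc H f (a *\<^sub>R A + b *\<^sub>R ident H) = cfc H (\<lambda>x. f (a * x + b)) A"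
proof -
  obtain p where p: "\<And>n x. x \<in> {m'..M'} \<Longrightarrow> \<bar>f x - poly (p n) x\<bar> \<le> inverse (real (Suc n))"
    using polynomial_sequence[OF f] by metis
  let ?B = "a *\<^sub>R A + b *\<^sub>R ident H"
  have lim: "(\<lambda>n. poly_op H (pcompose (p n) [:b, a:]) A) \<longlonglongrightarrow> cfc H (\<lambda>x. f (a * x + b)) A"
  proof (rule cfc_tendsto[OF _ _ _ LIMSEQ_inverse_real_of_nat])
    show "continuous_on {m..M} (\<lambda>x. f (a * x + b))"
      by (rule continuous_on_compose2[OF f]) (use maps in \<open>auto intro!: continuous_intros\<close>)
    show "\<bar>f (a * x + b) - poly (pcompose (p n) [:b, a:]) x\<bar> \<le> inverse (real (Suc n))" if "x \<in> {m..M}" for x n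
      using p[OF maps[OF that], of n] by (simp add: poly_pcompose algebra_simps)
  qed simp
  have "norm (cfc H f ?B - poly_op H (pcompose (p n) [:b, a:]) A) \<le> inverse (real (Suc n))" for n
  proof -
    have "norm (cfc H f ?B - poly_op H (p n) ?B) \<le> inverse (real (Suc n))"
      using is_cfc_norm_le[OF form_boundsD(1)[OF fb'] cfc_is_cfc[OF fb' f]] p spectrum_form_bounds[OF hs fb']
      by (meson inverse_nonnegative_iff_nonnegative of_nat_0_le_iff subsetD)
    then show ?thesis by (simp only: poly_op_affine[OF hs form_boundsD(2)[OF fb]])
  qed
  then have "(\<lambda>n. cfc H f ?B - poly_op H (pcompose (p n) [:b, a:]) A) \<longlonglongrightarrow> 0"
    by (intro Lim_null_comparison[OF _ LIMSEQ_inverse_real_of_nat]) simp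
  from tendsto_diff[OF tendsto_const[of "cfc H f ?B"] this] have "(\<lambda>n. poly_op H (pcompose (p n) [:b, a:]) A) \<longlonglongrightarrow> cfc H f ?B"
    by simp
  from LIMSEQ_unique[OF this lim] show ?thesis .
qed

end

end

section \<open>The weighted geometric mean\<close>

lemma continuous_on_powr_Icc: "0 < m \<Longrightarrow> continuous_on {m..M} (\<lambda>x::real. x powr r)"
  by (intro continuous_intros) auto

lemma positive_Icc_bounds:
  fixes f :: "real \<Rightarrow> real"
  assumes f: "continuous_on {m..M} f" and "\<And>x. x \<in> {m..M} \<Longrightarrow> 0 < f x"
  obtains a b where "0 < a" "a \<le> b" "\<And>x. x \<in> {m..M} \<Longrightarrow> a \<le> f x" "\<And>x. x \<in> {m..M} \<Longrightarrow> f x \<le> b"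
proof (cases "m \<le> M")
  case True
  obtain y where y: "y \<in> {m..M}" "\<And>x. x \<in> {m..M} \<Longrightarrow> f y \<le> f x"
    using continuous_attains_inf[OF compact_Icc _ f] True by auto
  obtain z where z: "z \<in> {m..M}" "\<And>x. x \<in> {m..M} \<Longrightarrow> f x \<le> f z"
    using continuous_attains_sup[OF compact_Icc _ f] True by auto
  show thesis by (rule that[of "f y" "f z"]) (use y z assms(2) in auto)
next
  case False
  then show thesis using that[of 1 1] by auto
qed

definition op_root :: "'u::complex_hilbert set \<Rightarrow> ('u \<Rightarrow>\<^sub>L 'u) \<Rightarrow> ('u \<Rightarrow>\<^sub>L 'u)" where
  "op_root H S = op_powr H S (1/2)"

definition op_inv_root :: "'u::complex_hilbert set \<Rightarrow> ('u \<Rightarrow>\<^sub>L 'u) \<Rightarrow> ('u \<Rightarrow>\<^sub>L 'u)" where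
  "op_inv_root H S = op_powr H S (-1/2)"

definition mean_middle :: "'u::complex_hilbert set \<Rightarrow> ('u \<Rightarrow>\<^sub>L 'u) \<Rightarrow> ('u \<Rightarrow>\<^sub>L 'u) \<Rightarrow> ('u \<Rightarrow>\<^sub>L 'u)" where
  "mean_middle H S T = op_inv_root H S o\<^sub>L T o\<^sub>L op_inv_root H S"

lemma mean_middle_apply:
  "(mean_middle H S T) \<cdot> x = (op_inv_root H S) \<cdot> (T \<cdot> ((op_inv_root H S) \<cdot> x))"
  by (simp add: mean_middle_def)

context
  fixes H :: "'u::complex_hilbert set"
  assumes hs: "hilbert_space H"
begin

text \<open>Taking inverses reverses the operator order: with \<open>y = S\<inverse> x\<close> the form of \<open>R\<close> is non-negative
  at \<open>y - R\<inverse> x\<close>, and its value there is at most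
  \<open>\<langle>R\<inverse> x, x\<rangle> - \<langle>S\<inverse> x, x\<rangle>\<close>.\<close>

lemma inverse_antitone:
  assumes R: "self_adjoint_on H R" "\<And>x. x \<in> H \<Longrightarrow> 0 \<le> inner (R \<cdot> x) x"
    and le: "\<And>x. x \<in> H \<Longrightarrow> inner (R \<cdot> x) x \<le> inner (S \<cdot> x) x"
    and R': "R' \<in> operators H" "\<And>x. x \<in> H \<Longrightarrow> R \<cdot> (R' \<cdot> x) = x"
    and S': "S' \<in> operators H" "\<And>x. x \<in> H \<Longrightarrow> S \<cdot> (S' \<cdot> x) = x"
    and x: "x \<in> H"
  shows "inner (S' \<cdot> x) x \<le> inner (R' \<cdot> x) x"
proof -
  let ?y = "S' \<cdot> x" and ?z = "R' \<cdot> x"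
  have mem: "?y \<in> H" "?z \<in> H" by (simp_all add: operators_in S' R')
  have "0 \<le> inner (R \<cdot> (?y - ?z)) (?y - ?z)"
    by (intro R hilbert_space_D[OF hs] mem)
  also have "\<dots> = inner (R \<cdot> ?y) ?y - 2 * inner x ?y + inner ?z x"
    using self_adjoint_onD(2)[OF R(1), of ?y ?z] R'(2)[OF x]
    by (simp add: blinfun.bilinear_simps inner_diff inner_commute)
  also have "inner (R \<cdot> ?y) ?y \<le> inner x ?y" using le[OF mem(1)] S'(2)[OF x] by simp
  finally show ?thesis by (simp add: inner_commute)
qed

context
  fixes S m M
  assumes S: "form_bounds H m M S" and m: "0 < m"
begin

lemma op_powr_self_adjoint: "self_adjoint_on H (op_powr H S r)"
  unfolding op_powr_def by (rule cfc_self_adjoint[OF hs S continuous_on_powr_Icc[OF m]])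

lemma op_powr_compose: "op_powr H S a o\<^sub>L op_powr H S b = op_powr H S (a + b)"
  unfolding op_powr_def cfc_mult[OF hs S continuous_on_powr_Icc[OF m] continuous_on_powr_Icc[OF m], symmetric]
  by (simp add: powr_add)

lemma op_powr_0: "op_powr H S 0 = ident H"
proof -
  have "op_powr H S 0 = cfc H (\<lambda>x. 1) S"
    unfolding op_powr_def by (rule cfc_cong[OF hs S]) (use m in auto)
  then show ?thesis by (simp add: cfc_const[OF hs S])
qed

lemma op_powr_1: "op_powr H S 1 = S"
proof -
  have "op_powr H S 1 = cfc H (\<lambda>x. x) S"
    unfolding op_powr_def by (rule cfc_cong[OF hs S]) (use m in auto)
  then show ?thesis by (simp add: cfc_ident[OF hs S])
qed

lemma op_powr_apply_apply:
  "(op_powr H S a) \<cdot> ((op_powr H S b) \<cdot> x) = (op_powr H S (a + b)) \<cdot> x"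
  unfolding op_powr_compose[symmetric] by simp

lemma op_powr_form_bounds: obtains a b where "0 < a" "a \<le> b" "form_bounds H a b (op_powr H S r)"
proof -
  have "\<And>x. x \<in> {m..M} \<Longrightarrow> 0 < x powr r" using m by auto
  from positive_Icc_bounds[OF continuous_on_powr_Icc[OF m] this]
  obtain a b where ab: "0 < a" "a \<le> b" "\<And>x. x \<in> {m..M} \<Longrightarrow> a \<le> x powr r" "\<And>x. x \<in> {m..M} \<Longrightarrow> x powr r \<le> b"
    by metis
  have "form_bounds H a b (op_powr H S r)"
    unfolding op_powr_def by (rule cfc_form_bounds[OF hs S continuous_on_powr_Icc[OF m] ab(3,4,2)])
  with ab that show thesis by blast
qed

lemma geometric_mean_eq:
  "geometric_mean H \<alpha> S T = op_root H S o\<^sub>L op_powr H (mean_middle H S T) \<alpha> o\<^sub>L op_root H S"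
proof (cases "S = 0")
  case True
  have "(op_powr H S (1/2)) \<cdot> x = blinfun_apply 0 x" if x: "x \<in> H" for x
  proof -
    have "inner x x = 0"
      using form_boundsD(4)[OF S x] m True inner_ge_zero[of x] by (simp add: mult_le_0_iff)
    then show ?thesis by simp
  qed
  then have "op_powr H S (1/2) = 0"
    by (rule operators_eqI[OF hs self_adjoint_onD(1)[OF op_powr_self_adjoint] operators_zero[OF hs]])
  then show ?thesis by (simp add: geometric_mean_def op_root_def)
qed (simp add: geometric_mean_def op_root_def op_inv_root_def mean_middle_def)

text \<open>In the following \<open>S\<close> and \<open>T\<close> are comparable, \<open>s S \<le> T \<le> t S\<close>.  Then the middle factor
  \<open>Y = S\<^sup>-\<^sup>1\<^sup>/\<^sup>2 T S\<^sup>-\<^sup>1\<^sup>/\<^sup>2\<close> lies between \<open>s\<close> and \<open>t\<close>, and inequalities between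
  functions on \<open>{s..t}\<close> become inequalities between means after conjugation with
  \<open>S\<^sup>1\<^sup>/\<^sup>2\<close>.\<close>

context
  fixes T s t
  assumes T: "self_adjoint_on H T" and s: "0 < s"
    and sT: "\<And>x. x \<in> H \<Longrightarrow> s * inner (S \<cdot> x) x \<le> inner (T \<cdot> x) x"
    and tT: "\<And>x. x \<in> H \<Longrightarrow> inner (T \<cdot> x) x \<le> t * inner (S \<cdot> x) x"
begin

abbreviation (input) "root_S \<equiv> blinfun_apply (op_root H S)"
abbreviation (input) "inv_root_S \<equiv> blinfun_apply (op_inv_root H S)"
abbreviation (input) "middle \<equiv> mean_middle H S T"

lemma root_facts:
  assumes "x \<in> H"
  shows "root_S (inv_root_S x) = x" "inv_root_S (root_S x) = x" "root_S (root_S x) = S \<cdot> x"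
  using assms
  by (simp_all add: op_root_def op_inv_root_def op_powr_apply_apply op_powr_0 op_powr_1 ident(2)[OF hs])

lemma root_adjoint:
  "inner (root_S x) y = inner x (root_S y)" "inner (inv_root_S x) y = inner x (inv_root_S y)"
  unfolding op_root_def op_inv_root_def by (rule self_adjoint_onD(2)[OF op_powr_self_adjoint])+

lemma root_mem: "root_S x \<in> H" "inv_root_S x \<in> H" "T \<cdot> x \<in> H"
  using operators_in[OF self_adjoint_onD(1)[OF op_powr_self_adjoint]] operators_in[OF self_adjoint_onD(1)[OF T]]
  by (simp_all add: op_root_def op_inv_root_def)

lemma middle_bounds: "form_bounds H s t middle"
  unfolding form_bounds_def
proof (intro conjI ballI)
  show "self_adjoint_on H middle" unfolding mean_middle_def op_inv_root_def
    by (rule self_adjoint_conj[OF hs T op_powr_self_adjoint])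
  fix x assume x: "x \<in> H"
  let ?y = "inv_root_S x"
  have "inner (S \<cdot> ?y) ?y = inner (root_S (root_S ?y)) ?y"
    using root_facts(3)[OF root_mem(2)] by simp
  also have "\<dots> = inner x x"
    by (simp add: root_adjoint(1) root_facts[OF x])
  finally have S1: "inner (S \<cdot> ?y) ?y = inner x x" .
  have T1: "inner (middle \<cdot> x) x = inner (T \<cdot> ?y) ?y"
    by (simp add: mean_middle_apply root_adjoint(2))
  show "s * inner x x \<le> inner (middle \<cdot> x) x" "inner (middle \<cdot> x) x \<le> t * inner x x"
    using sT[OF root_mem(2)[of x]] tT[OF root_mem(2)[of x]] unfolding T1 S1 by auto
qed

lemma geometric_mean_self_adjoint: "self_adjoint_on H (geometric_mean H \<alpha> S T)"
  unfolding geometric_mean_eq op_root_def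
  by (intro self_adjoint_conj[OF hs] op_powr_self_adjoint)
    (simp add: op_powr_def[of H middle] cfc_self_adjoint[OF hs middle_bounds continuous_on_powr_Icc[OF s]])

lemma geometric_mean_form:
  assumes "x \<in> H"
  shows "inner ((geometric_mean H \<alpha> S T) \<cdot> x) x
    = inner ((op_powr H middle \<alpha>) \<cdot> (root_S x)) (root_S x)"
  by (simp add: geometric_mean_eq root_adjoint(1))

lemma linear_middle_form:
  assumes x: "x \<in> H"
  shows "inner ((cfc H (\<lambda>y. a + b * y) middle) \<cdot> (root_S x)) (root_S x)
    = a * inner (S \<cdot> x) x + b * inner (T \<cdot> x) x"
proof -
  have "cfc H (\<lambda>y. a + b * y) middle = a *\<^sub>R ident H + b *\<^sub>R middle"
    using cfc_add[OF hs middle_bounds, of "\<lambda>y. a" "\<lambda>y. b * y"] cfc_cmult[OF hs middle_bounds, of "\<lambda>y. y" b]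
    by (simp add: continuous_intros cfc_const[OF hs middle_bounds] cfc_ident[OF hs middle_bounds])
  moreover have "inner (middle \<cdot> (root_S x)) (root_S x) = inner (T \<cdot> x) x"
    by (simp add: mean_middle_apply root_facts[OF x] root_adjoint(2))
  moreover have "inner (root_S x) (root_S x) = inner (S \<cdot> x) x"
    using root_facts(3)[OF x] root_adjoint(1)[of x "root_S x"] by (simp add: inner_commute)
  ultimately show ?thesis
    by (simp add: blinfun.bilinear_simps inner_add_left ident(2)[OF hs root_mem(1)])
qed

text \<open>An affine function of \<open>Y\<close> becomes, after conjugation, a linear combination of \<open>S\<close> and \<open>T\<close>.\<close>

lemma geometric_mean_le_linear:
  assumes "x \<in> H" "\<And>y. y \<in> {s..t} \<Longrightarrow> y powr \<alpha> \<le> a + b * y"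
  shows "inner ((geometric_mean H \<alpha> S T) \<cdot> x) x
    \<le> a * inner (S \<cdot> x) x + b * inner (T \<cdot> x) x"
  unfolding geometric_mean_form[OF assms(1)] linear_middle_form[OF assms(1), symmetric] op_powr_def[of H middle]
  by (rule cfc_mono[OF hs middle_bounds])
    (auto intro!: continuous_intros continuous_on_powr_Icc s root_mem assms(2)[simplified])

lemma geometric_mean_ge_linear:
  assumes "x \<in> H" "\<And>y. y \<in> {s..t} \<Longrightarrow> a + b * y \<le> c * y powr \<alpha>"
  shows "a * inner (S \<cdot> x) x + b * inner (T \<cdot> x) x
    \<le> c * inner ((geometric_mean H \<alpha> S T) \<cdot> x) x"
proof -
  have "inner ((cfc H (\<lambda>y. a + b * y) middle) \<cdot> (root_S x)) (root_S x)
      \<le> inner ((cfc H (\<lambda>y. c * y powr \<alpha>) middle) \<cdot> (root_S x)) (root_S x)"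
    by (rule cfc_mono[OF hs middle_bounds])
      (auto intro!: continuous_intros continuous_on_powr_Icc s root_mem assms(2)[simplified])
  then show ?thesis
    by (simp add: geometric_mean_form[OF assms(1)] linear_middle_form[OF assms(1)] op_powr_def[of H middle]
        cfc_cmult[OF hs middle_bounds continuous_on_powr_Icc[OF s]] blinfun.bilinear_simps)
qed

text \<open>The inverse of the geometric mean is
  \<open>S\<^sup>-\<^sup>1\<^sup>/\<^sup>2 Y\<^sup>-\<^sup>\<alpha> S\<^sup>-\<^sup>1\<^sup>/\<^sup>2\<close>; since
  \<open>y powr -\<alpha> \<le> (1 - \<alpha>) + \<alpha> / y\<close>, it lies below the arithmetic mean of the inverses.  This is
  the inequality between harmonic and geometric mean in inverted form.\<close>

lemma geometric_mean_inverse: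
  assumes \<alpha>: "0 \<le> \<alpha>" "\<alpha> \<le> 1"
    and S': "S' \<in> operators H" "\<And>x. x \<in> H \<Longrightarrow> S \<cdot> (S' \<cdot> x) = x"
    and T': "T' \<in> operators H" "\<And>x. x \<in> H \<Longrightarrow> T \<cdot> (T' \<cdot> x) = x"
  obtains U where "self_adjoint_on H U" "\<And>x. x \<in> H \<Longrightarrow> 0 \<le> inner (U \<cdot> x) x"
    "\<And>x. x \<in> H \<Longrightarrow> U \<cdot> ((geometric_mean H \<alpha> S T) \<cdot> x) = x"
    "\<And>x. x \<in> H \<Longrightarrow> inner (U \<cdot> x) x
       \<le> (1 - \<alpha>) * inner (S' \<cdot> x) x + \<alpha> * inner (T' \<cdot> x) x"
proof -
  let ?U = "op_inv_root H S o\<^sub>L op_powr H middle (- \<alpha>) o\<^sub>L op_inv_root H S"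
  note mb = middle_bounds
  have powr_mid: "self_adjoint_on H (op_powr H middle r)" for r
    unfolding op_powr_def[of H middle] by (rule cfc_self_adjoint[OF hs mb continuous_on_powr_Icc[OF s]])
  have inv_mid: "(op_powr H middle (- r)) \<cdot> ((op_powr H middle r) \<cdot> x) = x"
    if "x \<in> H" for x r
  proof -
    have "op_powr H middle (- r) o\<^sub>L op_powr H middle r = cfc H (\<lambda>y. 1) middle"
      unfolding op_powr_def[of H middle] cfc_mult[OF hs mb continuous_on_powr_Icc[OF s] continuous_on_powr_Icc[OF s], symmetric]
      by (rule cfc_cong[OF hs mb]) (use s in \<open>auto simp flip: powr_add\<close>)
    then have "op_powr H middle (- r) o\<^sub>L op_powr H middle r = ident H" using cfc_const[OF hs mb, of 1] by simp
    from arg_cong[OF this, of "\<lambda>T. T \<cdot> x"] show ?thesis using ident(2)[OF hs that] by simp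
  qed
  have sa: "self_adjoint_on H ?U" unfolding op_inv_root_def by (rule self_adjoint_conj[OF hs powr_mid op_powr_self_adjoint])
  have form: "inner (?U \<cdot> x) x = inner ((op_powr H middle (- \<alpha>)) \<cdot> (inv_root_S x)) (inv_root_S x)"
    for x
    by (simp add: root_adjoint(2))
  have pos: "0 \<le> inner (?U \<cdot> x) x" if x: "x \<in> H" for x
  proof -
    have "inner ((cfc H (\<lambda>y. 0) middle) \<cdot> (inv_root_S x)) (inv_root_S x)
        \<le> inner ((op_powr H middle (- \<alpha>)) \<cdot> (inv_root_S x)) (inv_root_S x)"
      unfolding op_powr_def[of H middle]
      by (rule cfc_mono[OF hs mb]) (auto intro!: continuous_intros continuous_on_powr_Icc s root_mem)
    then show ?thesis unfolding form by (simp add: cfc_const[OF hs mb])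
  qed
  have inv: "?U \<cdot> ((geometric_mean H \<alpha> S T) \<cdot> x) = x" if x: "x \<in> H" for x
    using root_facts[OF x] root_facts(2)[OF operators_in[OF self_adjoint_onD(1)[OF powr_mid]]]
      inv_mid[OF root_mem(1)] by (simp add: geometric_mean_eq)
  have le: "inner (?U \<cdot> x) x
       \<le> (1 - \<alpha>) * inner (S' \<cdot> x) x + \<alpha> * inner (T' \<cdot> x) x" if x: "x \<in> H" for x
  proof -
    let ?v = "inv_root_S x"
    have v: "?v \<in> H" by (rule root_mem(2))
    have S'x: "S' \<cdot> x \<in> H" and T'x: "T' \<cdot> x \<in> H" by (auto intro: operators_in S' T')
    have "inv_root_S (inv_root_S (root_S (root_S (S' \<cdot> x)))) = S' \<cdot> x"
      by (simp only: root_facts(2)[OF root_mem(1)] root_facts(2)[OF S'x])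
    then have "inv_root_S ?v = S' \<cdot> x"
      using root_facts(3)[OF S'x] S'(2)[OF x] by simp
    then have vv: "inner ?v ?v = inner (S' \<cdot> x) x"
      using root_adjoint(2)[of ?v x] by (simp add: root_adjoint(2))
    have "middle \<cdot> (root_S (T' \<cdot> x)) = ?v"
      using root_facts(2)[OF T'x] T'(2)[OF x] by (simp add: mean_middle_apply)
    moreover have "(op_powr H middle (-1)) \<cdot> ((op_powr H middle 1) \<cdot> (root_S (T' \<cdot> x)))
        = root_S (T' \<cdot> x)"
      by (rule inv_mid[OF root_mem(1)])
    moreover have "op_powr H middle 1 = middle"
    proof -
      have "op_powr H middle 1 = cfc H (\<lambda>x. x) middle"
        unfolding op_powr_def[of H middle] by (rule cfc_cong[OF hs mb]) (use s in auto)
      then show ?thesis by (simp add: cfc_ident[OF hs mb])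
    qed
    ultimately have "(op_powr H middle (-1)) \<cdot> ?v = root_S (T' \<cdot> x)" by simp
    then have Yv: "inner ((op_powr H middle (-1)) \<cdot> ?v) ?v = inner (T' \<cdot> x) x"
      by (simp add: root_adjoint(1) root_facts(1)[OF x])
    have young: "y powr - \<alpha> \<le> (1 - \<alpha>) + \<alpha> * y powr (-1)" if "y \<in> {s..t}" for y
    proof -
      have y: "0 < y" using that s by simp
      have "1 powr (1 - \<alpha>) * (y powr -1) powr \<alpha> \<le> (1 - \<alpha>) * 1 + \<alpha> * (y powr -1)"
        using \<alpha> y by (intro Youngs_inequality_0) auto
      moreover have "(y powr -1) powr \<alpha> = y powr - \<alpha>" by (simp only: powr_powr) simp
      ultimately show ?thesis by simp
    qed
    have "inner ((op_powr H middle (- \<alpha>)) \<cdot> ?v) ?v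
        \<le> inner ((cfc H (\<lambda>y. (1 - \<alpha>) + \<alpha> * y powr (-1)) middle) \<cdot> ?v) ?v"
      unfolding op_powr_def[of H middle]
      by (rule cfc_mono[OF hs mb]) (use s v young in \<open>auto intro!: continuous_intros continuous_on_powr_Icc\<close>)
    also have "cfc H (\<lambda>y. (1 - \<alpha>) + \<alpha> * y powr (-1)) middle = (1 - \<alpha>) *\<^sub>R ident H + \<alpha> *\<^sub>R op_powr H middle (-1)"
      using cfc_add[OF hs mb continuous_on_const continuous_on_mult_left[OF continuous_on_powr_Icc[OF s]], of "1 - \<alpha>" \<alpha> "-1"]
      by (simp only: cfc_const[OF hs mb] cfc_cmult[OF hs mb continuous_on_powr_Icc[OF s]] op_powr_def)
    finally show ?thesis
      unfolding form by (simp add: blinfun.bilinear_simps inner_add_left ident(2)[OF hs v] vv Yv)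
  qed
  show thesis by (rule that[OF sa pos inv le])
qed

end

end

end

section \<open>Doubled spaces and operator concavity\<close>

text \<open>\<open>K\<close> is the orthogonal sum of two isometric copies of \<open>F\<close>; \<open>E1\<close> and \<open>E2\<close> are the embeddings and the
  primed operators their adjoints.\<close>

definition doubling :: "'u::complex_hilbert set \<Rightarrow> 'u set \<Rightarrow> ('u \<Rightarrow>\<^sub>L 'u) \<Rightarrow> ('u \<Rightarrow>\<^sub>L 'u)
    \<Rightarrow> ('u \<Rightarrow>\<^sub>L 'u) \<Rightarrow> ('u \<Rightarrow>\<^sub>L 'u) \<Rightarrow> bool" where
  "doubling F K E1 E2 E1' E2' \<longleftrightarrow> hilbert_space F \<and> hilbert_space K \<and>
     (\<forall>c x. E1 \<cdot> (c *\<^sub>C x) = c *\<^sub>C E1 \<cdot> x \<and> E2 \<cdot> (c *\<^sub>C x) = c *\<^sub>C E2 \<cdot> x \<and>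
            E1' \<cdot> (c *\<^sub>C x) = c *\<^sub>C E1' \<cdot> x \<and> E2' \<cdot> (c *\<^sub>C x) = c *\<^sub>C E2' \<cdot> x) \<and>
     (\<forall>x. E1 \<cdot> x \<in> K \<and> E2 \<cdot> x \<in> K \<and> E1' \<cdot> x \<in> F \<and> E2' \<cdot> x \<in> F) \<and>
     (\<forall>x y. inner (E1 \<cdot> x) y = inner x (E1' \<cdot> y) \<and>
            inner (E2 \<cdot> x) y = inner x (E2' \<cdot> y)) \<and>
     (\<forall>x\<in>F. E1' \<cdot> (E1 \<cdot> x) = x \<and> E2' \<cdot> (E2 \<cdot> x) = x) \<and>
     (\<forall>x\<in>F. E1' \<cdot> (E2 \<cdot> x) = 0 \<and> E2' \<cdot> (E1 \<cdot> x) = 0) \<and>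
     (\<forall>z\<in>K. E1 \<cdot> (E1' \<cdot> z) + E2 \<cdot> (E2' \<cdot> z) = z)"

definition direct_sum :: "('u::complex_hilbert \<Rightarrow>\<^sub>L 'u) \<Rightarrow> ('u \<Rightarrow>\<^sub>L 'u) \<Rightarrow> ('u \<Rightarrow>\<^sub>L 'u) \<Rightarrow> ('u \<Rightarrow>\<^sub>L 'u)
    \<Rightarrow> ('u \<Rightarrow>\<^sub>L 'u) \<Rightarrow> ('u \<Rightarrow>\<^sub>L 'u) \<Rightarrow> ('u \<Rightarrow>\<^sub>L 'u)" where
  "direct_sum E1 E2 E1' E2' X Y = (E1 o\<^sub>L X o\<^sub>L E1') + (E2 o\<^sub>L Y o\<^sub>L E2')"

lemma direct_sum_apply:
  "(direct_sum E1 E2 E1' E2' X Y) \<cdot> z =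
    E1 \<cdot> (X \<cdot> (E1' \<cdot> z)) + E2 \<cdot> (Y \<cdot> (E2' \<cdot> z))"
  by (simp add: direct_sum_def blinfun.bilinear_simps)

context
  fixes F K :: "'u::complex_hilbert set" and E1 E2 E1' E2'
  assumes D: "doubling F K E1 E2 E1' E2'"
begin

abbreviation (input) "block \<equiv> direct_sum E1 E2 E1' E2'"

lemma doubling_spaces: "hilbert_space F" "hilbert_space K"
  using D by (simp_all add: doubling_def)

lemma doubling_scaleC:
  "E1 \<cdot> (c *\<^sub>C x) = c *\<^sub>C E1 \<cdot> x" "E2 \<cdot> (c *\<^sub>C x) = c *\<^sub>C E2 \<cdot> x"
  "E1' \<cdot> (c *\<^sub>C x) = c *\<^sub>C E1' \<cdot> x" "E2' \<cdot> (c *\<^sub>C x) = c *\<^sub>C E2' \<cdot> x"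
  using D unfolding doubling_def by blast+

lemma doubling_in:
  "E1 \<cdot> x \<in> K" "E2 \<cdot> x \<in> K" "E1' \<cdot> x \<in> F" "E2' \<cdot> x \<in> F"
  using D unfolding doubling_def by blast+

lemma doubling_adjoint:
  "inner (E1 \<cdot> x) y = inner x (E1' \<cdot> y)"
  "inner (E2 \<cdot> x) y = inner x (E2' \<cdot> y)"
  using D unfolding doubling_def by blast+

lemma doubling_isometry:
  "x \<in> F \<Longrightarrow> E1' \<cdot> (E1 \<cdot> x) = x" "x \<in> F \<Longrightarrow> E2' \<cdot> (E2 \<cdot> x) = x"
  "x \<in> F \<Longrightarrow> E1' \<cdot> (E2 \<cdot> x) = 0" "x \<in> F \<Longrightarrow> E2' \<cdot> (E1 \<cdot> x) = 0"
  using D unfolding doubling_def by blast+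

lemma doubling_decompose:
  "z \<in> K \<Longrightarrow> E1 \<cdot> (E1' \<cdot> z) + E2 \<cdot> (E2' \<cdot> z) = z"
  using D unfolding doubling_def by blast

lemma doubling_orthogonal:
  assumes "\<And>y. y \<in> K \<Longrightarrow> inner x y = 0"
  shows "E1' \<cdot> x = 0" "E2' \<cdot> x = 0"
proof -
  have "inner (E1' \<cdot> x) (E1' \<cdot> x) = 0" "inner (E2' \<cdot> x) (E2' \<cdot> x) = 0"
    using assms[OF doubling_in(1)] assms[OF doubling_in(2)]
    by (simp_all add: doubling_adjoint[symmetric] inner_commute)
  then show "E1' \<cdot> x = 0" "E2' \<cdot> x = 0" by simp_all
qed

lemma direct_sum_operators:
  assumes "X \<in> operators F" "Y \<in> operators F"
  shows "block X Y \<in> operators K"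
  by (rule operatorsI[OF _ _ _ doubling_spaces(2)])
    (auto simp: direct_sum_apply doubling_scaleC operators_scaleC[OF assms(1)] operators_scaleC[OF assms(2)]
      scaleC_add_right doubling_orthogonal intro!: hilbert_space_D[OF doubling_spaces(2)] doubling_in)

lemma direct_sum_self_adjoint:
  assumes "self_adjoint_on F X" "self_adjoint_on F Y"
  shows "self_adjoint_on K (block X Y)"
proof -
  have "inner ((block X Y) \<cdot> x) y = inner x ((block X Y) \<cdot> y)" for x y
  proof -
    have form: "inner ((block X Y) \<cdot> x) y = inner (X \<cdot> (E1' \<cdot> x)) (E1' \<cdot> y)
        + inner (Y \<cdot> (E2' \<cdot> x)) (E2' \<cdot> y)" for x y
      by (simp add: direct_sum_apply inner_add_left doubling_adjoint)
    show ?thesis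
      unfolding form inner_commute[of x] self_adjoint_onD(2)[OF assms(1), of "E1' \<cdot> x"]
        self_adjoint_onD(2)[OF assms(2), of "E2' \<cdot> x"] by (simp only: inner_commute)
  qed
  then show ?thesis
    by (simp add: self_adjoint_on_def direct_sum_operators self_adjoint_onD(1)[OF assms(1)] self_adjoint_onD(1)[OF assms(2)])
qed

lemma direct_sum_form:
  "inner ((block X Y) \<cdot> z) z = inner (X \<cdot> (E1' \<cdot> z)) (E1' \<cdot> z)
     + inner (Y \<cdot> (E2' \<cdot> z)) (E2' \<cdot> z)"
  by (simp add: direct_sum_apply inner_add_left doubling_adjoint)

lemma direct_sum_ident: "block (ident F) (ident F) = ident K"
  by (rule operators_eqI[OF doubling_spaces(2)])
    (simp_all add: direct_sum_operators ident[OF doubling_spaces(1)] ident[OF doubling_spaces(2)]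
      direct_sum_apply doubling_in doubling_decompose)

lemma direct_sum_norm: "z \<in> K \<Longrightarrow> inner z z = inner (E1' \<cdot> z) (E1' \<cdot> z)
    + inner (E2' \<cdot> z) (E2' \<cdot> z)"
  using direct_sum_form[of "ident F" "ident F" z]
  by (simp add: direct_sum_ident ident[OF doubling_spaces(1)] ident[OF doubling_spaces(2)] doubling_in)

lemma direct_sum_form_bounds:
  assumes X: "form_bounds F m M X" and Y: "form_bounds F m M Y"
  shows "form_bounds K m M (block X Y)"
  unfolding form_bounds_def
proof (intro conjI ballI)
  show "self_adjoint_on K (block X Y)"
    by (intro direct_sum_self_adjoint form_boundsD(1)[OF X] form_boundsD(1)[OF Y])
  fix z assume z: "z \<in> K"
  note * = form_boundsD(4,5)[OF X doubling_in(3)[of z]] form_boundsD(4,5)[OF Y doubling_in(4)[of z]]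
  show "m * inner z z \<le> inner ((block X Y) \<cdot> z) z" "inner ((block X Y) \<cdot> z) z \<le> M * inner z z"
    unfolding direct_sum_form direct_sum_norm[OF z] distrib_left by (intro add_mono *)+
qed

lemma direct_sum_poly:
  assumes "X \<in> operators F" "Y \<in> operators F"
  shows "poly_op K p (block X Y) = block (poly_op F p X) (poly_op F p Y)"
proof (induction p)
  case (pCons c p)
  note P = poly_op_operators[OF doubling_spaces(1) assms(1), of p] poly_op_operators[OF doubling_spaces(1) assms(2), of p]
  have "block X Y o\<^sub>L block (poly_op F p X) (poly_op F p Y) = block (X o\<^sub>L poly_op F p X) (Y o\<^sub>L poly_op F p Y)"
    by (rule blinfun_eqI)
      (simp add: direct_sum_apply blinfun.bilinear_simps doubling_isometry operators_in[OF P(1)] operators_in[OF P(2)])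
  moreover have "block (c *\<^sub>R ident F + X') (c *\<^sub>R ident F + Y') = c *\<^sub>R block (ident F) (ident F) + block X' Y'" for X' Y'
    by (rule blinfun_eqI) (simp add: direct_sum_apply blinfun.bilinear_simps scaleR_add_right)
  ultimately show ?case by (simp add: poly_op_pCons pCons.IH direct_sum_ident)
qed (simp add: direct_sum_def)

lemma direct_sum_cfc:
  assumes X: "form_bounds F m M X" and Y: "form_bounds F m M Y" and f: "continuous_on {m..M} f"
  shows "cfc K f (block X Y) = block (cfc F f X) (cfc F f Y)"
proof -
  obtain p where p: "\<And>n x. x \<in> {m..M} \<Longrightarrow> \<bar>f x - poly (p n) x\<bar> \<le> inverse (real (Suc n))"
    using polynomial_sequence[OF f] by blast
  have lim: "(\<lambda>n. poly_op G (p n) T) \<longlonglongrightarrow> cfc G f T" if "hilbert_space G" "form_bounds G m M T" for G :: "'u set" and T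
    by (rule cfc_tendsto[OF that f _ p LIMSEQ_inverse_real_of_nat]) simp_all
  have "(\<lambda>n. block (poly_op F (p n) X) (poly_op F (p n) Y)) \<longlonglongrightarrow> block (cfc F f X) (cfc F f Y)"
    unfolding direct_sum_def
    by (intro tendsto_intros bounded_bilinear.tendsto[OF bounded_bilinear_blinfun_compose]
        lim[OF doubling_spaces(1) X] lim[OF doubling_spaces(1) Y])
  moreover have "(\<lambda>n. block (poly_op F (p n) X) (poly_op F (p n) Y)) \<longlonglongrightarrow> cfc K f (block X Y)"
    using lim[OF doubling_spaces(2) direct_sum_form_bounds[OF X Y]]
    by (simp add: direct_sum_poly form_boundsD(2)[OF X] form_boundsD(2)[OF Y])
  ultimately show ?thesis by (rule LIMSEQ_unique[symmetric])
qed

end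

text \<open>Rotating the two copies of \<open>F\<close> inside \<open>K\<close> gives another decomposition of \<open>K\<close>.\<close>

lemma doubling_rotate:
  fixes F K :: "'u::complex_hilbert set"
  assumes D: "doubling F K E1 E2 E1' E2'" and ab: "a * a + b * b = 1"
  shows "doubling F K (a *\<^sub>R E1 + b *\<^sub>R E2) (a *\<^sub>R E2 - b *\<^sub>R E1) (a *\<^sub>R E1' + b *\<^sub>R E2') (a *\<^sub>R E2' - b *\<^sub>R E1')"
proof -
  note F = doubling_spaces(1)[OF D] and K = doubling_spaces(2)[OF D]
  have unit: "(a * a) *\<^sub>R x + (b * b) *\<^sub>R x = x" for x :: 'u
    using ab by (simp flip: scaleR_add_left)
  have rec: "a *\<^sub>R (a *\<^sub>R x1 + b *\<^sub>R x2) + b *\<^sub>R (a *\<^sub>R y1 + b *\<^sub>R y2)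
      + (a *\<^sub>R (a *\<^sub>R y2 - b *\<^sub>R y1) - b *\<^sub>R (a *\<^sub>R x2 - b *\<^sub>R x1)) = x1 + y2"
    for x1 x2 y1 y2 :: 'u
    using unit[of "x1 + y2"] by (simp add: algebra_simps)
  note lin = blinfun.bilinear_simps
  show ?thesis
    unfolding doubling_def
  proof (intro conjI allI ballI F K)
    fix x assume x: "x \<in> F"
    note iso = doubling_isometry[OF D x]
    show "(a *\<^sub>R E1' + b *\<^sub>R E2') \<cdot> ((a *\<^sub>R E1 + b *\<^sub>R E2) \<cdot> x) = x"
      "(a *\<^sub>R E2' - b *\<^sub>R E1') \<cdot> ((a *\<^sub>R E2 - b *\<^sub>R E1) \<cdot> x) = x"
      "(a *\<^sub>R E1' + b *\<^sub>R E2') \<cdot> ((a *\<^sub>R E2 - b *\<^sub>R E1) \<cdot> x) = 0"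
      "(a *\<^sub>R E2' - b *\<^sub>R E1') \<cdot> ((a *\<^sub>R E1 + b *\<^sub>R E2) \<cdot> x) = 0"
      using unit[of x] by (simp_all add: lin iso mult.commute[of b a])
  next
    fix z assume z: "z \<in> K"
    show "(a *\<^sub>R E1 + b *\<^sub>R E2) \<cdot> ((a *\<^sub>R E1' + b *\<^sub>R E2') \<cdot> z)
        + (a *\<^sub>R E2 - b *\<^sub>R E1) \<cdot> ((a *\<^sub>R E2' - b *\<^sub>R E1') \<cdot> z) = z"
      unfolding lin rec by (rule doubling_decompose[OF D z])
  qed (simp_all add: lin doubling_scaleC[OF D] scaleC_add_right scaleC_diff_right scaleC_scaleR
      hilbert_space_D[OF F] hilbert_space_D[OF K] doubling_in[OF D] doubling_adjoint[OF D] inner_add inner_diff)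
qed

text \<open>Order preservation is recorded for one space at a time: preservation on the doubled space \<open>K\<close> yields
  concavity on \<open>F\<close>.\<close>

definition monotone_on_space :: "'u::complex_hilbert set \<Rightarrow> (real \<Rightarrow> real) \<Rightarrow> bool" where
  "monotone_on_space K h \<longleftrightarrow> (\<forall>m M X Y. 0 < m \<longrightarrow> form_bounds K m M X \<longrightarrow> form_bounds K m M Y \<longrightarrow>
     (\<forall>z\<in>K. inner (X \<cdot> z) z \<le> inner (Y \<cdot> z) z) \<longrightarrow>
     (\<forall>z\<in>K. inner ((cfc K h X) \<cdot> z) z \<le> inner ((cfc K h Y) \<cdot> z) z))"

lemma weighted_form_bounds:
  assumes hs: "hilbert_space F" and A: "form_bounds F m M A" and B: "form_bounds F m M B" and \<alpha>: "0 \<le> \<alpha>" "\<alpha> \<le> 1"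
  shows "form_bounds F m M ((1 - \<alpha>) *\<^sub>R A + \<alpha> *\<^sub>R B)"
  unfolding form_bounds_def
proof (intro conjI ballI)
  show "self_adjoint_on F ((1 - \<alpha>) *\<^sub>R A + \<alpha> *\<^sub>R B)"
    by (intro self_adjoint_add[OF hs] self_adjoint_scaleR[OF hs] form_boundsD(1)[OF A] form_boundsD(1)[OF B])
  fix x assume x: "x \<in> F"
  have eq: "(1 - \<alpha>) * r + \<alpha> * r = r" for r by (simp add: algebra_simps)
  have "(1 - \<alpha>) * (m * inner x x) + \<alpha> * (m * inner x x)
      \<le> (1 - \<alpha>) * inner (A \<cdot> x) x + \<alpha> * inner (B \<cdot> x) x"
    using \<alpha> form_boundsD(4)[OF A x] form_boundsD(4)[OF B x] by (intro add_mono mult_left_mono) auto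
  then show "m * inner x x \<le> inner (((1 - \<alpha>) *\<^sub>R A + \<alpha> *\<^sub>R B) \<cdot> x) x"
    unfolding eq by (simp add: blinfun.bilinear_simps inner_add_left)
  have "(1 - \<alpha>) * inner (A \<cdot> x) x + \<alpha> * inner (B \<cdot> x) x
      \<le> (1 - \<alpha>) * (M * inner x x) + \<alpha> * (M * inner x x)"
    using \<alpha> form_boundsD(5)[OF A x] form_boundsD(5)[OF B x] by (intro add_mono mult_left_mono) auto
  then show "inner (((1 - \<alpha>) *\<^sub>R A + \<alpha> *\<^sub>R B) \<cdot> x) x \<le> M * inner x x"
    unfolding eq by (simp add: blinfun.bilinear_simps inner_add_left)
qed

lemma shift_form_bounds:
  assumes hs: "hilbert_space F" and A: "form_bounds F m M A"
  shows "form_bounds F (m + e) (M + e) (A + e *\<^sub>R ident F)"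
  using form_boundsD[OF A]
  by (auto simp: form_bounds_def blinfun.bilinear_simps inner_add_left ident(2)[OF hs] distrib_right
      intro!: self_adjoint_add[OF hs] self_adjoint_scaleR[OF hs] self_adjoint_ident[OF hs])

text \<open>Put \<open>C = (1 - \<alpha>) A + \<alpha> B\<close>.  In the rotated decomposition of \<open>K\<close> the operator \<open>A \<oplus> B\<close> has the
  upper left corner \<open>C\<close>, and it lies below \<open>(C + \<epsilon>) \<oplus> L\<close> for large \<open>L\<close>: the
  off-diagonal entries are absorbed by \<open>\<epsilon>\<close> and \<open>L\<close>.  Monotonicity on \<open>K\<close>, read off in the
  upper left corner, is the claim.\<close>

lemma doubling_concave_shifted:
  fixes F K :: "'u::complex_hilbert set"
  assumes D: "doubling F K E1 E2 E1' E2'" and mono: "monotone_on_space K h"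
    and h: "continuous_on {0<..} h" and m: "0 < m"
    and A: "form_bounds F m M A" and B: "form_bounds F m M B" and \<alpha>: "0 \<le> \<alpha>" "\<alpha> \<le> 1"
    and \<epsilon>: "0 < \<epsilon>" and x: "x \<in> F"
  shows "(1 - \<alpha>) * inner ((cfc F h A) \<cdot> x) x + \<alpha> * inner ((cfc F h B) \<cdot> x) x
    \<le> inner ((cfc F h (((1 - \<alpha>) *\<^sub>R A + \<alpha> *\<^sub>R B) + \<epsilon> *\<^sub>R ident F)) \<cdot> x) x"
proof -
  note F = doubling_spaces(1)[OF D] and K = doubling_spaces(2)[OF D]
  define a b where "a = sqrt (1 - \<alpha>)" and "b = sqrt \<alpha>"
  have ab: "a * a = 1 - \<alpha>" "b * b = \<alpha>" "0 \<le> a" "0 \<le> b" "a \<le> 1" "b \<le> 1" using \<alpha> by (auto simp: a_def b_def)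
  let ?J1 = "a *\<^sub>R E1 + b *\<^sub>R E2" and ?J2 = "a *\<^sub>R E2 - b *\<^sub>R E1"
  let ?J1' = "a *\<^sub>R E1' + b *\<^sub>R E2'" and ?J2' = "a *\<^sub>R E2' - b *\<^sub>R E1'"
  have J: "doubling F K ?J1 ?J2 ?J1' ?J2'" by (rule doubling_rotate[OF D]) (simp add: ab)
  define C where "C = (1 - \<alpha>) *\<^sub>R A + \<alpha> *\<^sub>R B"
  have C: "form_bounds F m M C" unfolding C_def by (rule weighted_form_bounds[OF F A B \<alpha>])
  define N where "N = norm (B - A)"
  \<comment> \<open>\<open>2 N \<parallel>u\<parallel> \<parallel>v\<parallel> \<le> \<epsilon> \<parallel>u\<parallel>\<^sup>2 + N\<^sup>2 / \<epsilon> \<parallel>v\<parallel>\<^sup>2\<close> absorbs the off-diagonal part; the summand \<open>m\<close> only keeps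
    \<open>L\<close> above the lower bound of the other operators.\<close>
  define L where "L = m + \<bar>M\<bar> + N\<^sup>2 / \<epsilon>"
  have L: "m \<le> L" "\<bar>M\<bar> + N\<^sup>2 / \<epsilon> \<le> L" using \<epsilon> m by (auto simp: L_def)
  let ?U = "\<bar>M\<bar> + \<epsilon> + L"
  have Ce: "form_bounds F m ?U (C + \<epsilon> *\<^sub>R ident F)"
    by (rule form_bounds_mono[OF shift_form_bounds[OF F C]]) (use \<epsilon> L m in auto)
  have LI: "form_bounds F m ?U (L *\<^sub>R ident F)"
    using L \<epsilon> m by (auto simp: form_bounds_def blinfun.bilinear_simps ident(2)[OF F]
        intro!: self_adjoint_scaleR[OF F] self_adjoint_ident[OF F] mult_right_mono)
  have A2: "form_bounds F m ?U A" and B2: "form_bounds F m ?U B"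
    by (rule form_bounds_mono[OF A] form_bounds_mono[OF B]; use \<epsilon> L m in auto)+
  let ?X = "direct_sum E1 E2 E1' E2' A B"
  let ?Y = "direct_sum ?J1 ?J2 ?J1' ?J2' (C + \<epsilon> *\<^sub>R ident F) (L *\<^sub>R ident F)"
  have hc: "continuous_on {m..?U} h" by (rule continuous_on_subset[OF h]) (use m in auto)
  have le: "inner (?X \<cdot> z) z \<le> inner (?Y \<cdot> z) z" if z: "z \<in> K" for z
  proof -
    define u v where "u = ?J1' \<cdot> z" and "v = ?J2' \<cdot> z"
    have uv: "u \<in> F" "v \<in> F" unfolding u_def v_def by (rule doubling_in[OF J])+
    have rec: "a *\<^sub>R (a *\<^sub>R x1 + b *\<^sub>R x2) - b *\<^sub>R (a *\<^sub>R x2 - b *\<^sub>R x1) = x1"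
      "b *\<^sub>R (a *\<^sub>R x1 + b *\<^sub>R x2) + a *\<^sub>R (a *\<^sub>R x2 - b *\<^sub>R x1) = x2" for x1 x2 :: 'u
      by (simp_all add: algebra_simps ab flip: scaleR_add_left)
    have z1: "E1' \<cdot> z = a *\<^sub>R u - b *\<^sub>R v" and z2: "E2' \<cdot> z = b *\<^sub>R u + a *\<^sub>R v"
      by (simp_all only: u_def v_def blinfun.bilinear_simps rec)
    have "inner (?X \<cdot> z) z = (a * a) * inner (A \<cdot> u) u + (b * b) * inner (B \<cdot> u) u
        + 2 * (a * b) * inner ((B - A) \<cdot> u) v
        + ((b * b) * inner (A \<cdot> v) v + (a * a) * inner (B \<cdot> v) v)"
      unfolding direct_sum_form[OF D] z1 z2
      using form_boundsD(3)[OF A, of v u] form_boundsD(3)[OF B, of v u]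
      by (simp add: blinfun.bilinear_simps inner_diff inner_add inner_commute algebra_simps)
    also have "(a * a) * inner (A \<cdot> u) u + (b * b) * inner (B \<cdot> u) u = inner (C \<cdot> u) u"
      by (simp add: C_def ab blinfun.bilinear_simps inner_add_left)
    also have "2 * (a * b) * inner ((B - A) \<cdot> u) v \<le> \<epsilon> * inner u u + N\<^sup>2 / \<epsilon> * inner v v"
    proof -
      have "\<bar>inner ((B - A) \<cdot> u) v\<bar> \<le> norm ((B - A) \<cdot> u) * norm v" by (rule Cauchy_Schwarz_ineq2)
      also have "\<dots> \<le> (N * norm u) * norm v" unfolding N_def by (intro mult_right_mono norm_blinfun) simp
      finally have "\<bar>inner ((B - A) \<cdot> u) v\<bar> \<le> N * norm u * norm v" .
      then have "(a * b) * inner ((B - A) \<cdot> u) v \<le> 1 * (N * norm u * norm v)"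
        using mult_left_mono[OF abs_ge_self[of "inner ((B - A) \<cdot> u) v"], of "a * b"]
          mult_right_mono[OF mult_le_one[OF ab(5,4,6)], of "\<bar>inner ((B - A) \<cdot> u) v\<bar>"] ab(3,4)
        by simp
      moreover have "0 \<le> (\<epsilon> * norm u - N * norm v)\<^sup>2 / \<epsilon>" using \<epsilon> by simp
      then have "2 * (N * norm u * norm v) \<le> \<epsilon> * (norm u)\<^sup>2 + N\<^sup>2 / \<epsilon> * (norm v)\<^sup>2"
        using \<epsilon> by (simp add: power2_diff field_simps power2_eq_square)
      ultimately show ?thesis by (simp add: power2_norm_eq_inner)
    qed
    also have "(b * b) * inner (A \<cdot> v) v + (a * a) * inner (B \<cdot> v) v
        \<le> (b * b) * (\<bar>M\<bar> * inner v v) + (a * a) * (\<bar>M\<bar> * inner v v)"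
    proof -
      have "M * inner v v \<le> \<bar>M\<bar> * inner v v" by (intro mult_right_mono) auto
      then show ?thesis
        using form_boundsD(5)[OF A uv(2)] form_boundsD(5)[OF B uv(2)] by (intro add_mono mult_left_mono) auto
    qed
    also have "(b * b) * (\<bar>M\<bar> * inner v v) + (a * a) * (\<bar>M\<bar> * inner v v) = \<bar>M\<bar> * inner v v"
      by (simp add: ab algebra_simps)
    also have "inner (C \<cdot> u) u + (\<epsilon> * inner u u + N\<^sup>2 / \<epsilon> * inner v v) + \<bar>M\<bar> * inner v v
        \<le> inner (C \<cdot> u) u + \<epsilon> * inner u u + L * inner v v"
      using mult_right_mono[OF L(2), of "inner v v"] by (simp add: algebra_simps)
    also have "\<dots> = inner (?Y \<cdot> z) z"
      unfolding direct_sum_form[OF J] u_def[symmetric] v_def[symmetric]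
      by (simp add: blinfun.bilinear_simps inner_add_left ident(2)[OF F] uv)
    finally show ?thesis by simp
  qed
  let ?z = "?J1 \<cdot> x"
  have z: "?z \<in> K" by (rule doubling_in[OF J])
  have zE: "E1' \<cdot> ?z = a *\<^sub>R x" "E2' \<cdot> ?z = b *\<^sub>R x"
    by (simp_all add: blinfun.bilinear_simps doubling_isometry[OF D] x)
  have "inner ((cfc K h ?X) \<cdot> ?z) ?z \<le> inner ((cfc K h ?Y) \<cdot> ?z) ?z"
    using mono[unfolded monotone_on_space_def, rule_format, OF m
        direct_sum_form_bounds[OF D A2 B2] direct_sum_form_bounds[OF J Ce LI] le z] .
  also have "inner ((cfc K h ?X) \<cdot> ?z) ?z
      = (1 - \<alpha>) * inner ((cfc F h A) \<cdot> x) x + \<alpha> * inner ((cfc F h B) \<cdot> x) x"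
    unfolding direct_sum_cfc[OF D A2 B2 hc] direct_sum_form[OF D] zE
    by (simp add: blinfun.bilinear_simps mult.assoc[symmetric] ab)
  also have "inner ((cfc K h ?Y) \<cdot> ?z) ?z = inner ((cfc F h (C + \<epsilon> *\<^sub>R ident F)) \<cdot> x) x"
    unfolding direct_sum_cfc[OF J Ce LI hc] direct_sum_form[OF J] doubling_isometry(1)[OF J x] doubling_isometry(4)[OF J x]
    by simp
  finally show ?thesis by (simp add: C_def)
qed

lemma inner_blinfun_le: "\<bar>inner (T \<cdot> x) x\<bar> \<le> norm T * inner x x"
proof -
  have "\<bar>inner (T \<cdot> x) x\<bar> \<le> norm (T \<cdot> x) * norm x" by (rule Cauchy_Schwarz_ineq2)
  also have "\<dots> \<le> (norm T * norm x) * norm x" by (intro mult_right_mono norm_blinfun) simp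
  finally show ?thesis by (simp add: norm_eq_sqrt_inner mult.assoc)
qed

text \<open>Let \<open>\<epsilon>\<close> tend to 0, using uniform continuity of \<open>h\<close> on a compact interval.\<close>

lemma doubling_concave:
  fixes F K :: "'u::complex_hilbert set"
  assumes D: "doubling F K E1 E2 E1' E2'" and mono: "monotone_on_space K h"
    and h: "continuous_on {0<..} h" and m: "0 < m"
    and A: "form_bounds F m M A" and B: "form_bounds F m M B" and \<alpha>: "0 \<le> \<alpha>" "\<alpha> \<le> 1" and x: "x \<in> F"
  shows "(1 - \<alpha>) * inner ((cfc F h A) \<cdot> x) x + \<alpha> * inner ((cfc F h B) \<cdot> x) x
    \<le> inner ((cfc F h ((1 - \<alpha>) *\<^sub>R A + \<alpha> *\<^sub>R B)) \<cdot> x) x" (is "?l \<le> inner ((cfc F h ?C) \<cdot> x) x")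
proof (rule field_le_epsilon)
  note F = doubling_spaces(1)[OF D]
  have C: "form_bounds F m M ?C" by (rule weighted_form_bounds[OF F A B \<alpha>])
  fix e :: real assume "0 < e"
  define d where "d = e / (inner x x + 1)"
  have "0 < inner x x + 1" by (simp add: add_nonneg_pos)
  then have d: "0 < d" "d * inner x x \<le> e" using \<open>0 < e\<close> by (simp_all add: d_def field_simps)
  have "continuous_on {m..M + 1} h" by (rule continuous_on_subset[OF h]) (use m in auto)
  then have "uniformly_continuous_on {m..M + 1} h" by (intro compact_uniformly_continuous compact_Icc)
  then obtain r where r: "0 < r" "\<And>y z. y \<in> {m..M + 1} \<Longrightarrow> z \<in> {m..M + 1} \<Longrightarrow> dist z y < r \<Longrightarrow> dist (h z) (h y) < d"
    using d(1) unfolding uniformly_continuous_on_def by metis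
  define \<epsilon> where "\<epsilon> = min 1 (r / 2)"
  have \<epsilon>: "0 < \<epsilon>" "\<epsilon> \<le> 1" "\<epsilon> < r" using r(1) by (auto simp: \<epsilon>_def)
  have Ce: "form_bounds F m (M + 1) (1 *\<^sub>R ?C + \<epsilon> *\<^sub>R ident F)"
    using form_bounds_mono[OF shift_form_bounds[OF F C, of \<epsilon>], of m "M + 1"] \<epsilon> by simp
  have "cfc F h (1 *\<^sub>R ?C + \<epsilon> *\<^sub>R ident F) = cfc F (\<lambda>y. h (1 * y + \<epsilon>)) ?C"
    by (rule cfc_affine[OF F C Ce]) (use \<epsilon> in \<open>auto intro: continuous_on_subset[OF h] simp: m\<close>,
      rule continuous_on_subset[OF h], use m in auto)
  then have shift: "cfc F h (?C + \<epsilon> *\<^sub>R ident F) = cfc F (\<lambda>y. h (y + \<epsilon>)) ?C" by simp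
  have "norm (cfc F (\<lambda>y. h (y + \<epsilon>)) ?C - cfc F h ?C) \<le> d"
  proof (rule cfc_dist_le[OF F C])
    show "continuous_on {m..M} (\<lambda>y. h (y + \<epsilon>))"
      by (rule continuous_on_compose2[OF h]) (use m \<epsilon> in \<open>auto intro!: continuous_intros\<close>)
    show "continuous_on {m..M} h" by (rule continuous_on_subset[OF h]) (use m in auto)
    show "\<bar>h (y + \<epsilon>) - h y\<bar> \<le> d" if "y \<in> {m..M}" for y
      using r(2)[of y "y + \<epsilon>"] that \<epsilon> by (auto simp: dist_real_def)
  qed (use d in simp)
  then have "norm (cfc F h (?C + \<epsilon> *\<^sub>R ident F) - cfc F h ?C) * inner x x \<le> d * inner x x"
    unfolding shift by (intro mult_right_mono) auto
  then have "inner ((cfc F h (?C + \<epsilon> *\<^sub>R ident F)) \<cdot> x) x - inner ((cfc F h ?C) \<cdot> x) x \<le> e"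
    using inner_blinfun_le[of "cfc F h (?C + \<epsilon> *\<^sub>R ident F) - cfc F h ?C" x] d(2)
    by (simp add: blinfun.bilinear_simps inner_diff_left)
  then show "?l \<le> inner ((cfc F h ?C) \<cdot> x) x + e"
    using doubling_concave_shifted[OF D mono h m A B \<alpha> \<epsilon>(1) x] by linarith
qed

section \<open>Finite-dimensional subspaces and their doubling\<close>

definition orthonormal :: "nat \<Rightarrow> (nat \<Rightarrow> 'u::complex_hilbert) \<Rightarrow> bool" where
  "orthonormal n b \<longleftrightarrow> (\<forall>i<n. \<forall>j<n. cinner (b i) (b j) = (if i = j then 1 else 0))"

text \<open>For orthonormal families this is the partial isometry that maps \<open>b i\<close> to \<open>c i\<close>; for \<open>b = c\<close> it is
  the projection onto the span, whose fixed points make up \<open>fin_span\<close> below.\<close>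

definition transfer :: "nat \<Rightarrow> (nat \<Rightarrow> 'u::complex_hilbert) \<Rightarrow> (nat \<Rightarrow> 'u) \<Rightarrow> 'u \<Rightarrow>\<^sub>L 'u" where
  "transfer n b c = Blinfun (\<lambda>x. \<Sum>i<n. cinner x (b i) *\<^sub>C c i)"

definition fin_span :: "nat \<Rightarrow> (nat \<Rightarrow> 'u::complex_hilbert) \<Rightarrow> 'u set" where
  "fin_span n b = {x. (transfer n b b) \<cdot> x = x}"

lemma cmod_cinner_le: "cmod (cinner x y) \<le> 2 * (norm x * norm (y::'u::complex_hilbert))"
proof -
  have "cmod (cinner x y) \<le> \<bar>inner x y\<bar> + \<bar>inner x (\<i> *\<^sub>C y)\<bar>"
    using cmod_le[of "cinner x y"] by (simp add: cinner_eq)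
  also have "\<dots> \<le> norm x * norm y + norm x * norm (\<i> *\<^sub>C y)"
    by (intro add_mono Cauchy_Schwarz_ineq2)
  finally show ?thesis by (simp add: norm_scaleC)
qed

lemma transfer_apply: "(transfer n b c) \<cdot> x = (\<Sum>i<n. cinner x (b i) *\<^sub>C c i)"
proof -
  have "bounded_linear (\<lambda>x. cinner x (b i) *\<^sub>C c i)" for i
  proof (rule bounded_linear_intro)
    fix x show "norm (cinner x (b i) *\<^sub>C c i) \<le> norm x * (2 * norm (b i) * norm (c i))"
      using mult_right_mono[OF cmod_cinner_le[of x "b i"], of "norm (c i)"] by (simp add: norm_scaleC algebra_simps)
  qed (simp_all add: cinner_add_left scaleC_add_left scaleR_scaleC cinner_scaleC_left scaleC_scaleC)
  then have "bounded_linear (\<lambda>x. \<Sum>i<n. cinner x (b i) *\<^sub>C c i)" by (intro bounded_linear_sum)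
  then show ?thesis unfolding transfer_def by (simp add: bounded_linear_Blinfun_apply)
qed

lemma transfer_scaleC: "(transfer n b c) \<cdot> (a *\<^sub>C x) = a *\<^sub>C (transfer n b c) \<cdot> x"
  by (simp add: transfer_apply cinner_scaleC_left scaleC_sum_right scaleC_scaleC)

lemma transfer_adjoint:
  "inner ((transfer n b c) \<cdot> x) y = inner x ((transfer n c b) \<cdot> (y::'u::complex_hilbert))"
proof -
  have "inner ((transfer n b c) \<cdot> x) y = (\<Sum>i<n. Re (cinner x (b i) * cinner (c i) y))"
    unfolding transfer_apply inner_sum_left by (simp only: inner_eq_Re_cinner cinner_scaleC_left)
  also have "\<dots> = (\<Sum>i<n. Re (cnj (cinner y (c i)) * cinner x (b i)))"
    by (subst (1) cinner_commute[of "c _" y]) (simp add: mult.commute)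
  also have "\<dots> = inner x ((transfer n c b) \<cdot> y)"
    unfolding transfer_apply inner_sum_right by (simp only: inner_eq_Re_cinner cinner_scaleC_right)
  finally show ?thesis .
qed

lemma inner_transfer_self:
  "inner ((transfer n b b) \<cdot> x) x = (\<Sum>i<n. (cmod (cinner x (b i)))\<^sup>2)"
proof -
  have "inner (cinner x (b i) *\<^sub>C b i) x = (cmod (cinner x (b i)))\<^sup>2" for i
  proof -
    have "cinner (cinner x (b i) *\<^sub>C b i) x = cinner x (b i) * cnj (cinner x (b i))"
      by (simp add: cinner_scaleC_left flip: cinner_commute)
    then show ?thesis unfolding inner_eq_Re_cinner complex_norm_square[symmetric] by simp
  qed
  then show ?thesis unfolding transfer_apply inner_sum_left by simp
qed

lemma cinner_transfer:
  assumes "orthonormal n c" "j < n"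
  shows "cinner ((transfer n b c) \<cdot> x) (c j) = cinner x (b j)"
proof -
  have "cinner ((transfer n b c) \<cdot> x) (c j) = (\<Sum>i<n. if i = j then cinner x (b i) else 0)"
    unfolding transfer_apply cinner_sum_left
    by (intro sum.cong) (use assms in \<open>auto simp: cinner_scaleC_left orthonormal_def\<close>)
  then show ?thesis using assms(2) by simp
qed

lemma transfer_compose:
  assumes "orthonormal n c"
  shows "(transfer n c d) \<cdot> ((transfer n b c) \<cdot> x) = (transfer n b d) \<cdot> x"
  unfolding transfer_apply[of n c d] transfer_apply[of n b d] by (intro sum.cong) (simp_all add: cinner_transfer[OF assms])

lemma transfer_in_fin_span: "orthonormal n c \<Longrightarrow> (transfer n b c) \<cdot> x \<in> fin_span n c"
  by (simp add: fin_span_def transfer_compose)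

lemma fin_span_basis: "orthonormal n b \<Longrightarrow> i < n \<Longrightarrow> b i \<in> fin_span n b"
proof -
  assume o: "orthonormal n b" and i: "i < n"
  have "(\<Sum>j<n. cinner (b i) (b j) *\<^sub>C b j) = (\<Sum>j<n. if j = i then b j else 0)"
    by (intro sum.cong) (use o i in \<open>auto simp: orthonormal_def\<close>)
  then show ?thesis using i by (simp add: fin_span_def transfer_apply)
qed

lemma fin_span_hilbert_space:
  fixes b :: "nat \<Rightarrow> 'u::complex_hilbert"
  shows "hilbert_space (fin_span n b)"
  unfolding hilbert_space_def
proof (intro conjI ballI allI)
  show "closed (fin_span n b)"
    unfolding fin_span_def by (rule closed_Collect_eq) (intro continuous_intros)+
qed (auto simp: fin_span_def blinfun.bilinear_simps transfer_scaleC)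

lemma fin_span_subset:
  assumes H: "hilbert_space H" and b: "\<And>i. i < n \<Longrightarrow> b i \<in> H"
  shows "fin_span n b \<subseteq> H"
proof
  fix x assume "x \<in> fin_span n b"
  then have "x = (\<Sum>i<n. cinner x (b i) *\<^sub>C b i)" by (simp add: fin_span_def transfer_apply)
  moreover have "(\<Sum>i<n. cinner x (b i) *\<^sub>C b i) \<in> H"
    by (intro hilbert_space_sum[OF H] hilbert_space_D(3)[OF H] b) simp
  ultimately show "x \<in> H" by simp
qed

lemma fin_span_Suc:
  assumes o: "orthonormal (Suc n) b"
  shows "fin_span n b \<subseteq> fin_span (Suc n) b"
  by (rule fin_span_subset[OF fin_span_hilbert_space]) (use o in \<open>auto intro: fin_span_basis\<close>)

lemma cinner_self: "cinner x x = complex_of_real ((norm (x::'u::complex_hilbert))\<^sup>2)"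
  using inner_iC_left[of x x] by (simp add: cinner_eq complex_eq_iff power2_norm_eq_inner inner_commute)

text \<open>The new vector is the normalised component of \<open>x\<close> orthogonal to the family; it stays in any
  subspace that contains \<open>x\<close> and the family.\<close>

lemma orthonormal_extend:
  fixes b :: "nat \<Rightarrow> 'u::complex_hilbert"
  assumes o: "orthonormal n b" and H: "hilbert_space H" "\<And>i. i < n \<Longrightarrow> b i \<in> H" and x: "x \<in> H" "x \<notin> fin_span n b"
  obtains u where "u \<in> H" "orthonormal (Suc n) (b(n := u))" "x \<in> fin_span (Suc n) (b(n := u))"
proof -
  define y where "y = x - (transfer n b b) \<cdot> x"
  have y0: "y \<noteq> 0" using x(2) by (auto simp: y_def fin_span_def)
  have Px: "(transfer n b b) \<cdot> x \<in> H"
    using subsetD[OF fin_span_subset[OF H(1)] transfer_in_fin_span[OF o]] H(2) by blast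
  have yb: "cinner y (b j) = 0" if "j < n" for j
    unfolding y_def cinner_diff_left cinner_transfer[OF o that] by simp
  define u where "u = complex_of_real (inverse (norm y)) *\<^sub>C y"
  have uH: "u \<in> H" unfolding u_def y_def by (intro hilbert_space_D[OF H(1)] x Px)
  have uu: "cinner u u = 1"
    unfolding cinner_self using y0 by (simp add: u_def norm_scaleC norm_inverse)
  have ub: "cinner u (b j) = 0" if "j < n" for j by (simp add: u_def cinner_scaleC_left yb[OF that])
  have bu: "cinner (b j) u = 0" if "j < n" for j using ub[OF that] cinner_commute[of "b j" u] by simp
  have o': "orthonormal (Suc n) (b(n := u))"
    using o uu ub bu by (auto simp: orthonormal_def less_Suc_eq)
  have "fin_span n b = fin_span n (b(n := u))"
    by (simp add: fin_span_def transfer_apply)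
  then have sub: "fin_span n b \<subseteq> fin_span (Suc n) (b(n := u))" using fin_span_Suc[OF o'] by simp
  note hK = hilbert_space_D[OF fin_span_hilbert_space[of "Suc n" "b(n := u)"]]
  have "u \<in> fin_span (Suc n) (b(n := u))" using fin_span_basis[OF o', of n] by simp
  moreover have "x = (transfer n b b) \<cdot> x + complex_of_real (norm y) *\<^sub>C u"
    using y0 by (simp add: u_def scaleC_scaleC y_def flip: of_real_mult)
  ultimately have "x \<in> fin_span (Suc n) (b(n := u))"
    using hK(2)[OF subsetD[OF sub transfer_in_fin_span[OF o]] hK(3)] by metis
  with uH o' that show thesis by blast
qed

lemma orthonormal_spanning:
  fixes H :: "'u::complex_hilbert set"
  assumes H: "hilbert_space H" and "finite S" "S \<subseteq> H"
  shows "\<exists>n b. orthonormal n b \<and> (\<forall>i<n. b i \<in> H) \<and> S \<subseteq> fin_span n b"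
  using assms(2,3)
proof (induction S rule: finite_induct)
  case empty
  then show ?case by (intro exI[of _ 0]) (simp add: orthonormal_def)
next
  case (insert x S)
  then obtain n b where b: "orthonormal n b" "\<And>i. i < n \<Longrightarrow> b i \<in> H" "S \<subseteq> fin_span n b" by auto
  show ?case
  proof (cases "x \<in> fin_span n b")
    case True
    then show ?thesis using b by (intro exI[of _ n] exI[of _ b]) auto
  next
    case False
    obtain u where u: "u \<in> H" "orthonormal (Suc n) (b(n := u))" "x \<in> fin_span (Suc n) (b(n := u))"
      using orthonormal_extend[OF b(1) H b(2) _ False] insert.prems by blast
    have "fin_span n b = fin_span n (b(n := u))" by (simp add: fin_span_def transfer_apply)
    then have "S \<subseteq> fin_span (Suc n) (b(n := u))" using b(3) fin_span_Suc[OF u(2)] by blast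
    moreover have "\<forall>i<Suc n. (b(n := u)) i \<in> H" using u(1) b(2) by (simp add: less_Suc_eq)
    ultimately show ?thesis using u(2,3) by blast
  qed
qed

lemma bessel_inequality:
  fixes e :: "nat \<Rightarrow> 'u::complex_hilbert"
  assumes "orthonormal N e"
  shows "(\<Sum>m<N. (cmod (cinner x (e m)))\<^sup>2) \<le> (norm x)\<^sup>2"
proof -
  let ?P = "blinfun_apply (transfer N e e)"
  have "inner (?P x) (?P x) = inner x (?P x)"
    using transfer_adjoint[of N e e x "?P x"] transfer_compose[OF assms] by simp
  moreover have "inner (?P x) x = (\<Sum>m<N. (cmod (cinner x (e m)))\<^sup>2)" by (rule inner_transfer_self)
  moreover have "0 \<le> inner (x - ?P x) (x - ?P x)" by simp
  ultimately show ?thesis by (simp add: inner_diff inner_commute power2_norm_eq_inner)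
qed

lemma norm_fin_span:
  assumes "orthonormal n b" "x \<in> fin_span n b"
  shows "(norm x)\<^sup>2 = (\<Sum>i<n. (cmod (cinner x (b i)))\<^sup>2)"
proof -
  have "(norm x)\<^sup>2 = inner ((transfer n b b) \<cdot> x) x"
    using assms(2) by (simp add: fin_span_def power2_norm_eq_inner)
  then show ?thesis by (simp only: inner_transfer_self)
qed

text \<open>In an infinite-dimensional space the span of \<open>n\<close> vectors is not everything: it would contain
  \<open>n + 1\<close> orthonormal vectors, against Bessel's inequality summed over both families.\<close>

lemma fin_span_proper:
  fixes b :: "nat \<Rightarrow> 'u::hilbert_universe"
  assumes o: "orthonormal n b"
  shows "\<exists>x. x \<notin> fin_span n b"
proof (rule ccontr)
  assume "\<not> ?thesis"
  then have all: "x \<in> fin_span n b" for x by blast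
  obtain e :: "nat \<Rightarrow> 'u" where "\<forall>m n. cinner (e m) (e n) = (if m = n then 1 else 0)"
    using infinite_dimensional by blast
  then have e: "orthonormal N e" for N by (simp add: orthonormal_def)
  have unit: "(norm (f i))\<^sup>2 = 1" if "orthonormal N f" "i < N" for f :: "nat \<Rightarrow> 'u" and N i
  proof -
    have "cinner (f i) (f i) = 1" using that by (simp add: orthonormal_def)
    then show ?thesis unfolding cinner_self by (metis of_real_eq_1_iff)
  qed
  have "real (Suc n) = (\<Sum>m<Suc n. (norm (e m))\<^sup>2)" using unit[OF e] by simp
  also have "\<dots> = (\<Sum>m<Suc n. \<Sum>i<n. (cmod (cinner (e m) (b i)))\<^sup>2)"
    by (simp only: norm_fin_span[OF o all])
  also have "\<dots> = (\<Sum>i<n. \<Sum>m<Suc n. (cmod (cinner (e m) (b i)))\<^sup>2)" by (rule sum.swap)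
  also have "\<dots> = (\<Sum>i<n. \<Sum>m<Suc n. (cmod (cinner (b i) (e m)))\<^sup>2)"
    by (intro sum.cong refl arg_cong[where f = "\<lambda>r. r\<^sup>2"]) (metis cinner_commute complex_mod_cnj)
  also have "\<dots> \<le> (\<Sum>i<n. (norm (b i))\<^sup>2)" by (intro sum_mono bessel_inequality e)
  also have "\<dots> = real n" using unit[OF o] by simp
  finally show False by simp
qed

lemma orthonormal_prolong:
  fixes b :: "nat \<Rightarrow> 'u::hilbert_universe"
  assumes "orthonormal n b"
  shows "\<exists>d. orthonormal (n + k) d \<and> (\<forall>i<n. d i = b i)"
proof (induction k)
  case 0
  then show ?case using assms by auto
next
  case (Suc k)
  then obtain d where d: "orthonormal (n + k) d" "\<forall>i<n. d i = b i" by blast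
  obtain x where x: "x \<notin> fin_span (n + k) d" using fin_span_proper[OF d(1)] by blast
  have "hilbert_space (UNIV :: 'u set)" by (simp add: hilbert_space_def)
  from orthonormal_extend[OF d(1) this _ _ x] obtain u where "orthonormal (Suc (n + k)) (d(n + k := u))" by blast
  moreover have "\<forall>i<n. (d(n + k := u)) i = b i" using d(2) by simp
  ultimately show ?case unfolding add_Suc_right by blast
qed

text \<open>Prolong a basis of the space to an orthonormal family of twice the length.  The second half \<open>c\<close> spans
  the second copy.\<close>

lemma doubling_exists:
  fixes b :: "nat \<Rightarrow> 'u::hilbert_universe"
  assumes b: "orthonormal n b"
  shows "\<exists>K E1 E2 E1' E2'. doubling (fin_span n b) K E1 E2 E1' E2'"
proof -
  obtain d where d: "orthonormal (n + n) d" "\<And>i. i < n \<Longrightarrow> d i = b i" using orthonormal_prolong[OF b] by blast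
  define c where "c i = d (n + i)" for i
  have c: "orthonormal n c" using d(1) by (simp add: orthonormal_def c_def)
  have bc: "cinner (b i) (c j) = 0" "cinner (c j) (b i) = 0" if "i < n" "j < n" for i j
    using d that by (auto simp: orthonormal_def c_def simp flip: d(2))
  have split: "(transfer (n + n) d d) \<cdot> x = (transfer n b b) \<cdot> x + (transfer n c c) \<cdot> x" for x
  proof -
    have "{..<n + n} = {..<n} \<union> {n..<n + n}" by auto
    then have "(\<Sum>i<n + n. cinner x (d i) *\<^sub>C d i) = (\<Sum>i<n. cinner x (d i) *\<^sub>C d i) + (\<Sum>i=n..<n+n. cinner x (d i) *\<^sub>C d i)"
      by (simp add: sum.union_disjoint ivl_disj_int)
    also have "(\<Sum>i=n..<n+n. cinner x (d i) *\<^sub>C d i) = (\<Sum>i<n. cinner x (c i) *\<^sub>C c i)"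
      by (rule sum.reindex_bij_witness[of _ "\<lambda>i. n + i" "\<lambda>i. i - n"]) (auto simp: c_def)
    finally show ?thesis by (simp add: transfer_apply d(2))
  qed
  let ?K = "fin_span (n + n) d"
  have cross: "(transfer n b f) \<cdot> ((transfer n h c) \<cdot> x) = 0"
    "(transfer n c f) \<cdot> ((transfer n h b) \<cdot> x) = 0" for f h x
    using bc by (simp_all add: transfer_apply cinner_sum_left cinner_scaleC_left)
  have sub: "fin_span n b \<subseteq> ?K" "fin_span n c \<subseteq> ?K"
    by (rule fin_span_subset[OF fin_span_hilbert_space];
        use fin_span_basis[OF d(1)] d(2) in \<open>force simp: c_def simp flip: d(2)\<close>)+
  have "doubling (fin_span n b) ?K (transfer n b b) (transfer n b c) (transfer n b b) (transfer n c b)"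
    unfolding doubling_def
  proof (intro conjI allI ballI fin_span_hilbert_space transfer_scaleC transfer_adjoint)
    show "(transfer n b b) \<cdot> x \<in> ?K" "(transfer n b c) \<cdot> x \<in> ?K" for x
      using sub transfer_in_fin_span b c by blast+
    fix x assume x: "x \<in> ?K"
    show "(transfer n b b) \<cdot> ((transfer n b b) \<cdot> x)
        + (transfer n b c) \<cdot> ((transfer n c b) \<cdot> x) = x"
      using x by (simp add: transfer_compose[OF b] fin_span_def split)
  next
    fix x assume x: "x \<in> fin_span n b"
    show "(transfer n c b) \<cdot> ((transfer n b c) \<cdot> x) = x"
      "(transfer n b b) \<cdot> ((transfer n b b) \<cdot> x) = x"
      using x by (simp_all add: transfer_compose[OF b] transfer_compose[OF c] fin_span_def)
  qed (simp_all add: cross transfer_in_fin_span[OF b])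
  then show ?thesis by blast
qed

section \<open>Operator concavity on an arbitrary space\<close>

text \<open>Compressing \<open>A\<close> to a finite-dimensional space that contains \<open>\<xi>, A \<xi>, \<dots>, A\<^sup>d \<xi>\<close> changes
  neither the form bounds nor the vectors \<open>p(A) \<xi>\<close> for polynomials of degree at most \<open>d\<close>.\<close>

definition compression :: "'u::complex_hilbert set \<Rightarrow> ('u \<Rightarrow>\<^sub>L 'u) \<Rightarrow> ('u \<Rightarrow>\<^sub>L 'u)" where
  "compression F A = ident F o\<^sub>L A o\<^sub>L ident F"

lemma compression_form_bounds:
  assumes F: "hilbert_space F" and FH: "F \<subseteq> H" and A: "form_bounds H m M A"
  shows "form_bounds F m M (compression F A)"
  unfolding form_bounds_def self_adjoint_on_def
proof (intro conjI ballI allI)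
  note id = ident[OF F]
  show "compression F A \<in> operators F"
    by (rule operatorsI[OF _ _ _ F])
      (auto simp: compression_def operators_scaleC[OF id(1)] operators_scaleC[OF form_boundsD(2)[OF A]]
        operators_in[OF id(1)] operators_orthogonal[OF F id(1)])
  show "inner ((compression F A) \<cdot> x) y = inner x ((compression F A) \<cdot> y)" for x y
    by (simp add: compression_def inner_ident[OF F] form_boundsD(3)[OF A])
  fix x assume x: "x \<in> F"
  then have "inner ((compression F A) \<cdot> x) x = inner (A \<cdot> x) x"
    by (simp add: compression_def inner_ident[OF F] id)
  then show "m * inner x x \<le> inner ((compression F A) \<cdot> x) x"
    "inner ((compression F A) \<cdot> x) x \<le> M * inner x x"
    using form_boundsD(4,5)[OF A subsetD[OF FH x]] by simp_all
qed

lemma compression_poly: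
  assumes F: "hilbert_space F" and H: "hilbert_space H" and FH: "F \<subseteq> H"
    and \<xi>: "\<And>k. k \<le> degree p \<Longrightarrow> (blinfun_apply A ^^ k) \<xi> \<in> F"
  shows "(poly_op F p (compression F A)) \<cdot> \<xi> = (poly_op H p A) \<cdot> \<xi>"
proof -
  have \<xi>F: "\<xi> \<in> F" using \<xi>[of 0] by simp
  have pow: "(((\<lambda>T. B o\<^sub>L T) ^^ k) (ident G)) \<cdot> \<xi> = (blinfun_apply B ^^ k) \<xi>"
    if "hilbert_space G" "\<xi> \<in> G" for G and B :: "'a \<Rightarrow>\<^sub>L 'a" and k
    by (induction k) (simp_all add: ident[OF that(1)] that)
  have comp: "(blinfun_apply (compression F A) ^^ k) \<xi> = (blinfun_apply A ^^ k) \<xi>" if "k \<le> degree p" for k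
    using that
  proof (induction k)
    case (Suc k)
    then show ?case using \<xi>[of k] \<xi>[of "Suc k"] by (simp add: compression_def ident[OF F])
  qed simp
  show ?thesis
    unfolding poly_op_def blinfun.sum_left blinfun.scaleR_left pow[OF F \<xi>F] pow[OF H subsetD[OF FH \<xi>F]]
    by (intro sum.cong) (simp_all add: comp)
qed

lemma compression_cfc:
  assumes F: "hilbert_space F" and H: "hilbert_space H" and FH: "F \<subseteq> H" and A: "form_bounds H m M A"
    and h: "continuous_on {m..M} h" and "0 \<le> e" and p: "\<And>x. x \<in> {m..M} \<Longrightarrow> \<bar>h x - poly p x\<bar> \<le> e"
    and \<xi>: "\<And>k. k \<le> degree p \<Longrightarrow> (blinfun_apply A ^^ k) \<xi> \<in> F"
  shows "\<bar>inner ((cfc H h A) \<cdot> \<xi>) \<xi> - inner ((cfc F h (compression F A)) \<cdot> \<xi>) \<xi>\<bar> \<le> 2 * e * inner \<xi> \<xi>"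
proof -
  note AF = compression_form_bounds[OF F FH A]
  have approx: "\<bar>inner ((cfc G h B) \<cdot> \<xi>) \<xi> - inner ((poly_op G p B) \<cdot> \<xi>) \<xi>\<bar> \<le> e * inner \<xi> \<xi>"
    if "hilbert_space G" "form_bounds G m M B" for G :: "'a set" and B
  proof -
    have "norm (cfc G h B - poly_op G p B) * inner \<xi> \<xi> \<le> e * inner \<xi> \<xi>"
      by (intro mult_right_mono cfc_approx[OF that h \<open>0 \<le> e\<close> p]) auto
    then show ?thesis using inner_blinfun_le[of "cfc G h B - poly_op G p B" \<xi>]
      by (simp add: blinfun.bilinear_simps inner_diff_left)
  qed
  have "(poly_op F p (compression F A)) \<cdot> \<xi> = (poly_op H p A) \<cdot> \<xi>"
    by (rule compression_poly[OF F H FH]) (rule \<xi>)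
  then show ?thesis using approx[OF H A] approx[OF F AF] by (simp add: abs_le_iff)
qed

text \<open>For a fixed vector, all three functions of operators are replaced up to \<open>2 e \<parallel>\<xi>\<parallel>\<^sup>2\<close> by the
  corresponding functions of compressions to one finite-dimensional space, where the doubling argument
  applies.\<close>

lemma monotone_imp_concave:
  fixes H :: "'u::hilbert_universe set"
  assumes mono: "\<And>K::'u set. hilbert_space K \<Longrightarrow> monotone_on_space K h"
    and h: "continuous_on {0<..} h" and H: "hilbert_space H" and m: "0 < m"
    and A: "form_bounds H m M A" and B: "form_bounds H m M B" and \<alpha>: "0 \<le> \<alpha>" "\<alpha> \<le> 1" and \<xi>: "\<xi> \<in> H"
  shows "(1 - \<alpha>) * inner ((cfc H h A) \<cdot> \<xi>) \<xi> + \<alpha> * inner ((cfc H h B) \<cdot> \<xi>) \<xi>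
    \<le> inner ((cfc H h ((1 - \<alpha>) *\<^sub>R A + \<alpha> *\<^sub>R B)) \<cdot> \<xi>) \<xi>" (is "?l \<le> ?r")
proof (rule field_le_epsilon)
  fix d :: real assume "0 < d"
  define C where "C = (1 - \<alpha>) *\<^sub>R A + \<alpha> *\<^sub>R B"
  have C: "form_bounds H m M C" unfolding C_def by (rule weighted_form_bounds[OF H A B \<alpha>])
  have hc: "continuous_on {m..M} h" by (rule continuous_on_subset[OF h]) (use m in auto)
  define e where "e = d / (4 * (inner \<xi> \<xi> + 1))"
  have "0 < inner \<xi> \<xi> + 1" by (simp add: add_nonneg_pos)
  then have e: "0 < e" "4 * e * inner \<xi> \<xi> \<le> d" using \<open>0 < d\<close> by (simp_all add: e_def field_simps)
  obtain p where p: "\<And>x. x \<in> {m..M} \<Longrightarrow> \<bar>h x - poly p x\<bar> \<le> e" using polynomial_approximation[OF hc e(1)] by blast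
  define S where "S = (\<Union>T\<in>{A, B, C}. (\<lambda>k. (blinfun_apply T ^^ k) \<xi>) ` {..degree p})"
  have pow: "(blinfun_apply T ^^ k) \<xi> \<in> H" if "T \<in> operators H" for T k
    by (induction k) (simp_all add: \<xi> operators_in[OF that])
  have "finite S" "S \<subseteq> H" using pow form_boundsD(2)[OF A] form_boundsD(2)[OF B] form_boundsD(2)[OF C]
    by (auto simp: S_def)
  from orthonormal_spanning[OF H this]
  obtain n b where b: "orthonormal n b" "\<And>i. i < n \<Longrightarrow> b i \<in> H" "S \<subseteq> fin_span n b" by blast
  define F where "F = fin_span n b"
  have F: "hilbert_space F" "F \<subseteq> H" unfolding F_def by (rule fin_span_hilbert_space) (rule fin_span_subset[OF H b(2)])
  obtain K E1 E2 E1' E2' where D: "doubling F K E1 E2 E1' E2'" using doubling_exists[OF b(1)] unfolding F_def by blast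
  have K: "(blinfun_apply T ^^ k) \<xi> \<in> F" if "T \<in> {A, B, C}" "k \<le> degree p" for T k
    using b(3) that by (auto simp: S_def F_def)
  have \<xi>F: "\<xi> \<in> F" using K[of A 0] by simp
  have "compression F C = (1 - \<alpha>) *\<^sub>R compression F A + \<alpha> *\<^sub>R compression F B"
    by (simp add: C_def compression_def compose_simps)
  then have conc: "(1 - \<alpha>) * inner ((cfc F h (compression F A)) \<cdot> \<xi>) \<xi> + \<alpha> * inner ((cfc F h (compression F B)) \<cdot> \<xi>) \<xi>
      \<le> inner ((cfc F h (compression F C)) \<cdot> \<xi>) \<xi>"
    using doubling_concave[OF D mono[OF doubling_spaces(2)[OF D]] h m compression_form_bounds[OF F A]
        compression_form_bounds[OF F B] \<alpha> \<xi>F] by simp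
  have close: "\<bar>inner ((cfc H h T) \<cdot> \<xi>) \<xi> - inner ((cfc F h (compression F T)) \<cdot> \<xi>) \<xi>\<bar> \<le> 2 * e * inner \<xi> \<xi>"
    if "T \<in> {A, B, C}" "form_bounds H m M T" for T
    by (rule compression_cfc[OF F(1) H F(2) that(2) hc less_imp_le[OF e(1)]]) (fact p, fact K[OF that(1)])
  have "(1 - \<alpha>) * (inner ((cfc H h A) \<cdot> \<xi>) \<xi> - inner ((cfc F h (compression F A)) \<cdot> \<xi>) \<xi>)
      + \<alpha> * (inner ((cfc H h B) \<cdot> \<xi>) \<xi> - inner ((cfc F h (compression F B)) \<cdot> \<xi>) \<xi>)
      \<le> (1 - \<alpha>) * (2 * e * inner \<xi> \<xi>) + \<alpha> * (2 * e * inner \<xi> \<xi>)"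
    using \<alpha> close[OF _ A] close[OF _ B] by (intro add_mono mult_left_mono) auto
  also have "\<dots> = 2 * e * inner \<xi> \<xi>" by (simp add: algebra_simps)
  finally show "?l \<le> ?r + d"
    using conc close[OF _ C] e(2) unfolding C_def[symmetric] by (simp add: algebra_simps abs_le_iff)
qed

section \<open>Operator monotone decreasing functions\<close>

lemma op_monotone_decreasing_form:
  fixes K :: "'u::hilbert_universe set"
  assumes g: "operator_monotone_decreasing TYPE('u) g" and K: "hilbert_space K" and m: "0 < m"
    and X: "form_bounds K m M X" and Y: "form_bounds K m M Y"
    and le: "\<And>z. z \<in> K \<Longrightarrow> inner (X \<cdot> z) z \<le> inner (Y \<cdot> z) z" and z: "z \<in> K"
  shows "inner ((cfc K g Y) \<cdot> z) z \<le> inner ((cfc K g X) \<cdot> z) z"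
proof -
  have gc: "continuous_on {m..M} g"
    by (rule continuous_on_subset[of "{0<..}"]) (use g m in \<open>auto simp: operator_monotone_decreasing_def\<close>)
  have "op_le K X Y" using le by (simp add: op_le_iff[OF K form_boundsD(1)[OF X] form_boundsD(1)[OF Y]])
  then have "op_le K (cfc K g Y) (cfc K g X)"
    using g K positive_definite_onI[OF K X m] positive_definite_onI[OF K Y m]
    by (auto simp: operator_monotone_decreasing_def)
  then show ?thesis
    using z by (simp add: op_le_iff[OF K cfc_self_adjoint[OF K Y gc] cfc_self_adjoint[OF K X gc]])
qed

lemma cfc_reciprocal:
  assumes K: "hilbert_space K" and X: "form_bounds K m M X" and f: "continuous_on {m..M} f"
    and pos: "\<And>x. x \<in> {m..M} \<Longrightarrow> 0 < f x" and z: "z \<in> K"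
  shows "(cfc K f X) \<cdot> ((cfc K (\<lambda>x. 1 / f x) X) \<cdot> z) = z"
    and "(cfc K (\<lambda>x. 1 / f x) X) \<cdot> ((cfc K f X) \<cdot> z) = z"
proof -
  have f': "continuous_on {m..M} (\<lambda>x. 1 / f x)"
    by (intro continuous_intros f) (use pos in force)
  have "cfc K f X o\<^sub>L cfc K (\<lambda>x. 1 / f x) X = cfc K (\<lambda>x. 1) X"
    "cfc K (\<lambda>x. 1 / f x) X o\<^sub>L cfc K f X = cfc K (\<lambda>x. 1) X"
    unfolding cfc_mult[OF K X f f', symmetric] cfc_mult[OF K X f' f, symmetric]
    by (rule cfc_cong[OF K X]; use pos in force)+
  then have "(cfc K f X o\<^sub>L cfc K (\<lambda>x. 1 / f x) X) \<cdot> z = z"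
    "(cfc K (\<lambda>x. 1 / f x) X o\<^sub>L cfc K f X) \<cdot> z = z"
    using cfc_const[OF K X, of 1] ident(2)[OF K z] by simp_all
  then show "(cfc K f X) \<cdot> ((cfc K (\<lambda>x. 1 / f x) X) \<cdot> z) = z"
    "(cfc K (\<lambda>x. 1 / f x) X) \<cdot> ((cfc K f X) \<cdot> z) = z" by simp_all
qed

lemma reciprocal_monotone:
  fixes K :: "'u::hilbert_universe set"
  assumes g: "operator_monotone_decreasing TYPE('u) g" and pos: "\<And>x. 0 < x \<Longrightarrow> 0 < g x + c"
    and K: "hilbert_space K"
  shows "monotone_on_space K (\<lambda>x. 1 / (g x + c))"
  unfolding monotone_on_space_def
proof (intro allI impI ballI)
  fix m M X Y z
  assume m: "0 < m" and X: "form_bounds K m M X" and Y: "form_bounds K m M Y"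
    and le: "\<forall>z\<in>K. inner (X \<cdot> z) z \<le> inner (Y \<cdot> z) z" and z: "z \<in> K"
  let ?k = "\<lambda>x. g x + c"
  have gc: "continuous_on {m..M} g"
    by (rule continuous_on_subset[of "{0<..}"]) (use g m in \<open>auto simp: operator_monotone_decreasing_def\<close>)
  then have kc: "continuous_on {m..M} ?k" by (intro continuous_intros)
  have kpos: "\<And>x. x \<in> {m..M} \<Longrightarrow> 0 < ?k x" using pos m by auto
  have hc: "continuous_on {m..M} (\<lambda>x. 1 / ?k x)" by (intro continuous_intros kc) (use kpos in force)
  have split: "cfc K ?k T = cfc K g T + c *\<^sub>R ident K" if "form_bounds K m M T" for T
    by (simp add: cfc_add[OF K that gc] cfc_const[OF K that])
  have kle: "inner ((cfc K ?k Y) \<cdot> w) w \<le> inner ((cfc K ?k X) \<cdot> w) w" if "w \<in> K" for w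
    using op_monotone_decreasing_form[OF g K m X Y _ that] le
    by (simp add: split[OF X] split[OF Y] blinfun.bilinear_simps inner_add_left)
  have kY: "0 \<le> inner ((cfc K ?k Y) \<cdot> w) w" if "w \<in> K" for w
    using cfc_mono[OF K Y _ kc _ that, of "\<lambda>x. 0"] kpos by (force simp: cfc_const[OF K Y])
  show "inner ((cfc K (\<lambda>x. 1 / ?k x) X) \<cdot> z) z \<le> inner ((cfc K (\<lambda>x. 1 / ?k x) Y) \<cdot> z) z"
    by (rule inverse_antitone[OF K cfc_self_adjoint[OF K Y kc] kY kle cfc_operators[OF K Y hc] _
          cfc_operators[OF K X hc] _ z])
      (use cfc_reciprocal(1)[OF K Y kc kpos] cfc_reciprocal(1)[OF K X kc kpos] in blast)+
qed

lemma scalar_form_bounds: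
  assumes H: "hilbert_space H" and "m \<le> r" "r \<le> M"
  shows "form_bounds H m M (r *\<^sub>R ident H)"
  using assms by (auto simp: form_bounds_def blinfun.bilinear_simps ident(2)[OF H]
      intro!: self_adjoint_scaleR[OF H] self_adjoint_ident[OF H] mult_right_mono)

lemma scalar_cfc_form:
  assumes H: "hilbert_space H" and \<xi>: "\<xi> \<in> H"
  shows "inner ((cfc H f (r *\<^sub>R ident H)) \<cdot> \<xi>) \<xi> = f r * inner \<xi> \<xi>"
proof -
  note r = scalar_form_bounds[OF H order_refl order_refl, of r]
  have "cfc H f (r *\<^sub>R ident H) = cfc H (\<lambda>x. f r) (r *\<^sub>R ident H)"
    by (rule cfc_cong[OF H r]) auto
  then show ?thesis by (simp add: cfc_const[OF H r] blinfun.bilinear_simps ident(2)[OF H \<xi>])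
qed

text \<open>A positive concave function \<open>h\<close> on the half-line satisfies \<open>h (l x) \<le> l h x\<close>, because \<open>x\<close>
  is almost a convex combination of a point near 0 and \<open>l x\<close>.  Apply this to
  \<open>h = 1 / (g + c)\<close>; the shift by \<open>c\<close> avoids zeros of \<open>g\<close>.\<close>

lemma dilation_bound:
  fixes H :: "'u::hilbert_universe set"
  assumes g0: "\<And>x. 0 < x \<Longrightarrow> 0 \<le> g x" and g: "operator_monotone_decreasing TYPE('u) g"
    and H: "hilbert_space H" and \<xi>: "\<xi> \<in> H" "\<xi> \<noteq> 0" and x: "0 < x" and l: "1 \<le> l"
  shows "g x \<le> l * g (l * x)"
proof -
  have ii: "0 < inner \<xi> \<xi>" using \<xi> by simp
  have lx: "x \<le> l * x" "0 < l * x" using x l by auto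
  have shifted: "g x + c \<le> l * (g (l * x) + c)" if c: "0 < c" for c
  proof -
    let ?h = "\<lambda>x. 1 / (g x + c)"
    have pos: "0 < g y + c" if "0 < y" for y using g0[OF that] c by linarith
    have hpos: "0 < ?h y" if "0 < y" for y using pos[OF that] by simp
    have gc: "continuous_on {0<..} g" using g by (simp add: operator_monotone_decreasing_def)
    have hc: "continuous_on {0<..} ?h" by (intro continuous_intros gc) (use pos in force)
    have conc: "(x - d) * ?h (l * x) \<le> (l * x - d) * ?h x" if d: "0 < d" "d < x" for d
    proof -
      define w where "w = (x - d) / (l * x - d)"
      have den: "0 < l * x - d" using d lx by linarith
      have w: "0 \<le> w" "w \<le> 1" using d lx den by (auto simp: w_def)
      have "w * (l * x - d) = x - d" using den by (simp add: w_def)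
      then have comb: "(1 - w) * d + w * (l * x) = x" by (simp add: algebra_simps)
      have "(1 - w) * (?h d * inner \<xi> \<xi>) + w * (?h (l * x) * inner \<xi> \<xi>) \<le> ?h x * inner \<xi> \<xi>"
        using monotone_imp_concave[OF reciprocal_monotone[OF g pos] hc H d(1)
            scalar_form_bounds[OF H, of d d "l * x"] scalar_form_bounds[OF H, of d "l * x" "l * x"] w \<xi>(1)] d lx
        by (simp only: scalar_cfc_form[OF H \<xi>(1)] comb scaleR_scaleR flip: scaleR_add_left)
      then have "(1 - w) * ?h d + w * ?h (l * x) \<le> ?h x"
        using ii by (simp only: mult.assoc[symmetric] distrib_right[symmetric] mult_le_cancel_right_pos)
      moreover have "0 \<le> (1 - w) * ?h d" using w hpos[OF d(1)] by (intro mult_nonneg_nonneg) auto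
      ultimately have "w * ?h (l * x) \<le> ?h x" by linarith
      then have "(l * x - d) * (w * ?h (l * x)) \<le> (l * x - d) * ?h x" using den by (intro mult_left_mono) auto
      then show ?thesis using den by (simp add: w_def)
    qed
    have "x * ?h (l * x) \<le> l * x * ?h x"
    proof (rule tendsto_le[of "at_right 0"])
      show "((\<lambda>d. (l * x - d) * ?h x) \<longlongrightarrow> l * x * ?h x) (at_right 0)"
        by (rule tendsto_eq_intros refl | simp)+
      show "((\<lambda>d. (x - d) * ?h (l * x)) \<longlongrightarrow> x * ?h (l * x)) (at_right 0)"
        by (rule tendsto_eq_intros refl | simp)+
      show "\<forall>\<^sub>F d in at_right 0. (x - d) * ?h (l * x) \<le> (l * x - d) * ?h x"
        unfolding eventually_at_right_field using x conc by blast
    qed simp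
    then have "x * ?h (l * x) \<le> x * (l * ?h x)" by (simp add: mult_ac)
    then have "?h (l * x) \<le> l * ?h x" using x by (simp only: mult_le_cancel_left_pos)
    then show ?thesis using pos[OF x] pos[OF lx(2)] by (simp add: field_simps)
  qed
  show ?thesis
  proof (rule field_le_epsilon)
    fix e :: real assume "0 < e"
    then have "g x + e / l \<le> l * (g (l * x) + e / l)" using l by (intro shifted) simp
    also have "\<dots> = l * g (l * x) + e" using l by (simp add: distrib_left)
    finally show "g x \<le> l * g (l * x) + e" using \<open>0 < e\<close> l by (smt (verit) divide_pos_pos)
  qed
qed

text \<open>A zero of \<open>g\<close> spreads to the right by monotonicity and to the left by the dilation bound.\<close>

lemma vanishing_dichotomy:
  fixes H :: "'u::hilbert_universe set"
  assumes g0: "\<And>x. 0 < x \<Longrightarrow> 0 \<le> g x" and g: "operator_monotone_decreasing TYPE('u) g"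
    and H: "hilbert_space H" and \<xi>: "\<xi> \<in> H" "\<xi> \<noteq> 0"
  shows "(\<forall>x>0. g x = 0) \<or> (\<forall>x>0. 0 < g x)"
proof (rule disjCI)
  assume "\<not> (\<forall>x>0. 0 < g x)"
  then obtain x0 where x0: "0 < x0" "g x0 = 0" using g0 by force
  have "g x \<le> 0" if x: "0 < x" for x
  proof (cases "x0 \<le> x")
    case True
    have "g x * inner \<xi> \<xi> \<le> g x0 * inner \<xi> \<xi>"
      using op_monotone_decreasing_form[OF g H x0(1) scalar_form_bounds[OF H, of x0 x0 x]
          scalar_form_bounds[OF H, of x0 x x] _ \<xi>(1)] True
      by (simp add: scalar_cfc_form[OF H \<xi>(1)] blinfun.bilinear_simps ident(2)[OF H] mult_right_mono)
    moreover have "0 < inner \<xi> \<xi>" using \<xi>(2) by simp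
    ultimately show ?thesis using x0 by (simp add: mult_le_0_iff)
  next
    case False
    then show ?thesis using dilation_bound[OF g0 g H \<xi> x, of "x0 / x"] x x0 by simp
  qed
  then show "\<forall>x>0. g x = 0" using g0 by force
qed

section \<open>A reverse arithmetic-geometric mean inequality\<close>

text \<open>The logarithm of the quotient of both means vanishes to second order at \<open>x = 1\<close>.\<close>

lemma reverse_young_ge_1:
  fixes \<alpha> x :: real
  assumes \<alpha>: "0 \<le> \<alpha>" "\<alpha> \<le> 1" and x: "1 \<le> x"
  shows "ln (1 - \<alpha> + \<alpha> * x) - \<alpha> * ln x \<le> \<alpha> * (1 - \<alpha>) / 2 * (x - 1)\<^sup>2"
proof -
  define f where "f y = \<alpha> * (1 - \<alpha>) / 2 * (y - 1)\<^sup>2 - ln (1 - \<alpha> + \<alpha> * y) + \<alpha> * ln y" for y :: real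
  have "f 1 \<le> f x"
  proof (rule DERIV_nonneg_imp_nondecreasing[OF x])
    fix y :: real assume y: "1 \<le> y" "y \<le> x"
    have "\<alpha> * 1 \<le> \<alpha> * y" using \<alpha> y by (intro mult_left_mono) auto
    then have w: "1 \<le> 1 - \<alpha> + \<alpha> * y" by simp
    have d: "(f has_real_derivative (\<alpha> * (1 - \<alpha>) * (y - 1) - \<alpha> / (1 - \<alpha> + \<alpha> * y) + \<alpha> / y)) (at y)"
      unfolding f_def by (rule derivative_eq_intros refl | use w y in simp)+
    have "\<alpha> * (1 - \<alpha>) * (y - 1) - \<alpha> / (1 - \<alpha> + \<alpha> * y) + \<alpha> / y
        = \<alpha> * (1 - \<alpha>) * (y - 1) * (1 - 1 / (y * (1 - \<alpha> + \<alpha> * y)))"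
    proof -
      have "\<alpha> / (1 - \<alpha> + \<alpha> * y) - \<alpha> / y = \<alpha> * (1 - \<alpha>) * (y - 1) / (y * (1 - \<alpha> + \<alpha> * y))"
        using w y by (simp add: diff_frac_eq algebra_simps)
      then show ?thesis by (simp add: right_diff_distrib)
    qed
    moreover have "1 * 1 \<le> y * (1 - \<alpha> + \<alpha> * y)" using w y by (intro mult_mono) auto
    ultimately show "\<exists>D. (f has_real_derivative D) (at y) \<and> 0 \<le> D"
      using d \<alpha> y w by (intro exI[of _ "\<alpha> * (1 - \<alpha>) * (y - 1) - \<alpha> / (1 - \<alpha> + \<alpha> * y) + \<alpha> / y"]) simp
  qed
  then show ?thesis by (simp add: f_def)
qed

text \<open>This is the constant of the theorem.  Both \<open>x\<close> and \<open>1 / x\<close> are at most \<open>max 1 t / min 1 s\<close>.\<close>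

lemma reverse_young:
  fixes \<alpha> x s t :: real
  assumes \<alpha>: "0 \<le> \<alpha>" "\<alpha> \<le> 1" and s: "0 < s" and x: "s \<le> x" "x \<le> t"
  shows "(1 - \<alpha>) + \<alpha> * x \<le> exp (\<alpha> * (1 - \<alpha>) / 2 * (max 1 t / min 1 s - 1)\<^sup>2) * x powr \<alpha>"
proof -
  define k where "k = max 1 t / min 1 s"
  have x0: "0 < x" using s x by simp
  have w: "0 < 1 - \<alpha> + \<alpha> * x"
  proof (cases "\<alpha> = 1")
    case False
    then show ?thesis using \<alpha> x0 by (intro add_pos_nonneg) auto
  qed (use x0 in simp)
  have mon: "\<alpha> * (1 - \<alpha>) / 2 * (y - 1)\<^sup>2 \<le> \<alpha> * (1 - \<alpha>) / 2 * (k - 1)\<^sup>2" if "1 \<le> y" "y \<le> k" for y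
    using \<alpha> that by (intro mult_left_mono power_mono) auto
  have "ln (1 - \<alpha> + \<alpha> * x) - \<alpha> * ln x \<le> \<alpha> * (1 - \<alpha>) / 2 * (k - 1)\<^sup>2"
  proof (cases "1 \<le> x")
    case True
    have "x * min 1 s \<le> max 1 t * 1" using x s x0 by (intro mult_mono) auto
    then have "x \<le> k" using s by (simp add: k_def pos_le_divide_eq)
    then show ?thesis using reverse_young_ge_1[OF \<alpha> True] mon[OF True] by linarith
  next
    \<comment> \<open>Exchanging the roles of the two means replaces \<open>x\<close> by \<open>1 / x\<close> and \<open>\<alpha>\<close> by \<open>1 - \<alpha>\<close>.\<close>
    case False
    then have y: "1 \<le> 1 / x" using x0 by simp
    have "min 1 s \<le> max 1 t * x"
      using mult_mono[of 1 "max 1 t" "min 1 s" x] x s by auto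
    then have yk: "1 / x \<le> k" using s x0 by (simp add: k_def field_simps)
    have "1 - (1 - \<alpha>) + (1 - \<alpha>) * (1 / x) = (1 - \<alpha> + \<alpha> * x) / x" using x0 by (simp add: field_simps)
    then have "ln (1 - (1 - \<alpha>) + (1 - \<alpha>) * (1 / x)) - (1 - \<alpha>) * ln (1 / x) = ln (1 - \<alpha> + \<alpha> * x) - \<alpha> * ln x"
      using w x0 by (simp add: ln_div algebra_simps)
    then show ?thesis using reverse_young_ge_1[of "1 - \<alpha>", OF _ _ y] mon[OF y yk] \<alpha> by (simp add: mult.commute)
  qed
  then have "ln (1 - \<alpha> + \<alpha> * x) \<le> \<alpha> * (1 - \<alpha>) / 2 * (k - 1)\<^sup>2 + \<alpha> * ln x" by simp
  then have "exp (ln (1 - \<alpha> + \<alpha> * x)) \<le> exp (\<alpha> * (1 - \<alpha>) / 2 * (k - 1)\<^sup>2 + \<alpha> * ln x)" by simp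
  then have "1 - \<alpha> + \<alpha> * x \<le> exp (\<alpha> * (1 - \<alpha>) / 2 * (k - 1)\<^sup>2 + \<alpha> * ln x)"
    by (simp only: exp_ln[OF w])
  then show ?thesis using x0 by (simp add: exp_add powr_def k_def)
qed

section \<open>The main inequalities\<close>

text \<open>Hoelder's inequality for the form of a geometric mean: \<open>y powr \<alpha>\<close> lies below its tangent at
  \<open>c = v / u\<close>, where \<open>u\<close> and \<open>v\<close> are the values of the two forms.\<close>

lemma geometric_mean_hoelder:
  assumes H: "hilbert_space H" and m: "0 < m" and S: "form_bounds H m M S" and T: "self_adjoint_on H T"
    and s: "0 < s"
    and sT: "\<And>x. x \<in> H \<Longrightarrow> s * inner (S \<cdot> x) x \<le> inner (T \<cdot> x) x"
    and tT: "\<And>x. x \<in> H \<Longrightarrow> inner (T \<cdot> x) x \<le> t * inner (S \<cdot> x) x"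
    and \<alpha>: "0 \<le> \<alpha>" "\<alpha> \<le> 1" and \<xi>: "\<xi> \<in> H"
  shows "inner ((geometric_mean H \<alpha> S T) \<cdot> \<xi>) \<xi>
    \<le> inner (S \<cdot> \<xi>) \<xi> powr (1 - \<alpha>) * inner (T \<cdot> \<xi>) \<xi> powr \<alpha>"
proof (cases "\<xi> = 0")
  case False
  define u v where "u = inner (S \<cdot> \<xi>) \<xi>" and "v = inner (T \<cdot> \<xi>) \<xi>"
  have "0 < m * inner \<xi> \<xi>" using m False by simp
  then have u: "0 < u" using form_boundsD(4)[OF S \<xi>] by (simp add: u_def)
  then have v: "0 < v" using sT[OF \<xi>] mult_pos_pos[OF s u] unfolding u_def v_def by linarith
  define c where "c = v / u"
  have c: "0 < c" using u v by (simp add: c_def)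
  have tangent: "y powr \<alpha> \<le> (1 - \<alpha>) * c powr \<alpha> + \<alpha> * c powr (\<alpha> - 1) * y" if "y \<in> {s..t}" for y
  proof -
    have y: "0 < y" using that s by simp
    have "c powr (1 - \<alpha>) * y powr \<alpha> \<le> (1 - \<alpha>) * c + \<alpha> * y"
      using \<alpha> c y by (intro Youngs_inequality_0) auto
    then have "c powr (\<alpha> - 1) * (c powr (1 - \<alpha>) * y powr \<alpha>) \<le> c powr (\<alpha> - 1) * ((1 - \<alpha>) * c + \<alpha> * y)"
      by (intro mult_left_mono) auto
    moreover have "c powr (\<alpha> - 1) * c powr (1 - \<alpha>) = 1" using c by (simp flip: powr_add)
    then have "c powr (\<alpha> - 1) * (c powr (1 - \<alpha>) * y powr \<alpha>) = y powr \<alpha>"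
      by (simp only: mult.assoc[symmetric] mult_1)
    moreover have "c powr (\<alpha> - 1) * c = c powr \<alpha>" using c by (simp add: powr_diff)
    then have "c powr (\<alpha> - 1) * ((1 - \<alpha>) * c + \<alpha> * y) = (1 - \<alpha>) * c powr \<alpha> + \<alpha> * c powr (\<alpha> - 1) * y"
      by (metis distrib_left mult.assoc mult.left_commute)
    ultimately show ?thesis by simp
  qed
  have "inner ((geometric_mean H \<alpha> S T) \<cdot> \<xi>) \<xi>
      \<le> (1 - \<alpha>) * c powr \<alpha> * u + \<alpha> * c powr (\<alpha> - 1) * v"
    unfolding u_def v_def by (rule geometric_mean_le_linear[OF H S m T s sT tT \<xi> tangent])
  also have "c powr \<alpha> * u = u powr (1 - \<alpha>) * v powr \<alpha>"
    using u v by (simp add: c_def powr_divide powr_diff)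
  then have "(1 - \<alpha>) * c powr \<alpha> * u = (1 - \<alpha>) * (u powr (1 - \<alpha>) * v powr \<alpha>)" by (simp only: mult.assoc)
  also have "c powr (\<alpha> - 1) * v = u powr (1 - \<alpha>) * v powr \<alpha>"
    using u v by (simp add: c_def powr_divide powr_diff)
  then have "\<alpha> * c powr (\<alpha> - 1) * v = \<alpha> * (u powr (1 - \<alpha>) * v powr \<alpha>)" by (simp only: mult.assoc)
  finally show ?thesis unfolding u_def v_def by (simp add: algebra_simps)
qed simp

text \<open>Concavity of \<open>1 / g\<close> bounds \<open>g\<close> of the arithmetic mean by the harmonic mean of \<open>g(P)\<close> and
  \<open>g(Q)\<close>, which lies below the geometric mean.\<close>

lemma op_monotone_decreasing_geometrically_convex:
  fixes H :: "'u::hilbert_universe set"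
  assumes g: "operator_monotone_decreasing TYPE('u) g" and pos: "\<And>x. 0 < x \<Longrightarrow> 0 < g x"
    and H: "hilbert_space H" and m: "0 < m" and P: "form_bounds H m M P" and Q: "form_bounds H m M Q"
    and \<alpha>: "0 \<le> \<alpha>" "\<alpha> \<le> 1"
  shows "self_adjoint_on H (geometric_mean H \<alpha> (cfc H g P) (cfc H g Q))"
    and "\<And>x. x \<in> H \<Longrightarrow> inner ((cfc H g ((1 - \<alpha>) *\<^sub>R P + \<alpha> *\<^sub>R Q)) \<cdot> x) x
      \<le> inner ((geometric_mean H \<alpha> (cfc H g P) (cfc H g Q)) \<cdot> x) x"
    and "\<And>x. x \<in> H \<Longrightarrow> inner ((geometric_mean H \<alpha> (cfc H g P) (cfc H g Q)) \<cdot> x) x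
      \<le> inner ((cfc H g P) \<cdot> x) x powr (1 - \<alpha>) * inner ((cfc H g Q) \<cdot> x) x powr \<alpha>"
proof -
  let ?S = "cfc H g P" and ?T = "cfc H g Q" and ?C = "(1 - \<alpha>) *\<^sub>R P + \<alpha> *\<^sub>R Q" and ?h = "\<lambda>x. 1 / g x"
  have g1: "continuous_on {0<..} g" using g by (simp add: operator_monotone_decreasing_def)
  have gc: "continuous_on {m..M} g" by (rule continuous_on_subset[OF g1]) (use m in auto)
  have h1: "continuous_on {0<..} ?h" by (intro continuous_intros g1) (use pos in force)
  have hc: "continuous_on {m..M} ?h" by (rule continuous_on_subset[OF h1]) (use m in auto)
  have gpos: "\<And>x. x \<in> {m..M} \<Longrightarrow> 0 < g x" using pos m by auto
  obtain a b where ab: "0 < a" "a \<le> b" "\<And>x. x \<in> {m..M} \<Longrightarrow> a \<le> g x" "\<And>x. x \<in> {m..M} \<Longrightarrow> g x \<le> b"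
    using positive_Icc_bounds[OF gc gpos] by blast
  have S: "form_bounds H a b ?S" and T: "form_bounds H a b ?T"
    by (rule cfc_form_bounds[OF H P gc ab(3,4,2)], assumption+) (rule cfc_form_bounds[OF H Q gc ab(3,4,2)], assumption+)
  have C: "form_bounds H m M ?C" by (rule weighted_form_bounds[OF H P Q \<alpha>])
  have s: "0 < a / b" using ab by simp
  have sT: "a / b * inner (?S \<cdot> x) x \<le> inner (?T \<cdot> x) x" if "x \<in> H" for x
  proof -
    have "a / b * inner (?S \<cdot> x) x \<le> a / b * (b * inner x x)"
      using s form_boundsD(5)[OF S that] by (intro mult_left_mono) auto
    then show ?thesis using form_boundsD(4)[OF T that] ab(1,2) by simp
  qed
  have tT: "inner (?T \<cdot> x) x \<le> b / a * inner (?S \<cdot> x) x" if "x \<in> H" for x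
  proof -
    have "b / a * (a * inner x x) \<le> b / a * inner (?S \<cdot> x) x"
      using ab form_boundsD(4)[OF S that] by (intro mult_left_mono) auto
    then show ?thesis using form_boundsD(5)[OF T that] ab(1,2) by simp
  qed
  note Tsa = form_boundsD(1)[OF T]
  show gm: "self_adjoint_on H (geometric_mean H \<alpha> ?S ?T)"
    by (rule geometric_mean_self_adjoint[OF H S ab(1) Tsa s sT tT])
  show "inner ((geometric_mean H \<alpha> ?S ?T) \<cdot> x) x
      \<le> inner (?S \<cdot> x) x powr (1 - \<alpha>) * inner (?T \<cdot> x) x powr \<alpha>" if "x \<in> H" for x
    by (rule geometric_mean_hoelder[OF H ab(1) S Tsa s sT tT \<alpha> that])
  show "inner ((cfc H g ?C) \<cdot> x) x \<le> inner ((geometric_mean H \<alpha> ?S ?T) \<cdot> x) x"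
    if x: "x \<in> H" for x
  proof -
    obtain U where U: "self_adjoint_on H U" "\<And>x. x \<in> H \<Longrightarrow> 0 \<le> inner (U \<cdot> x) x"
      "\<And>x. x \<in> H \<Longrightarrow> U \<cdot> ((geometric_mean H \<alpha> ?S ?T) \<cdot> x) = x"
      "\<And>x. x \<in> H \<Longrightarrow> inner (U \<cdot> x) x
         \<le> (1 - \<alpha>) * inner ((cfc H ?h P) \<cdot> x) x + \<alpha> * inner ((cfc H ?h Q) \<cdot> x) x"
      by (rule geometric_mean_inverse[OF H S ab(1) Tsa s sT tT \<alpha> cfc_operators[OF H P hc] cfc_reciprocal(1)[OF H P gc gpos]
          cfc_operators[OF H Q hc] cfc_reciprocal(1)[OF H Q gc gpos]]) blast+
    have mono: "monotone_on_space K ?h" if "hilbert_space K" for K :: "'u set"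
      using reciprocal_monotone[OF g _ that, of 0] pos by simp
    have "inner (U \<cdot> y) y \<le> inner ((cfc H ?h ?C) \<cdot> y) y" if "y \<in> H" for y
      using U(4)[OF that] monotone_imp_concave[OF mono h1 H m P Q \<alpha> that] by linarith
    from inverse_antitone[OF H U(1,2) this self_adjoint_onD(1)[OF gm] U(3) cfc_operators[OF H C gc] _ x]
    show ?thesis using cfc_reciprocal(2)[OF H C gc gpos] by blast
  qed
qed

text \<open>On a non-zero space a zero of \<open>g\<close> makes \<open>g\<close> vanish identically, and on the zero space every operator
  is zero.\<close>

lemma cfc_eq_0_of_zero:
  fixes H :: "'u::hilbert_universe set"
  assumes g0: "\<And>x. 0 < x \<Longrightarrow> 0 \<le> g x" and g: "operator_monotone_decreasing TYPE('u) g" and H: "hilbert_space H"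
    and nz: "\<not> (\<forall>x>0. 0 < g x)" and m: "0 < m" and X: "form_bounds H m M X"
  shows "cfc H g X = 0"
proof -
  have gc: "continuous_on {m..M} g"
    by (rule continuous_on_subset[of "{0<..}"]) (use g m in \<open>auto simp: operator_monotone_decreasing_def\<close>)
  show ?thesis
  proof (cases "\<exists>\<xi>\<in>H. \<xi> \<noteq> 0")
    case True
    then have "\<forall>x>0. g x = 0" using vanishing_dichotomy[OF g0 g H] nz by blast
    then have "cfc H g X = cfc H (\<lambda>x. 0) X" by (intro cfc_cong[OF H X]) (use m in auto)
    then show ?thesis by (simp add: cfc_const[OF H X])
  next
    case False
    show ?thesis
      by (rule operators_eqI[OF H cfc_operators[OF H X gc] operators_zero[OF H]]) (use False in auto)
  qed
qed

theorem theorem3p3: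
  fixes g :: "real \<Rightarrow> real"
    and p q s t :: real
    and H :: "'u::hilbert_universe set"
    and A B :: "'u \<Rightarrow>\<^sub>L 'u"
  assumes "\<And>x. 0 < x \<Longrightarrow> 0 \<le> g x"
    and "operator_monotone_decreasing TYPE('u) g"
    and "1 < p" and "1 < q" and "1 / p + 1 / q = 1"
    and "hilbert_space H"
    and "positive_definite_on H A" and "positive_definite_on H B"
    and "0 < s" and "0 < t"
    and "positive_definite_on H (s *\<^sub>R op_powr H A p)"
    and "op_le H (s *\<^sub>R op_powr H A p) (op_powr H B q)"
    and "op_le H (op_powr H B q) (t *\<^sub>R op_powr H A p)"
  shows "op_le H
           (cfc H g (geometric_mean H (1 / q) (op_powr H A p) (op_powr H B q)))
           (exp (1 / (2 * p * q) * (max 1 t / min 1 s - 1)\<^sup>2) *\<^sub>R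
              geometric_mean H (1 / q) (cfc H g (op_powr H A p)) (cfc H g (op_powr H B q))) \<and>
         (\<forall>\<xi>\<in>H.
           Re (cinner (blinfun_apply
                 (cfc H g (geometric_mean H (1 / q) (op_powr H A p) (op_powr H B q))) \<xi>) \<xi>)
           \<le> exp (1 / (2 * p * q) * (max 1 t / min 1 s - 1)\<^sup>2) *
              Re (cinner (blinfun_apply (cfc H g (op_powr H A p)) \<xi>) \<xi>) powr (1 / p) *
              Re (cinner (blinfun_apply (cfc H g (op_powr H B q)) \<xi>) \<xi>) powr (1 / q))"
proof -
  note g0 = assms(1) and g = assms(2) and H = assms(6) and s = assms(9)
  define P Q where "P = op_powr H A p" and "Q = op_powr H B q"
  define \<alpha> where "\<alpha> = 1 / q"
  have \<alpha>: "0 \<le> \<alpha>" "\<alpha> \<le> 1" "1 / p = 1 - \<alpha>" using assms(4,5) by (simp_all add: \<alpha>_def)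
  define l where "l = exp (1 / (2 * p * q) * (max 1 t / min 1 s - 1)\<^sup>2)"
  have "1 / (2 * p * q) = (1 / q) * (1 / p) / 2" by simp
  then have l_eq: "l = exp (\<alpha> * (1 - \<alpha>) / 2 * (max 1 t / min 1 s - 1)\<^sup>2)"
    unfolding l_def \<alpha>(3) by (simp add: \<alpha>_def)
  have l: "1 \<le> l" using assms(3,4) by (simp add: l_def)
  obtain a1 b1 where A: "0 < a1" "form_bounds H a1 b1 A" by (rule positive_definite_form_bounds[OF H assms(7)])
  obtain a2 b2 where B: "0 < a2" "form_bounds H a2 b2 B" by (rule positive_definite_form_bounds[OF H assms(8)])
  obtain m1 M1 where P1: "0 < m1" "form_bounds H m1 M1 P" unfolding P_def by (rule op_powr_form_bounds[OF H A(2,1)])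
  obtain m2 M2 where Q1: "0 < m2" "form_bounds H m2 M2 Q" unfolding Q_def by (rule op_powr_form_bounds[OF H B(2,1)])
  define m M where "m = min m1 m2" and "M = max M1 M2"
  have m: "0 < m" and P: "form_bounds H m M P" and Q: "form_bounds H m M Q"
    using P1(1) Q1(1) form_bounds_mono[OF P1(2)] form_bounds_mono[OF Q1(2)] by (auto simp: m_def M_def)
  note Psa = form_boundsD(1)[OF P] and Qsa = form_boundsD(1)[OF Q]
  have sQ: "s * inner (P \<cdot> x) x \<le> inner (Q \<cdot> x) x" if "x \<in> H" for x
    using assms(12) that unfolding P_def[symmetric] Q_def[symmetric] op_le_iff[OF H self_adjoint_scaleR[OF H Psa] Qsa]
    by (simp add: blinfun.bilinear_simps)
  have tQ: "inner (Q \<cdot> x) x \<le> t * inner (P \<cdot> x) x" if "x \<in> H" for x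
    using assms(13) that unfolding P_def[symmetric] Q_def[symmetric] op_le_iff[OF H Qsa self_adjoint_scaleR[OF H Psa]]
    by (simp add: blinfun.bilinear_simps)
  define G where "G = geometric_mean H \<alpha> P Q"
  define C where "C = (1 - \<alpha>) *\<^sub>R P + \<alpha> *\<^sub>R Q"
  have C: "form_bounds H m M C" unfolding C_def by (rule weighted_form_bounds[OF H P Q \<alpha>(1,2)])
  have Gsa: "self_adjoint_on H G" unfolding G_def by (rule geometric_mean_self_adjoint[OF H P m Qsa s sQ tQ])
  have CG: "inner (C \<cdot> x) x \<le> l * inner (G \<cdot> x) x" if "x \<in> H" for x
    using geometric_mean_ge_linear[OF H P m Qsa s sQ tQ that, where a = "1 - \<alpha>" and b = \<alpha> and c = l and \<alpha> = \<alpha>]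
      reverse_young[OF \<alpha>(1,2) s]
    by (simp add: l_eq C_def G_def blinfun.bilinear_simps inner_add_left)
  define N where "N = max M (l * norm G)"
  have lG: "form_bounds H m N (l *\<^sub>R G + 0 *\<^sub>R ident H)"
    unfolding form_bounds_def
  proof (intro conjI ballI)
    show "self_adjoint_on H (l *\<^sub>R G + 0 *\<^sub>R ident H)" using self_adjoint_scaleR[OF H Gsa] by simp
    fix x assume x: "x \<in> H"
    show "m * inner x x \<le> inner ((l *\<^sub>R G + 0 *\<^sub>R ident H) \<cdot> x) x"
      using CG[OF x] form_boundsD(4)[OF C x] by (simp add: blinfun.bilinear_simps)
    have "l * inner (G \<cdot> x) x \<le> l * (norm G * inner x x)"
      using l inner_blinfun_le[of G x] by (intro mult_left_mono) auto
    also have "\<dots> \<le> N * inner x x" unfolding mult.assoc[symmetric] by (intro mult_right_mono) (auto simp: N_def)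
    finally show "inner ((l *\<^sub>R G + 0 *\<^sub>R ident H) \<cdot> x) x \<le> N * inner x x"
      by (simp add: blinfun.bilinear_simps)
  qed
  have G: "form_bounds H (m / l) (N / l) G"
    unfolding form_bounds_def
  proof (intro conjI ballI Gsa)
    fix x assume x: "x \<in> H"
    show "m / l * inner x x \<le> inner (G \<cdot> x) x" "inner (G \<cdot> x) x \<le> N / l * inner x x"
      using form_boundsD(4,5)[OF lG x] l by (simp_all add: blinfun.bilinear_simps field_simps)
  qed
  have ml: "0 < m / l" using m l by simp
  let ?S = "cfc H g P" and ?T = "cfc H g Q"
  let ?K = "geometric_mean H \<alpha> ?S ?T"
  have "op_le H (cfc H g G) (l *\<^sub>R ?K) \<and> (\<forall>\<xi>\<in>H. inner ((cfc H g G) \<cdot> \<xi>) \<xi>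
      \<le> l * inner (?S \<cdot> \<xi>) \<xi> powr (1 - \<alpha>) * inner (?T \<cdot> \<xi>) \<xi> powr \<alpha>)"
  proof (cases "\<forall>x>0. 0 < g x")
    case True
    then have pos: "\<And>x. 0 < x \<Longrightarrow> 0 < g x" by blast
    have g1: "continuous_on {0<..} g" using g by (simp add: operator_monotone_decreasing_def)
    have gc: "continuous_on {m / l..N / l} g" by (rule continuous_on_subset[OF g1]) (use ml in auto)
    have gl: "continuous_on {m / l..N / l} (\<lambda>x. g (l * x))"
      proof (rule continuous_on_compose2[OF g1])
      show "(\<lambda>x. l * x) ` {m / l..N / l} \<subseteq> {0<..}"
      proof (rule image_subsetI)
        fix x assume "x \<in> {m / l..N / l}"
        then have "0 < x" using ml by (meson atLeastAtMost_iff less_le_trans)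
        then show "l * x \<in> {0<..}" using l by simp
      qed
    qed (intro continuous_intros)
    have gN: "continuous_on {m..N} g" by (rule continuous_on_subset[OF g1]) (use m in auto)
    have shift: "cfc H g (l *\<^sub>R G + 0 *\<^sub>R ident H) = cfc H (\<lambda>x. g (l * x)) G"
      using cfc_affine[OF H G lG gN] l by (simp add: field_simps)
    have C': "form_bounds H m N C" by (rule form_bounds_mono[OF C]) (simp_all add: N_def)
    have le1: "inner ((cfc H g G) \<cdot> x) x \<le> l * inner (?K \<cdot> x) x" if x: "x \<in> H" for x
    proof (cases "x = 0")
      case False
      have "inner ((cfc H g G) \<cdot> x) x \<le> inner ((cfc H (\<lambda>x. l * g (l * x)) G) \<cdot> x) x"
        by (rule cfc_mono[OF H G gc continuous_on_mult_left[OF gl] _ x], rule dilation_bound[OF g0 g H x False _ l])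
          (use ml in auto)
      also have "\<dots> = l * inner ((cfc H g (l *\<^sub>R G + 0 *\<^sub>R ident H)) \<cdot> x) x"
        by (simp only: cfc_cmult[OF H G gl] shift) (simp add: blinfun.bilinear_simps)
      also have "\<dots> \<le> l * inner ((cfc H g C) \<cdot> x) x"
        using l op_monotone_decreasing_form[OF g H m C' lG _ x] CG by (simp add: blinfun.bilinear_simps)
      also have "\<dots> \<le> l * inner (?K \<cdot> x) x"
        using l op_monotone_decreasing_geometrically_convex(2)[OF g pos H m P Q \<alpha>(1,2) x]
        by (intro mult_left_mono) (auto simp: C_def)
      finally show ?thesis .
    qed simp
    have "inner ((cfc H g G) \<cdot> x) x
        \<le> l * inner (?S \<cdot> x) x powr (1 - \<alpha>) * inner (?T \<cdot> x) x powr \<alpha>" if x: "x \<in> H" for x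
    proof -
      have "l * inner (?K \<cdot> x) x
          \<le> l * (inner (?S \<cdot> x) x powr (1 - \<alpha>) * inner (?T \<cdot> x) x powr \<alpha>)"
        using l op_monotone_decreasing_geometrically_convex(3)[OF g pos H m P Q \<alpha>(1,2) x]
        by (intro mult_left_mono) auto
      with le1[OF x] show ?thesis unfolding mult.assoc by linarith
    qed
    moreover have "op_le H (cfc H g G) (l *\<^sub>R ?K)"
      using le1 by (simp add: op_le_iff[OF H cfc_self_adjoint[OF H G gc] self_adjoint_scaleR[OF H
            op_monotone_decreasing_geometrically_convex(1)[OF g pos H m P Q \<alpha>(1,2)]]] blinfun.bilinear_simps)
    ultimately show ?thesis by blast
  next
    case False
    have zero: "cfc H g X = 0" if "0 < m'" "form_bounds H m' M' X" for X m' M'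
      by (rule cfc_eq_0_of_zero[OF _ g H False that]) (rule g0)
    have "cfc H g G = 0" "?S = 0" "?T = 0" using zero[OF ml G] zero[OF m P] zero[OF m Q] by auto
    moreover have "geometric_mean H \<alpha> 0 0 = 0" by (simp add: geometric_mean_def)
    moreover have "op_le H 0 0" by (simp add: op_le_def positive_on_def operators_zero[OF H])
    ultimately show ?thesis by simp
  qed
  then show ?thesis
    unfolding P_def[symmetric] Q_def[symmetric] \<alpha>(3) \<alpha>_def[symmetric] l_def[symmetric] G_def inner_eq_Re_cinner .
qed

end
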